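(* Let $A:[0,1]\to\mathbb{R}^{n\times n}$ and $B:[0,1]\to\mathbb{R}^{n\times m}$ be continuous with $(A(t),B(t))$ controllable. Let $m_0,m_1\in\mathbb{R}^n$, let $\Sigma_0,\Sigma_1$ be symmetric positive definite $n\times n$ matrices, and let $\rho_0,\rho_1$ be the Gaussian densities on $\mathbb{R}^n$ with means $m_0,m_1$ and covariances $\Sigma_0,\Sigma_1$. Let $\Pi_0(t)$, $t\in[0,1]$, be the solution of the Riccati equation $$\dot\Pi_0(t)+A(t)'\Pi_0(t)+\Pi_0(t)A(t)-\Pi_0(t)B(t)B(t)'\Pi_0(t)=0$$ with initial condition $$\Pi_0(0)=\Sigma_0^{-1/2}\Big[\Sigma_0^{1/2}\Phi_{10}'M_{10}^{-1}\Phi_{10}\Sigma_0^{1/2}-\big(\Sigma_0^{1/2}\Phi_{10}'M_{10}^{-1}\Sigma_1M_{10}^{-1}\Phi_{10}\Sigma_0^{1/2}\big)^{1/2}\Big]\Sigma_0^{-1/2}.$$ Let $\hat\Phi(t,s)$ be the state transition matrix of $A(t)-B(t)B(t)'\Pi_0(t)$, let $\hat M(t,s)=\int_s^t\hat\Phi(t,\tau)B(\tau)B(\tau)'\hat\Phi(t,\tau)'d\tau$, and let $$m(t)=\hat\Phi(1,t)'\hat M(1,0)^{-1}(m_1-\hat\Phi(1,0)m_0).$$ Let $\rho(t,\cdot)$ be the probability density of the process $x(t)$ defined by $$\dot x(t)=(A(t)-B(t)B(t)'\Pi_0(t))x(t)+B(t)B(t)'m(t),\qquad x(0)\sim\mathcal{N}(m_0,\Sigma_0),$$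 and let $$u(t,x)=-B(t)'\Pi_0(t)x+B(t)'m(t).$$ Then the pair $(\rho,u)$ is a solution (minimizer) of the problem $$\inf_{(\rho,u)}\int_{\mathbb{R}^n}\int_0^1\tfrac12\|u(t,x)\|^2\rho(t,x)\,dt\,dx$$ subject to $$\frac{\partial\rho}{\partial t}+\nabla\cdot\big((A(t)x+B(t)u)\rho\big)=0,\qquad \rho(0,x)=\rho_0(x),\quad\rho(1,y)=\rho_1(y).$$
   Context: Prime denotes transpose; square roots of positive (semi)definite matrices are the symmetric positive (semi)definite ones. $\Phi(t,s)$ is the state transition matrix of $\dot x=A(t)x$ ($\partial_t\Phi(t,s)=A(t)\Phi(t,s)$, $\Phi(s,s)=I$); similarly $\partial_t\hat\Phi(t,s)=(A(t)-B(t)B(t)'\Pi_0(t))\hat\Phi(t,s)$, $\hat\Phi(s,s)=I$. $M(t,s)=\int_s^t\Phi(t,\tau)B(\tau)B(\tau)'\Phi(t,\tau)'d\tau$; $\Phi_{10}=\Phi(1,0)$, $M_{10}=M(1,0)$. Controllability means that $M(t,s)$ is invertible for all $0\le s<t\le1$. In the minimization, $\rho(t,\cdot)$ ranges over flows of probability densities on $\mathbb{R}^n$ (weakly continuous in $t\in[0,1]$) with the prescribed boundary values, $u(t,x)$ over continuous feedback control laws $[0,1]\times\mathbb{R}^n\to\mathbb{R}^m$, and the continuity equation is understood weakly (tested against smooth compactly supported functions on $(0,1)\times\mathbb{R}^n$). *)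

theory Defs
  imports "HOL-Probability.Probability"
begin

section \<open>Positive definite matrices, square roots and Gaussian densities\<close>

definition pos_semidef :: "real^'n^'n \<Rightarrow> bool" where
  "pos_semidef S \<longleftrightarrow> transpose S = S \<and> (\<forall>x. 0 \<le> x \<bullet> (S *v x))"

definition pos_def :: "real^'n^'n \<Rightarrow> bool" where
  "pos_def S \<longleftrightarrow> transpose S = S \<and> (\<forall>x. x \<noteq> 0 \<longrightarrow> 0 < x \<bullet> (S *v x))"

definition msqrt :: "real^'n^'n \<Rightarrow> real^'n^'n" where
  "msqrt S = (THE R. pos_semidef R \<and> R ** R = S)"

definition gaussian_density :: "real^'n \<Rightarrow> real^'n^'n \<Rightarrow> real^'n \<Rightarrow> real" where
  "gaussian_density \<mu> S x =
     exp (- (1/2) * ((x - \<mu>) \<bullet> (matrix_inv S *v (x - \<mu>)))) / sqrt ((2 * pi) ^ CARD('n) * det S)"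


section \<open>Linear systems on the time interval [0,1]\<close>

text \<open>All time-dependent objects are functions on the whole real line of which only the values
  on [0,1] matter; derivatives at the end points are one-sided.  On [0,1] the transition
  matrix is uniquely determined by the following predicate when A is continuous.\<close>

definition transition_matrix ::
  "(real \<Rightarrow> real^'n^'n) \<Rightarrow> (real \<Rightarrow> real \<Rightarrow> real^'n^'n) \<Rightarrow> bool" where
  "transition_matrix A \<Phi> \<longleftrightarrow>
     (\<forall>s\<in>{0..1}. \<Phi> s s = mat 1 \<and>
        (\<forall>t\<in>{0..1}. ((\<lambda>t. \<Phi> t s) has_vector_derivative A t ** \<Phi> t s) (at t within {0..1})))"

definition gramian ::
  "(real \<Rightarrow> real^'m^'n) \<Rightarrow> (real \<Rightarrow> real \<Rightarrow> real^'n^'n) \<Rightarrow> real \<Rightarrow> real \<Rightarrow> real^'n^'n" where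
  "gramian B \<Phi> t s =
     integral {s..t} (\<lambda>\<tau>. \<Phi> t \<tau> ** B \<tau> ** transpose (B \<tau>) ** transpose (\<Phi> t \<tau>))"

text \<open>Controllability of (A, B), expressed through the transition matrix of A.\<close>

definition controllable ::
  "(real \<Rightarrow> real^'m^'n) \<Rightarrow> (real \<Rightarrow> real \<Rightarrow> real^'n^'n) \<Rightarrow> bool" where
  "controllable B \<Phi> \<longleftrightarrow> (\<forall>s t. 0 \<le> s \<and> s < t \<and> t \<le> 1 \<longrightarrow> invertible (gramian B \<Phi> t s))"

definition riccati_solution ::
  "(real \<Rightarrow> real^'n^'n) \<Rightarrow> (real \<Rightarrow> real^'m^'n) \<Rightarrow> (real \<Rightarrow> real^'n^'n) \<Rightarrow> bool" where
  "riccati_solution A B \<Pi>\<^sub>0 \<longleftrightarrow>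
     (\<forall>t\<in>{0..1}. (\<Pi>\<^sub>0 has_vector_derivative
        - (transpose (A t) ** \<Pi>\<^sub>0 t + \<Pi>\<^sub>0 t ** A t - \<Pi>\<^sub>0 t ** B t ** transpose (B t) ** \<Pi>\<^sub>0 t))
        (at t within {0..1}))"

definition riccati_init ::
  "real^'n^'n \<Rightarrow> real^'n^'n \<Rightarrow> real^'n^'n \<Rightarrow> real^'n^'n \<Rightarrow> real^'n^'n" where
  "riccati_init \<Sigma>\<^sub>0 \<Sigma>\<^sub>1 \<Phi>\<^sub>1\<^sub>0 M\<^sub>1\<^sub>0 =
     (let R = msqrt \<Sigma>\<^sub>0; N = matrix_inv M\<^sub>1\<^sub>0 in
      matrix_inv R **
        (R ** transpose \<Phi>\<^sub>1\<^sub>0 ** N ** \<Phi>\<^sub>1\<^sub>0 ** R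
          - msqrt (R ** transpose \<Phi>\<^sub>1\<^sub>0 ** N ** \<Sigma>\<^sub>1 ** N ** \<Phi>\<^sub>1\<^sub>0 ** R)) **
        matrix_inv R)"


section \<open>The minimization problem\<close>

fun higher_differentiable :: "nat \<Rightarrow> ('a::euclidean_space \<Rightarrow> real) \<Rightarrow> bool" where
  "higher_differentiable 0 f \<longleftrightarrow> continuous_on UNIV f"
| "higher_differentiable (Suc k) f \<longleftrightarrow>
     (\<forall>x. f differentiable (at x)) \<and>
     (\<forall>v. higher_differentiable k (\<lambda>x. frechet_derivative f (at x) v))"

definition smooth :: "('a::euclidean_space \<Rightarrow> real) \<Rightarrow> bool" where
  "smooth f \<longleftrightarrow> (\<forall>k. higher_differentiable k f)"

text \<open>Test functions on the open strip, extended by zero to all of space-time.\<close>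

definition test_function :: "(real \<times> (real^'n) \<Rightarrow> real) \<Rightarrow> bool" where
  "test_function \<phi> \<longleftrightarrow> smooth \<phi> \<and> compact (closure {z. \<phi> z \<noteq> 0}) \<and>
     closure {z. \<phi> z \<noteq> 0} \<subseteq> {0<..<1} \<times> UNIV"

text \<open>Densities are determined only up to null sets; joint Borel measurability selects versions
  for which the space-time integrals below make sense.\<close>

definition jointly_measurable_on_strip :: "(real \<Rightarrow> real^'n \<Rightarrow> real) \<Rightarrow> bool" where
  "jointly_measurable_on_strip \<rho> \<longleftrightarrow>
     (\<lambda>(t, x). \<rho> t x) \<in> borel_measurable (restrict_space borel {0..1} \<Otimes>\<^sub>M borel)"

definition density_flow :: "(real \<Rightarrow> real^'n \<Rightarrow> real) \<Rightarrow> bool" where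
  "density_flow \<rho> \<longleftrightarrow>
     jointly_measurable_on_strip \<rho> \<and>
     (\<forall>t\<in>{0..1}. (\<forall>x. 0 \<le> \<rho> t x) \<and> (\<integral>\<^sup>+x. ennreal (\<rho> t x) \<partial>lborel) = 1) \<and>
     (\<forall>f::real^'n \<Rightarrow> real. continuous_on UNIV f \<and> bounded (range f) \<longrightarrow>
        continuous_on {0..1} (\<lambda>t. LINT x|lborel. f x * \<rho> t x))"

text \<open>The Frechet derivative of \<phi> at (t, x) in direction (1, v) is the time derivative of \<phi>
  plus the inner product of its spatial gradient with v.  The integrand is a bounded function
  of compact support times \<rho> when u is continuous, so both integrals exist.\<close>

definition continuity_equation ::
  "(real \<Rightarrow> real^'n^'n) \<Rightarrow> (real \<Rightarrow> real^'m^'n) \<Rightarrow>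
   (real \<Rightarrow> real^'n \<Rightarrow> real) \<Rightarrow> (real \<Rightarrow> real^'n \<Rightarrow> real^'m) \<Rightarrow> bool" where
  "continuity_equation A B \<rho> u \<longleftrightarrow>
     (\<forall>\<phi>. test_function \<phi> \<longrightarrow>
        (LINT t:{0..1}|lborel. (LINT x|lborel.
           frechet_derivative \<phi> (at (t, x)) (1, A t *v x + B t *v u t x) * \<rho> t x)) = 0)"

definition feasible ::
  "(real \<Rightarrow> real^'n^'n) \<Rightarrow> (real \<Rightarrow> real^'m^'n) \<Rightarrow> (real^'n \<Rightarrow> real) \<Rightarrow> (real^'n \<Rightarrow> real) \<Rightarrow>
   (real \<Rightarrow> real^'n \<Rightarrow> real) \<Rightarrow> (real \<Rightarrow> real^'n \<Rightarrow> real^'m) \<Rightarrow> bool" where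
  "feasible A B \<rho>\<^sub>0 \<rho>\<^sub>1 \<rho> u \<longleftrightarrow>
     density_flow \<rho> \<and>
     continuous_on ({0..1} \<times> UNIV) (\<lambda>(t, x). u t x) \<and>
     continuity_equation A B \<rho> u \<and>
     (AE x in lborel. \<rho> 0 x = \<rho>\<^sub>0 x) \<and> (AE y in lborel. \<rho> 1 y = \<rho>\<^sub>1 y)"

definition cost ::
  "(real \<Rightarrow> real^'n \<Rightarrow> real) \<Rightarrow> (real \<Rightarrow> real^'n \<Rightarrow> real^'m) \<Rightarrow> ennreal" where
  "cost \<rho> u =
     (\<integral>\<^sup>+x. (\<integral>\<^sup>+t\<in>{0..1}. ennreal (1/2 * (norm (u t x))\<^sup>2 * \<rho> t x) \<partial>lborel) \<partial>lborel)"

definition minimizer ::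
  "(real \<Rightarrow> real^'n^'n) \<Rightarrow> (real \<Rightarrow> real^'m^'n) \<Rightarrow> (real^'n \<Rightarrow> real) \<Rightarrow> (real^'n \<Rightarrow> real) \<Rightarrow>
   (real \<Rightarrow> real^'n \<Rightarrow> real) \<Rightarrow> (real \<Rightarrow> real^'n \<Rightarrow> real^'m) \<Rightarrow> bool" where
  "minimizer A B \<rho>\<^sub>0 \<rho>\<^sub>1 \<rho> u \<longleftrightarrow>
     feasible A B \<rho>\<^sub>0 \<rho>\<^sub>1 \<rho> u \<and>
     (\<forall>\<rho>' u'. feasible A B \<rho>\<^sub>0 \<rho>\<^sub>1 \<rho>' u' \<longrightarrow> cost \<rho> u \<le> cost \<rho>' u')"

end

theory Submission
  imports Defs
begin

text \<open>The feedback is the gradient \<open>w = B' \<nabla>\<psi>\<close> of the quadratic function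
  \<open>\<psi> t x = - x \<bullet> \<Pi>\<^sub>0 t x / 2 + m t \<bullet> x\<close>.  The Riccati equation for \<open>\<Pi>\<^sub>0\<close> and the adjoint equation for \<open>m\<close> say
  precisely that \<open>\<psi>\<close> satisfies the Hamilton-Jacobi equation up to a function of time.  Hence along
  any admissible pair \<open>(\<rho>, u)\<close> the time derivative of the mean of \<open>\<psi>\<close> is the mean of
  \<open>u \<bullet> w - |w|\<^sup>2 / 2\<close> plus a function of time, and integration over the unit interval gives a number
  that depends on the prescribed end densities only.  Since \<open>u \<bullet> w - |w|\<^sup>2 / 2 \<le> |u|\<^sup>2 / 2\<close>, with
  equality for \<open>u = w\<close>, that number is a lower bound of every cost and is the cost of the
  feedback flow (\<open>verification_identity\<close>, \<open>cost_optimal\<close>).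

  The continuity equation is only given weakly, against smooth functions of compact support, while
  \<open>\<psi>\<close> is unbounded and merely \<open>C\<^sup>1\<close> in time.  But \<open>\<psi>\<close> is a finite sum of products \<open>a t * p x\<close> with p of
  degree at most two, and these are treated one at a time: testing with products yields the
  increments of the mean of \<open>f x\<close> by the lemma of du Bois-Reymond (\<open>flow_increment\<close>), a product rule
  brings in the coefficient a, and cutoffs in space pass from compactly supported f to p
  (\<open>flow_identity_quadratic_growth\<close>).  The last step needs second moments at all times; for finite
  cost they follow from those of the initial density by Gronwall's inequality
  (\<open>second_moment_integrable\<close>).

  That the feedback flow is admissible is linear algebra and linear ordinary differential
  equations.  Its paths are affine images of the initial state.  The costate \<open>\<Pi>\<^sub>0 \<Phi>hat\<close> solves the
  open-loop adjoint equation, which gives \<open>\<Phi>hat 1 0\<close> in closed form; the initial value of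
  \<open>\<Pi>\<^sub>0\<close> is the one for which this matrix carries the covariance \<open>\<Sigma>\<^sub>0\<close> to \<open>\<Sigma>\<^sub>1\<close>
  (\<open>closed_loop_covariance\<close>), and \<open>m\<close> is the minimal-energy correction that carries the mean \<open>m\<^sub>0\<close> to
  \<open>m\<^sub>1\<close> (\<open>closed_loop_steers_mean\<close>).  The continuity equation is the chain rule along the paths,
  averaged by Fubini's theorem.\<close>

declare transpose_matrix_vector [simp del]

section \<open>Symmetric matrices and their square roots\<close>

lemma inner_matrix_vector_left: "(A *v x) \<bullet> y = x \<bullet> (transpose A *v y)"
  for A :: "real^'n^'m"
  by (metis dot_lmul_matrix vector_transpose_matrix transpose_transpose)

lemma inner_matrix_vector_right: "x \<bullet> (A *v y) = (transpose A *v x) \<bullet> y"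
  for A :: "real^'n^'m"
  by (simp add: inner_matrix_vector_left)

lemma linear_coefficient_eq_0:
  fixes a b :: real
  assumes "\<And>t. 0 \<le> t * a + t\<^sup>2 * b"
  shows "a = 0"
proof (rule ccontr)
  assume "a \<noteq> 0"
  \<comment> \<open>Small enough for the linear term to win, with the sign that makes it negative.\<close>
  define t where "t = - a / (\<bar>b\<bar> + 1)"
  have pos: "\<bar>b\<bar> + 1 > 0" by simp
  have "t * a + t\<^sup>2 * b \<le> t * a + t\<^sup>2 * \<bar>b\<bar>"
    by (simp add: mult_left_mono)
  also have "t\<^sup>2 * \<bar>b\<bar> < t\<^sup>2 * (\<bar>b\<bar> + 1)"
    using \<open>a \<noteq> 0\<close> pos by (intro mult_strict_left_mono) (auto simp: t_def)
  also have "t * a + t\<^sup>2 * (\<bar>b\<bar> + 1) = 0"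
  proof -
    have "t * (\<bar>b\<bar> + 1) = - a" using pos by (simp add: t_def)
    then show ?thesis by (simp add: power2_eq_square mult.assoc)
  qed
  finally show False using assms[of t] by simp
qed

text \<open>A unit vector maximizing the Rayleigh quotient on an invariant subspace is an eigenvector:
  the quadratic form \<open>c |w|\<^sup>2 - w \<bullet> f w\<close> is nonnegative there and vanishes at the maximizer, so its
  first variation vanishes.\<close>

lemma self_adjoint_eigenvector_in_subspace:
  fixes f :: "'a::euclidean_space \<Rightarrow> 'a"
  assumes f: "linear f" and adj: "\<And>x y. f x \<bullet> y = x \<bullet> f y"
    and S: "subspace S" and inv: "\<And>x. x \<in> S \<Longrightarrow> f x \<in> S" and ne: "\<exists>x\<in>S. x \<noteq> 0"
  obtains v c where "v \<in> S" "norm v = 1" "f v = c *\<^sub>R v"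
proof -
  let ?K = "sphere 0 1 \<inter> S"
  obtain x where x: "x \<in> S" "x \<noteq> 0" using ne by auto
  have "(1 / norm x) *\<^sub>R x \<in> ?K"
    using x S by (auto simp: subspace_scale)
  moreover have "compact ?K"
    using closed_subspace[OF S] by (intro compact_Int_closed) auto
  moreover have "continuous_on ?K (\<lambda>x. x \<bullet> f x)"
    using linear_continuous_on[of f ?K] f by (intro continuous_intros) (simp add: linear_conv_bounded_linear)
  ultimately obtain v where v: "v \<in> ?K" and max: "\<And>y. y \<in> ?K \<Longrightarrow> y \<bullet> f y \<le> v \<bullet> f v"
    using continuous_attains_sup[of ?K "\<lambda>x. x \<bullet> f x"] by blast
  define c where "c = v \<bullet> f v"
  define h where "h w = c * (w \<bullet> w) - w \<bullet> f w" for w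
  interpret linear f by fact
  have h0: "0 \<le> h w" if "w \<in> S" for w
  proof (cases "w = 0")
    case True then show ?thesis by (simp add: h_def zero)
  next
    case False
    have "(1 / norm w) *\<^sub>R w \<in> ?K"
      using that False S by (auto simp: subspace_scale)
    from max[OF this] have "(w \<bullet> f w) / (norm w)\<^sup>2 \<le> c"
      by (simp add: c_def scale power2_eq_square field_simps)
    then have "w \<bullet> f w \<le> c * (norm w)\<^sup>2" using False by (simp add: field_simps)
    then show ?thesis by (simp add: h_def power2_norm_eq_inner)
  qed
  define y where "y = c *\<^sub>R v - f v"
  have yS: "y \<in> S" using v S inv by (auto simp: y_def subspace_diff subspace_scale)
  have "2 * (y \<bullet> y) = 0"
  proof (rule linear_coefficient_eq_0)
    fix t :: real
    have vv: "v \<bullet> v = 1" using v by (simp flip: power2_norm_eq_inner)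
    have "0 \<le> h (v + t *\<^sub>R y)"
      using v yS S by (intro h0) (auto simp: subspace_add subspace_scale)
    also have "\<dots> = c * (v \<bullet> v + 2 * t * (v \<bullet> y) + t\<^sup>2 * (y \<bullet> y))
        - (v \<bullet> f v + t * (y \<bullet> f v) + t * (v \<bullet> f y) + t\<^sup>2 * (y \<bullet> f y))"
      by (simp add: h_def add scale inner_add_left inner_add_right inner_commute[of y v]
          power2_eq_square algebra_simps)
    also have "\<dots> = t * (2 * (c * (v \<bullet> y) - f v \<bullet> y)) + t\<^sup>2 * h y"
      using vv by (simp add: h_def c_def adj[of v y] inner_commute[of y "f v"] algebra_simps)
    also have "c * (v \<bullet> y) - f v \<bullet> y = y \<bullet> y"
      by (simp add: y_def inner_diff_left)
    finally show "0 \<le> t * (2 * (y \<bullet> y)) + t\<^sup>2 * h y" .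
  qed
  then have "f v = c *\<^sub>R v" by (simp add: y_def)
  with v show ?thesis by (intro that[of v c]) auto
qed

text \<open>An orthonormal set of eigenvectors of maximal size is a basis, because the orthogonal
  complement of its span is invariant and would otherwise contribute one more eigenvector.\<close>

lemma self_adjoint_orthonormal_eigenbasis:
  fixes f :: "'a::euclidean_space \<Rightarrow> 'a"
  assumes f: "linear f" and adj: "\<And>x y. f x \<bullet> y = x \<bullet> f y"
  obtains b l where "finite b" "\<And>v w. v \<in> b \<Longrightarrow> w \<in> b \<Longrightarrow> v \<bullet> w = (if v = w then 1 else 0)"
    "\<And>v. v \<in> b \<Longrightarrow> f v = l v *\<^sub>R v" "\<And>x. x = (\<Sum>v\<in>b. (x \<bullet> v) *\<^sub>R v)"
proof -
  define Q where "Q b \<longleftrightarrow> finite b \<and> (\<forall>v\<in>b. \<forall>w\<in>b. v \<bullet> w = (if v = w then 1 else 0)) \<and>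
    (\<forall>v\<in>b. \<exists>l. f v = l *\<^sub>R v)" for b :: "'a set"
  have card: "card b < Suc DIM('a)" if "Q b" for b
  proof -
    have "pairwise orthogonal b" "0 \<notin> b"
      using that by (auto simp: Q_def pairwise_def orthogonal_def) fastforce
    then have "independent b" by (rule pairwise_orthogonal_independent)
    then show ?thesis using independent_bound[of b] by simp
  qed
  have "Q {}" by (simp add: Q_def)
  then have "\<exists>b. Q b \<and> (\<forall>b'. Q b' \<longrightarrow> card b' \<le> card b)"
    using card by (intro ex_has_greatest_nat[of Q "{}" card "Suc DIM('a)"]) (auto intro: less_imp_le)
  then obtain b where b: "Q b" and bmax: "\<And>b'. Q b' \<Longrightarrow> card b' \<le> card b"
    by blast
  define S where "S = {x. \<forall>v\<in>b. x \<bullet> v = 0}"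
  obtain l where l: "\<And>v. v \<in> b \<Longrightarrow> f v = l v *\<^sub>R v" using b unfolding Q_def by metis
  have S: "subspace S" by (auto simp: S_def subspace_def inner_add_left)
  have inv: "f x \<in> S" if "x \<in> S" for x
    using that l by (auto simp: S_def adj)
  have S0: "x = 0" if "x \<in> S" for x
  proof (rule ccontr)
    assume "x \<noteq> 0"
    then obtain v c where v: "v \<in> S" "norm v = 1" "f v = c *\<^sub>R v"
      using self_adjoint_eigenvector_in_subspace[OF f adj S inv] \<open>x \<in> S\<close> by blast
    have vv: "v \<bullet> v = 1" using v by (simp flip: power2_norm_eq_inner)
    have "v \<notin> b" using v vv by (auto simp: S_def)
    moreover have "Q (insert v b)"
      using b v vv by (auto simp: Q_def S_def inner_commute)
    ultimately show False using bmax[of "insert v b"] b by (auto simp: Q_def)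
  qed
  have ex: "x = (\<Sum>v\<in>b. (x \<bullet> v) *\<^sub>R v)" for x
  proof -
    have "x - (\<Sum>v\<in>b. (x \<bullet> v) *\<^sub>R v) \<in> S"
      unfolding S_def
    proof safe
      fix w assume w: "w \<in> b"
      have "(\<Sum>v\<in>b. (x \<bullet> v) *\<^sub>R v) \<bullet> w = (\<Sum>v\<in>b. (x \<bullet> v) * (if v = w then 1 else 0))"
        unfolding inner_sum_left using b w by (intro sum.cong) (auto simp: Q_def)
      also have "\<dots> = x \<bullet> w"
        using b w by (simp add: Q_def if_distrib cong: if_cong)
      finally show "(x - (\<Sum>v\<in>b. (x \<bullet> v) *\<^sub>R v)) \<bullet> w = 0" by (simp add: inner_diff_left)
    qed
    then show ?thesis using S0 by fastforce
  qed
  show ?thesis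
    using b by (intro that[of b l] l ex) (auto simp: Q_def)
qed

text \<open>The quadratic form of S is minimal at x, so its derivative \<open>2 S x\<close> vanishes there.\<close>

lemma pos_semidef_ker:
  fixes S :: "real^'n^'n"
  assumes "pos_semidef S" "x \<bullet> (S *v x) = 0"
  shows "S *v x = 0"
proof -
  have symS: "transpose S = S" and nn: "\<And>x. 0 \<le> x \<bullet> (S *v x)"
    using assms by (auto simp: pos_semidef_def)
  define y where "y = S *v x"
  have "2 * (y \<bullet> y) = 0"
  proof (rule linear_coefficient_eq_0)
    fix t :: real
    have "0 \<le> (x + t *\<^sub>R y) \<bullet> (S *v (x + t *\<^sub>R y))" by (rule nn)
    also have "\<dots> = x \<bullet> (S *v x) + t * (y \<bullet> (S *v x)) + t * (x \<bullet> (S *v y)) + t\<^sup>2 * (y \<bullet> (S *v y))"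
      by (simp add: matrix_vector_right_distrib matrix_vector_mult_scaleR inner_add_left
          inner_add_right power2_eq_square algebra_simps)
    also have "x \<bullet> (S *v y) = y \<bullet> y"
      by (simp add: inner_matrix_vector_right symS y_def)
    finally show "0 \<le> t * (2 * (y \<bullet> y)) + t\<^sup>2 * (y \<bullet> (S *v y))"
      using assms(2) by (simp add: y_def)
  qed
  then show ?thesis by (simp add: y_def)
qed

lemma invertible_iff_ker: "invertible A \<longleftrightarrow> (\<forall>x. A *v x = 0 \<longrightarrow> x = 0)" for A :: "real^'n^'n"
  by (metis invertible_left_inverse matrix_left_invertible_ker)

lemma pos_def_iff: "pos_def S \<longleftrightarrow> pos_semidef S \<and> invertible S" for S :: "real^'n^'n"
proof
  assume S: "pos_def S"
  then have "x = 0" if "S *v x = 0" for x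
    using that unfolding pos_def_def by (metis inner_zero_right less_irrefl)
  moreover have "0 \<le> x \<bullet> (S *v x)" for x
    using S by (cases "x = 0") (auto simp: pos_def_def less_imp_le)
  ultimately show "pos_semidef S \<and> invertible S"
    using S by (auto simp: invertible_iff_ker pos_def_def pos_semidef_def)
next
  assume "pos_semidef S \<and> invertible S"
  then show "pos_def S"
    unfolding pos_def_def
    by (metis invertible_iff_ker less_eq_real_def pos_semidef_def pos_semidef_ker)
qed

lemma transpose_diff: "transpose (A - B) = transpose A - transpose B"
  by (simp add: transpose_def vec_eq_iff)

lemma transpose_add: "transpose (A + B) = transpose A + transpose B"
  by (simp add: transpose_def vec_eq_iff)

text \<open>The root has the eigenvectors of S and the roots of its eigenvalues.\<close>

lemma pos_semidef_sqrt_exists: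
  fixes S :: "real^'n^'n"
  assumes S: "pos_semidef S"
  shows "\<exists>R. pos_semidef R \<and> R ** R = S"
proof -
  have adj: "(S *v x) \<bullet> y = x \<bullet> (S *v y)" for x y
    using S by (simp add: pos_semidef_def inner_matrix_vector_left)
  obtain b l where b: "finite b"
    and on: "\<And>v w. v \<in> b \<Longrightarrow> w \<in> b \<Longrightarrow> v \<bullet> w = (if v = w then 1 else 0)"
    and ev: "\<And>v. v \<in> b \<Longrightarrow> S *v v = l v *\<^sub>R v" and ex: "\<And>x. x = (\<Sum>v\<in>b. (x \<bullet> v) *\<^sub>R v)"
    using self_adjoint_orthonormal_eigenbasis[of "(*v) S", OF _ adj] by blast
  have lnn: "0 \<le> l v" if "v \<in> b" for v
  proof -
    have "0 \<le> v \<bullet> (S *v v)" using S by (simp add: pos_semidef_def)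
    then show ?thesis using that ev on by simp
  qed
  define r where "r x = (\<Sum>v\<in>b. (sqrt (l v) * (x \<bullet> v)) *\<^sub>R v)" for x
  have lin: "linear r"
    unfolding r_def by (intro linearI)
      (simp_all add: inner_add_left algebra_simps sum.distrib scaleR_sum_right)
  then have r: "matrix r *v x = r x" for x by (simp add: matrix_works)
  have rv: "r v = sqrt (l v) *\<^sub>R v" if "v \<in> b" for v
  proof -
    have "r v = (\<Sum>w\<in>b. if w = v then sqrt (l w) *\<^sub>R w else 0)"
      unfolding r_def using on that by (intro sum.cong) auto
    then show ?thesis using b that by simp
  qed
  have r_inner: "r x \<bullet> y = (\<Sum>v\<in>b. sqrt (l v) * (x \<bullet> v) * (y \<bullet> v))" for x y
    by (simp add: r_def inner_sum_left inner_commute[of y])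
  have "transpose (matrix r) = matrix r"
  proof -
    have "transpose (matrix r) *v x = matrix r *v x" for x
    proof (rule vector_eq_ldot[THEN iffD1, rule_format])
      fix y
      have "y \<bullet> (transpose (matrix r) *v x) = r y \<bullet> x"
        by (simp add: inner_matrix_vector_right r)
      also have "\<dots> = r x \<bullet> y" by (simp add: r_inner mult_ac)
      finally show "y \<bullet> (transpose (matrix r) *v x) = y \<bullet> (matrix r *v x)"
        by (simp add: r inner_commute)
    qed
    then show ?thesis by (simp add: matrix_eq)
  qed
  moreover have "0 \<le> x \<bullet> (matrix r *v x)" for x
    unfolding r by (subst inner_commute) (auto simp: r_inner mult.assoc intro!: sum_nonneg mult_nonneg_nonneg[OF _ zero_le_square] lnn)
  moreover have "matrix r ** matrix r = S"
  proof (subst matrix_eq, rule allI)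
    fix x
    have "r (r x) = r (\<Sum>v\<in>b. (sqrt (l v) * (x \<bullet> v)) *\<^sub>R v)" by (simp add: r_def)
    also have "\<dots> = (\<Sum>v\<in>b. (sqrt (l v) * (x \<bullet> v)) *\<^sub>R (sqrt (l v) *\<^sub>R v))"
      by (simp add: linear_sum[OF lin] linear_cmul[OF lin] rv)
    also have "\<dots> = (\<Sum>v\<in>b. (x \<bullet> v) *\<^sub>R (S *v v))"
      using lnn ev by (intro sum.cong) (auto simp: algebra_simps real_sqrt_mult_self)
    also have "\<dots> = S *v (\<Sum>v\<in>b. (x \<bullet> v) *\<^sub>R v)"
      by (simp add: linear_sum[OF matrix_vector_mul_linear] matrix_vector_mult_scaleR)
    also have "\<dots> = S *v x" unfolding ex[of x, symmetric] ..
    finally show "matrix r ** matrix r *v x = S *v x"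
      by (simp add: r flip: matrix_vector_mul_assoc)
  qed
  ultimately show ?thesis by (auto simp: pos_semidef_def)
qed

text \<open>For two positive semidefinite roots R, Q of the same matrix, \<open>D = R - Q\<close> and \<open>T = R + Q\<close>
  anticommute, so every eigenvector of D with nonzero eigenvalue has \<open>v \<bullet> T v = 0\<close>; then R and Q
  both annihilate it, and so does D.\<close>

lemma pos_semidef_sqrt_unique:
  fixes R Q :: "real^'n^'n"
  assumes R: "pos_semidef R" and Q: "pos_semidef Q" and eq: "R ** R = Q ** Q"
  shows "R = Q"
proof -
  define D T where "D = R - Q" and "T = R + Q"
  have "transpose D = D" using R Q by (simp add: D_def transpose_diff pos_semidef_def)
  then have adj: "(D *v x) \<bullet> y = x \<bullet> (D *v y)" for x y
    by (simp add: inner_matrix_vector_left)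
  obtain b l where b: "finite b"
    and on: "\<And>v w. v \<in> b \<Longrightarrow> w \<in> b \<Longrightarrow> v \<bullet> w = (if v = w then 1 else 0)"
    and ev: "\<And>v. v \<in> b \<Longrightarrow> D *v v = l v *\<^sub>R v" and ex: "\<And>x. x = (\<Sum>v\<in>b. (x \<bullet> v) *\<^sub>R v)"
    using self_adjoint_orthonormal_eigenbasis[of "(*v) D", OF _ adj] by blast
  have anti: "D *v (T *v x) + T *v (D *v x) = 0" for x
  proof -
    have e: "R *v (R *v x) = Q *v (Q *v x)"
      by (simp add: matrix_vector_mul_assoc eq)
    show ?thesis
      by (simp add: D_def T_def matrix_vector_mult_add_rdistrib matrix_vector_mult_diff_rdistrib
          matrix_vector_right_distrib matrix_vector_mult_diff_distrib e)
  qed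
  have Dv: "D *v v = 0" if v: "v \<in> b" for v
  proof (rule ccontr)
    assume nz: "D *v v \<noteq> 0"
    have "0 = v \<bullet> (D *v (T *v v)) + v \<bullet> (T *v (D *v v))"
      using anti[of v] by (simp flip: inner_add_right)
    also have "\<dots> = 2 * l v * (v \<bullet> (T *v v))"
      using ev[OF v] by (simp add: matrix_vector_mult_scaleR flip: adj)
    finally have "v \<bullet> (T *v v) = 0" using nz ev[OF v] by auto
    then have "v \<bullet> (R *v v) + v \<bullet> (Q *v v) = 0"
      by (simp add: T_def matrix_vector_mult_add_rdistrib inner_add_right)
    then have "v \<bullet> (R *v v) = 0" "v \<bullet> (Q *v v) = 0"
      using R Q by (auto simp: pos_semidef_def add_nonneg_eq_0_iff)
    then have "R *v v = 0" "Q *v v = 0" using R Q pos_semidef_ker by auto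
    then show False using nz by (simp add: D_def matrix_vector_mult_diff_rdistrib)
  qed
  have "D *v x = 0" for x
  proof -
    have "D *v x = D *v (\<Sum>v\<in>b. (x \<bullet> v) *\<^sub>R v)" unfolding ex[of x, symmetric] ..
    also have "\<dots> = (\<Sum>v\<in>b. (x \<bullet> v) *\<^sub>R (D *v v))"
      by (simp add: linear_sum[OF matrix_vector_mul_linear] matrix_vector_mult_scaleR)
    finally show ?thesis by (simp add: Dv)
  qed
  then have "D = 0" by (metis matrix_eq matrix_vector_mult_0)
  then show ?thesis by (simp add: D_def)
qed

lemma msqrt:
  assumes "pos_semidef S"
  shows "pos_semidef (msqrt S)" "msqrt S ** msqrt S = S"
proof -
  have "\<exists>!R. pos_semidef R \<and> R ** R = S"
    using pos_semidef_sqrt_exists[OF assms] pos_semidef_sqrt_unique by metis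
  from theI'[OF this] show "pos_semidef (msqrt S)" "msqrt S ** msqrt S = S"
    by (auto simp: msqrt_def)
qed

lemma invertible_factor: "invertible (A ** A) \<Longrightarrow> invertible A" for A :: "real^'n^'n"
  by (metis invertible_iff_ker matrix_vector_mul_assoc matrix_vector_mult_0_right)

section \<open>Linear differential equations on the unit interval\<close>

lemma bounded_bilinear_matrix_matrix_mult:
  "bounded_bilinear ((**) :: real^'n^'m \<Rightarrow> real^'p^'n \<Rightarrow> real^'p^'m)"
  by (intro bilinear_conv_bounded_bilinear[THEN iffD1])
    (auto simp: bilinear_def matrix_matrix_mult_def vec_eq_iff sum.distrib sum_distrib_left
      algebra_simps intro!: linearI)

lemma bounded_bilinear_matrix_vector_mult:
  "bounded_bilinear ((*v) :: real^'n^'m \<Rightarrow> real^'n \<Rightarrow> real^'m)"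
  by (intro bilinear_conv_bounded_bilinear[THEN iffD1])
    (auto simp: bilinear_def algebra_simps scaleR_matrix_vector_assoc intro!: linearI)

lemma bounded_linear_transpose: "bounded_linear (transpose :: real^'n^'m \<Rightarrow> real^'m^'n)"
  by (intro linear_conv_bounded_linear[THEN iffD1] linearI)
    (auto simp: transpose_def vec_eq_iff)

lemmas matrix_continuous_intros =
  bounded_bilinear.continuous_on[OF bounded_bilinear_matrix_matrix_mult]
  bounded_bilinear.continuous_on[OF bounded_bilinear_matrix_vector_mult]
  bounded_linear.continuous_on[OF bounded_linear_transpose]

lemmas has_vector_derivative_matrix_mult =
  bounded_bilinear.has_vector_derivative[OF bounded_bilinear_matrix_matrix_mult]

lemmas has_vector_derivative_matrix_vector_mult =
  bounded_bilinear.has_vector_derivative[OF bounded_bilinear_matrix_vector_mult]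

lemmas has_vector_derivative_transpose =
  bounded_linear.has_vector_derivative[OF bounded_linear_transpose]

lemma nonpos_derivative_imp_decreasing:
  fixes g :: "real \<Rightarrow> real"
  assumes g: "\<And>t. t \<in> {0..1} \<Longrightarrow> (g has_vector_derivative g' t) (at t within {0..1})"
    and nonpos: "\<And>t. t \<in> {0..1} \<Longrightarrow> g' t \<le> 0" and st: "0 \<le> s" "s \<le> t" "t \<le> 1"
  shows "g t \<le> g s"
proof (cases "s = t")
  case False
  then have "s < t" using st by simp
  moreover have "(g has_derivative (\<lambda>h. h * g' \<tau>)) (at \<tau> within {s..t})" if "s \<le> \<tau>" "\<tau> \<le> t" for \<tau>
    using g[of \<tau>] that st by (auto simp: has_vector_derivative_def intro: has_derivative_subset)
  ultimately obtain \<tau> where "\<tau> \<in> {s<..<t}" "g t - g s = (t - s) * g' \<tau>"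
    using mvt_simple[of s t g "\<lambda>\<tau> h. h * g' \<tau>"] by blast
  moreover from this have "(t - s) * g' \<tau> \<le> 0"
    using nonpos[of \<tau>] st by (intro mult_nonneg_nonpos) auto
  ultimately show ?thesis by linarith
qed simp

text \<open>Gronwall's estimate, forwards and backwards in time: \<open>|x|\<^sup>2 exp (-2Kt)\<close> decreases and
  \<open>|x|\<^sup>2 exp (2Kt)\<close> increases.  It yields both the uniqueness of solutions and a uniform bound on
  transition matrices.\<close>

lemma norm_le_exp_of_linear_growth:
  fixes x :: "real \<Rightarrow> 'a::real_inner"
  assumes x: "\<And>t. t \<in> {0..1} \<Longrightarrow> (x has_vector_derivative x' t) (at t within {0..1})"
    and growth: "\<And>t. t \<in> {0..1} \<Longrightarrow> norm (x' t) \<le> K * norm (x t)" and K: "0 \<le> K"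
    and st: "s \<in> {0..1}" "t \<in> {0..1}"
  shows "norm (x t) \<le> exp K * norm (x s)"
proof -
  have d: "((\<lambda>t. (x t \<bullet> x t) * exp (c * t)) has_vector_derivative
      (2 * (x t \<bullet> x' t) + c * (x t \<bullet> x t)) * exp (c * t)) (at t within {0..1})"
    if "t \<in> {0..1}" for t c
  proof -
    have 1: "((\<lambda>t. x t \<bullet> x t) has_vector_derivative x t \<bullet> x' t + x' t \<bullet> x t) (at t within {0..1})"
      by (rule bounded_bilinear.has_vector_derivative[OF bounded_bilinear_inner x[OF that] x[OF that]])
    have 2: "((\<lambda>t. exp (c * t)) has_vector_derivative c * exp (c * t)) (at t within {0..1})"
      by (auto intro!: derivative_eq_intros simp flip: has_real_derivative_iff_has_vector_derivative)
    show ?thesis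
      using bounded_bilinear.has_vector_derivative[OF bounded_bilinear_mult 1 2]
      by (simp add: inner_commute algebra_simps)
  qed
  have b: "\<bar>2 * (x t \<bullet> x' t)\<bar> \<le> (2 * K) * (x t \<bullet> x t)" if "t \<in> {0..1}" for t
  proof -
    have "\<bar>x t \<bullet> x' t\<bar> \<le> norm (x t) * norm (x' t)" by (rule Cauchy_Schwarz_ineq2)
    also have "\<dots> \<le> norm (x t) * (K * norm (x t))"
      using growth[OF that] by (intro mult_left_mono) auto
    also have "\<dots> = K * (x t \<bullet> x t)"
      by (simp add: power2_eq_square algebra_simps flip: power2_norm_eq_inner)
    finally show ?thesis by simp
  qed
  have "(norm (x t))\<^sup>2 \<le> exp (2 * K * \<bar>t - s\<bar>) * (norm (x s))\<^sup>2"
  proof (cases "s \<le> t")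
    case True
    have "(x t \<bullet> x t) * exp (- (2 * K) * t) \<le> (x s \<bullet> x s) * exp (- (2 * K) * s)"
      using b st True
      by (intro nonpos_derivative_imp_decreasing[OF d]) (auto intro!: mult_nonpos_nonneg simp: abs_le_iff)
    then show ?thesis
      using True unfolding power2_norm_eq_inner
      by (simp add: exp_diff exp_minus field_simps right_diff_distrib)
  next
    case False
    have "- ((x s \<bullet> x s) * exp ((2 * K) * s)) \<le> - ((x t \<bullet> x t) * exp ((2 * K) * t))"
    proof (rule nonpos_derivative_imp_decreasing[where g = "\<lambda>t. - (x t \<bullet> x t * exp (2 * K * t))"
          and g' = "\<lambda>t. - ((2 * (x t \<bullet> x' t) + 2 * K * (x t \<bullet> x t)) * exp (2 * K * t))"])
      show "((\<lambda>t. - (x t \<bullet> x t * exp (2 * K * t))) has_vector_derivative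
        - ((2 * (x t \<bullet> x' t) + 2 * K * (x t \<bullet> x t)) * exp (2 * K * t))) (at t within {0..1})"
        if "t \<in> {0..1}" for t
        using d[OF that, of "2 * K"] by (rule has_vector_derivative_minus)
      show "- ((2 * (x t \<bullet> x' t) + 2 * K * (x t \<bullet> x t)) * exp (2 * K * t)) \<le> 0"
        if "t \<in> {0..1}" for t
        using b[OF that] by (auto intro!: mult_nonneg_nonneg simp: abs_le_iff)
    qed (use st False in auto)
    then show ?thesis
      using False unfolding power2_norm_eq_inner
      by (simp add: exp_diff field_simps right_diff_distrib)
  qed
  also have "\<dots> \<le> exp (2 * K) * (norm (x s))\<^sup>2"
    using st K by (intro mult_right_mono) (auto simp: abs_le_iff mult_left_le)
  also have "\<dots> = (exp K * norm (x s))\<^sup>2"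
    by (simp add: power_mult_distrib exp_double)
  finally show ?thesis by (rule power2_le_imp_le) simp
qed

lemma has_vector_derivative_iff_difference_quotient:
  "(f has_vector_derivative D) (at x within S) \<longleftrightarrow>
    ((\<lambda>y. (f y - f x) /\<^sub>R (y - x)) \<longlongrightarrow> D) (at x within S)"
proof -
  have "norm ((f y - f x) - (y - x) *\<^sub>R D) / norm (y - x) = norm ((f y - f x) /\<^sub>R (y - x) - D)"
    if "y \<noteq> x" for y
  proof -
    have "(f y - f x) /\<^sub>R (y - x) - D = ((f y - f x) - (y - x) *\<^sub>R D) /\<^sub>R (y - x)"
      using that by (simp add: scaleR_diff_right)
    then show ?thesis by (simp add: divide_inverse)
  qed
  then have "((\<lambda>y. norm ((f y - f x) - (y - x) *\<^sub>R D) / norm (y - x)) \<longlongrightarrow> 0) (at x within S) \<longleftrightarrow>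
      ((\<lambda>y. norm ((f y - f x) /\<^sub>R (y - x) - D)) \<longlongrightarrow> 0) (at x within S)"
    by (intro tendsto_cong) (auto simp: eventually_at_filter)
  then show ?thesis
    unfolding has_vector_derivative_def has_derivative_iff_norm tendsto_norm_zero_iff LIM_zero_iff
    by (simp add: bounded_linear_scaleR_left)
qed

text \<open>The difference quotient of the inverse W is \<open>- W \<tau> ** Q ** W s\<close> with Q the difference quotient
  of Y.\<close>

lemma has_vector_derivative_matrix_inverse:
  fixes Y W :: "real \<Rightarrow> real^'n^'n"
  assumes inv: "\<And>\<tau>. \<tau> \<in> S \<Longrightarrow> W \<tau> ** Y \<tau> = mat 1" "\<And>\<tau>. \<tau> \<in> S \<Longrightarrow> Y \<tau> ** W \<tau> = mat 1"
    and Y: "(Y has_vector_derivative D) (at s within S)"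
    and W: "(W \<longlongrightarrow> W s) (at s within S)" and s: "s \<in> S"
  shows "(W has_vector_derivative - (W s ** D ** W s)) (at s within S)"
proof -
  have Y': "((\<lambda>\<tau>. (Y \<tau> - Y s) /\<^sub>R (\<tau> - s)) \<longlongrightarrow> D) (at s within S)"
    using Y by (simp add: has_vector_derivative_iff_difference_quotient)
  have eq: "- (W \<tau> ** ((Y \<tau> - Y s) /\<^sub>R (\<tau> - s)) ** W s) = (W \<tau> - W s) /\<^sub>R (\<tau> - s)" if "\<tau> \<in> S" for \<tau>
  proof -
    have "W \<tau> ** (Y \<tau> - Y s) ** W s = W s - W \<tau>"
      by (simp add: bounded_bilinear.diff_left[OF bounded_bilinear_matrix_matrix_mult]
          bounded_bilinear.diff_right[OF bounded_bilinear_matrix_matrix_mult] inv that s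
          flip: matrix_mul_assoc)
    then show ?thesis
      by (simp add: bounded_bilinear.scaleR_left[OF bounded_bilinear_matrix_matrix_mult]
          bounded_bilinear.scaleR_right[OF bounded_bilinear_matrix_matrix_mult]
          flip: scaleR_minus_right)
  qed
  have "((\<lambda>\<tau>. - (W \<tau> ** ((Y \<tau> - Y s) /\<^sub>R (\<tau> - s)) ** W s)) \<longlongrightarrow> - (W s ** D ** W s)) (at s within S)"
    by (intro tendsto_minus bounded_bilinear.tendsto[OF bounded_bilinear_matrix_matrix_mult] W Y' tendsto_const)
  moreover have "\<forall>\<^sub>F \<tau> in at s within S. - (W \<tau> ** ((Y \<tau> - Y s) /\<^sub>R (\<tau> - s)) ** W s) = (W \<tau> - W s) /\<^sub>R (\<tau> - s)"
    unfolding eventually_at_filter by (intro always_eventually) (blast intro: eq)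
  ultimately show ?thesis
    unfolding has_vector_derivative_iff_difference_quotient by (rule Lim_transform_eventually)
qed

lemma continuous_path_bounded:
  fixes h :: "real \<Rightarrow> 'a::real_normed_vector"
  assumes "continuous_on {0..1} h"
  shows "\<exists>k\<ge>0. \<forall>t\<in>{0..1}. norm (h t) \<le> k"
proof -
  have "bounded (h ` {0..1})"
    using assms by (intro compact_imp_bounded compact_continuous_image) auto
  then obtain k where "0 < k" "\<forall>y\<in>h ` {0..1}. norm y \<le> k" unfolding bounded_pos by blast
  then show ?thesis by (intro exI[of _ k]) auto
qed

lemma continuous_path_bounded_bilinear:
  fixes L :: "real \<Rightarrow> 'a::real_normed_vector"
  assumes f: "bounded_bilinear f" and L: "continuous_on {0..1} L"
  shows "\<exists>K\<ge>0. \<forall>t\<in>{0..1}. \<forall>x. norm (f (L t) x) \<le> K * norm x"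
proof -
  obtain c where c: "0 \<le> c" "\<And>t. t \<in> {0..1} \<Longrightarrow> norm (L t) \<le> c"
    using continuous_path_bounded[OF L] by blast
  obtain k where k: "0 < k" "\<And>A x. norm (f A x) \<le> norm A * norm x * k"
    using bounded_bilinear.pos_bounded[OF f] by blast
  have "norm (f (L t) x) \<le> c * k * norm x" if "t \<in> {0..1}" for t x
  proof -
    have "norm (f (L t) x) \<le> norm (L t) * norm x * k" by (rule k)
    also have "\<dots> \<le> c * norm x * k" using c(2)[OF that] k(1) by (intro mult_right_mono) auto
    finally show ?thesis by (simp add: mult_ac)
  qed
  then show ?thesis using c k by (intro exI[of _ "c * k"]) auto
qed

lemmas matrix_path_bounded = continuous_path_bounded_bilinear[OF bounded_bilinear_matrix_vector_mult]

lemma bilinear_solution_unique: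
  fixes f :: "'a::real_normed_vector \<Rightarrow> 'b::real_inner \<Rightarrow> 'b"
  assumes f: "bounded_bilinear f" and L: "continuous_on {0..1} L"
    and x: "\<And>t. t \<in> {0..1} \<Longrightarrow> (x has_vector_derivative f (L t) (x t)) (at t within {0..1})"
    and y: "\<And>t. t \<in> {0..1} \<Longrightarrow> (y has_vector_derivative f (L t) (y t)) (at t within {0..1})"
    and st: "s \<in> {0..1}" "t \<in> {0..1}" and eq: "x s = y s"
  shows "x t = y t"
proof -
  obtain K where K: "0 \<le> K" and growth: "\<And>t v. t \<in> {0..1} \<Longrightarrow> norm (f (L t) v) \<le> K * norm v"
    using continuous_path_bounded_bilinear[OF f L] by blast
  have "((\<lambda>t. x t - y t) has_vector_derivative f (L t) (x t - y t)) (at t within {0..1})"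
    if "t \<in> {0..1}" for t
    using has_vector_derivative_diff[OF x[OF that] y[OF that]]
    by (simp add: bounded_bilinear.diff_right[OF f])
  from norm_le_exp_of_linear_growth[OF this growth K st] show ?thesis
    by (simp add: eq)
qed

lemmas linear_solution_unique = bilinear_solution_unique[OF bounded_bilinear_matrix_vector_mult]

lemmas linear_matrix_solution_unique = bilinear_solution_unique[OF bounded_bilinear_matrix_matrix_mult]

locale linear_system =
  fixes L :: "real \<Rightarrow> real^'n^'n" and \<Phi> :: "real \<Rightarrow> real \<Rightarrow> real^'n^'n"
  assumes continuous_coefficient: "continuous_on {0..1} L"
    and transition: "transition_matrix L \<Phi>"
begin

lemma transition_refl [simp]: "s \<in> {0..1} \<Longrightarrow> \<Phi> s s = mat 1"
  using transition by (simp add: transition_matrix_def)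

lemma transition_deriv:
  "s \<in> {0..1} \<Longrightarrow> t \<in> {0..1} \<Longrightarrow>
    ((\<lambda>t. \<Phi> t s) has_vector_derivative L t ** \<Phi> t s) (at t within {0..1})"
  using transition by (simp add: transition_matrix_def)

lemma transition_compose:
  assumes "r \<in> {0..1}" "s \<in> {0..1}" "t \<in> {0..1}"
  shows "\<Phi> t s ** \<Phi> s r = \<Phi> t r"
proof (rule linear_matrix_solution_unique[OF continuous_coefficient, of "\<lambda>t. \<Phi> t s ** \<Phi> s r" "\<lambda>t. \<Phi> t r" s t])
  show "((\<lambda>t. \<Phi> t s ** \<Phi> s r) has_vector_derivative L t ** (\<Phi> t s ** \<Phi> s r)) (at t within {0..1})"
    if "t \<in> {0..1}" for t
    using has_vector_derivative_matrix_mult[OF transition_deriv[OF assms(2) that] has_vector_derivative_const]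
    by (simp add: matrix_mul_assoc)
qed (use assms transition_deriv in auto)

lemma transition_bounded:
  "\<exists>C\<ge>0. \<forall>s\<in>{0..1}. \<forall>t\<in>{0..1}. norm (\<Phi> t s) \<le> C"
proof -
  obtain K where K: "0 \<le> K"
    and growth: "\<And>t X. t \<in> {0..1} \<Longrightarrow> norm (L t ** X) \<le> K * norm (X :: real^'n^'n)"
    using continuous_path_bounded_bilinear[OF bounded_bilinear_matrix_matrix_mult continuous_coefficient] by blast
  show ?thesis
  proof (intro exI[of _ "exp K * norm (mat 1 :: real^'n^'n)"] conjI ballI)
    fix s t :: real assume st: "s \<in> {0..1}" "t \<in> {0..1}"
    show "norm (\<Phi> t s) \<le> exp K * norm (mat 1 :: real^'n^'n)"
      using norm_le_exp_of_linear_growth[OF transition_deriv[OF st(1)] growth K st] st by simp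
  qed simp
qed

text \<open>Continuity in the second argument is not part of the defining property of a transition matrix; it
  follows from \<open>\<Phi> 0 \<tau> - \<Phi> 0 s = \<Phi> 0 \<tau> ** (\<Phi> s 0 - \<Phi> \<tau> 0) ** \<Phi> 0 s\<close> and the uniform bound.\<close>

lemma transition_inverse_tendsto:
  assumes s: "s \<in> {0..1}"
  shows "(\<Phi> 0 \<longlongrightarrow> \<Phi> 0 s) (at s within {0..1})"
proof -
  obtain C where C: "0 \<le> C" "\<And>s t. s \<in> {0..1} \<Longrightarrow> t \<in> {0..1} \<Longrightarrow> norm (\<Phi> t s) \<le> C"
    using transition_bounded by metis
  obtain c where c: "c > 0" "\<And>A X. norm (A ** X) \<le> norm (A :: real^'n^'n) * norm (X :: real^'n^'n) * c"
    using bounded_bilinear.pos_bounded[OF bounded_bilinear_matrix_matrix_mult] by blast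
  have le: "norm (\<Phi> 0 \<tau> - \<Phi> 0 s) \<le> (C * c) * (norm (\<Phi> s 0 - \<Phi> \<tau> 0) * (C * c))" if \<tau>: "\<tau> \<in> {0..1}" for \<tau>
  proof -
    have "\<Phi> 0 \<tau> - \<Phi> 0 s = \<Phi> 0 \<tau> ** ((\<Phi> s 0 - \<Phi> \<tau> 0) ** \<Phi> 0 s)"
      using \<tau> s
      by (simp add: bounded_bilinear.diff_left[OF bounded_bilinear_matrix_matrix_mult]
          bounded_bilinear.diff_right[OF bounded_bilinear_matrix_matrix_mult] transition_compose)
    also have "norm \<dots> \<le> norm (\<Phi> 0 \<tau>) * norm ((\<Phi> s 0 - \<Phi> \<tau> 0) ** \<Phi> 0 s) * c" by (rule c)
    also have "\<dots> \<le> C * (norm (\<Phi> s 0 - \<Phi> \<tau> 0) * C * c) * c"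
    proof (intro mult_right_mono mult_mono)
      have "norm ((\<Phi> s 0 - \<Phi> \<tau> 0) ** \<Phi> 0 s) \<le> norm (\<Phi> s 0 - \<Phi> \<tau> 0) * norm (\<Phi> 0 s) * c" by (rule c)
      also have "\<dots> \<le> norm (\<Phi> s 0 - \<Phi> \<tau> 0) * C * c"
        using C s c by (intro mult_right_mono mult_left_mono) auto
      finally show "norm ((\<Phi> s 0 - \<Phi> \<tau> 0) ** \<Phi> 0 s) \<le> norm (\<Phi> s 0 - \<Phi> \<tau> 0) * C * c" .
    qed (use C c s \<tau> in auto)
    finally show ?thesis by (simp add: mult_ac)
  qed
  have "((\<lambda>\<tau>. \<Phi> \<tau> 0) \<longlongrightarrow> \<Phi> s 0) (at s within {0..1})"
    using has_vector_derivative_continuous[OF transition_deriv[of 0 s]] s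
    by (simp add: continuous_within)
  then have "((\<lambda>\<tau>. (C * c) * (norm (\<Phi> s 0 - \<Phi> \<tau> 0) * (C * c))) \<longlongrightarrow> (C * c) * (norm (\<Phi> s 0 - \<Phi> s 0) * (C * c))) (at s within {0..1})"
    by (intro tendsto_intros)
  then have "((\<lambda>\<tau>. (C * c) * (norm (\<Phi> s 0 - \<Phi> \<tau> 0) * (C * c))) \<longlongrightarrow> 0) (at s within {0..1})" by simp
  moreover have "\<forall>\<^sub>F \<tau> in at s within {0..1}. norm (\<Phi> 0 \<tau> - \<Phi> 0 s) \<le> (C * c) * (norm (\<Phi> s 0 - \<Phi> \<tau> 0) * (C * c))"
    unfolding eventually_at_filter by (intro always_eventually allI impI le)
  ultimately have "((\<lambda>\<tau>. \<Phi> 0 \<tau> - \<Phi> 0 s) \<longlongrightarrow> 0) (at s within {0..1})"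
    by (rule Lim_null_comparison[rotated])
  then show ?thesis by (simp add: LIM_zero_iff)
qed

lemma transition_deriv_right:
  assumes t: "t \<in> {0..1}" and s: "s \<in> {0..1}"
  shows "(\<Phi> t has_vector_derivative - (\<Phi> t s ** L s)) (at s within {0..1})"
proof -
  have "(\<Phi> 0 has_vector_derivative - (\<Phi> 0 s ** (L s ** \<Phi> s 0) ** \<Phi> 0 s)) (at s within {0..1})"
    using s by (intro has_vector_derivative_matrix_inverse[where Y = "\<lambda>\<tau>. \<Phi> \<tau> 0"]
        transition_deriv transition_inverse_tendsto) (auto simp: transition_compose)
  also have "\<Phi> 0 s ** (L s ** \<Phi> s 0) ** \<Phi> 0 s = \<Phi> 0 s ** L s"
    using s by (simp add: transition_compose flip: matrix_mul_assoc)
  finally have W: "(\<Phi> 0 has_vector_derivative - (\<Phi> 0 s ** L s)) (at s within {0..1})" .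
  have "((\<lambda>\<tau>. \<Phi> t 0 ** \<Phi> 0 \<tau>) has_vector_derivative - (\<Phi> t 0 ** \<Phi> 0 s ** L s)) (at s within {0..1})"
    using has_vector_derivative_matrix_mult[OF has_vector_derivative_const[of "\<Phi> t 0"] W]
    by (simp add: bounded_bilinear.minus_right[OF bounded_bilinear_matrix_matrix_mult] matrix_mul_assoc)
  then have "((\<lambda>\<tau>. \<Phi> t 0 ** \<Phi> 0 \<tau>) has_vector_derivative - (\<Phi> t s ** L s)) (at s within {0..1})"
    using s t by (simp add: transition_compose)
  then show ?thesis
    by (rule has_vector_derivative_transform[rotated 2]) (use s t in \<open>auto simp: transition_compose\<close>)
qed

lemma continuous_transition:
  "s \<in> {0..1} \<Longrightarrow> continuous_on {0..1} (\<lambda>t. \<Phi> t s)"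
  by (auto simp: continuous_on_eq_continuous_within
      intro: has_vector_derivative_continuous[OF transition_deriv])

lemma continuous_transition_right:
  "t \<in> {0..1} \<Longrightarrow> continuous_on {0..1} (\<Phi> t)"
  by (auto simp: continuous_on_eq_continuous_within
      intro: has_vector_derivative_continuous[OF transition_deriv_right])

text \<open>The transposed transition matrix propagates the adjoint equation \<open>p' = - transpose L *v p\<close>, which
  both the costate and the function m of the closed loop satisfy.\<close>

lemma adjoint_deriv:
  assumes "t \<in> {0..1}" "s \<in> {0..1}"
  shows "((\<lambda>s. transpose (\<Phi> t s) *v w) has_vector_derivative
    - (transpose (L s) *v (transpose (\<Phi> t s) *v w))) (at s within {0..1})"
proof -
  have "((\<lambda>s. transpose (\<Phi> t s) *v w) has_vector_derivative
    transpose (- (\<Phi> t s ** L s)) *v w) (at s within {0..1})"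
    using has_vector_derivative_matrix_vector_mult[OF
        has_vector_derivative_transpose[OF transition_deriv_right[OF assms]] has_vector_derivative_const]
    by simp
  then show ?thesis
    by (simp add: linear_neg[OF bounded_linear.linear[OF bounded_linear_transpose]] matrix_transpose_mul
        bounded_bilinear.minus_left[OF bounded_bilinear_matrix_vector_mult] matrix_vector_mul_assoc)
qed

text \<open>Along a solution of the inhomogeneous equation the map \<open>\<tau> \<mapsto> \<Phi> t \<tau> *v x \<tau>\<close> has derivative
  \<open>\<Phi> t \<tau> *v g \<tau>\<close>.\<close>

lemma variation_of_constants:
  assumes x: "\<And>t. t \<in> {0..1} \<Longrightarrow> (x has_vector_derivative L t *v x t + g t) (at t within {0..1})"
    and st: "0 \<le> s" "s \<le> t" "t \<le> 1"
  shows "((\<lambda>\<tau>. \<Phi> t \<tau> *v g \<tau>) has_integral (x t - \<Phi> t s *v x s)) {s..t}"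
proof -
  have "((\<lambda>\<tau>. \<Phi> t \<tau> *v x \<tau>) has_vector_derivative \<Phi> t \<tau> *v g \<tau>) (at \<tau> within {s..t})"
    if "\<tau> \<in> {s..t}" for \<tau>
  proof -
    have "((\<lambda>\<tau>. \<Phi> t \<tau> *v x \<tau>) has_vector_derivative
      \<Phi> t \<tau> *v (L \<tau> *v x \<tau> + g \<tau>) + - (\<Phi> t \<tau> ** L \<tau>) *v x \<tau>) (at \<tau> within {0..1})"
      using that st by (intro has_vector_derivative_matrix_vector_mult transition_deriv_right x) auto
    then show ?thesis
      using st by (auto simp: matrix_vector_right_distrib matrix_vector_mul_assoc
          bounded_bilinear.minus_left[OF bounded_bilinear_matrix_vector_mult]
          intro: has_vector_derivative_within_subset)
  qed
  from fundamental_theorem_of_calculus[OF st(2) this] show ?thesis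
    using st by simp
qed

lemma gramian_integrand_integrable:
  fixes B :: "real \<Rightarrow> real^'m^'n"
  assumes B: "continuous_on {0..1} B" and st: "0 \<le> s" "s \<le> t" "t \<le> 1"
  shows "(\<lambda>\<tau>. \<Phi> t \<tau> ** B \<tau> ** transpose (B \<tau>) ** transpose (\<Phi> t \<tau>)) integrable_on {s..t}"
  using st by (intro integrable_continuous_interval matrix_continuous_intros)
    (auto intro: continuous_on_subset[OF B] continuous_on_subset[OF continuous_transition_right])

lemma gramian_symmetric:
  fixes B :: "real \<Rightarrow> real^'m^'n"
  assumes "continuous_on {0..1} B" "0 \<le> s" "s \<le> t" "t \<le> 1"
  shows "transpose (gramian B \<Phi> t s) = gramian B \<Phi> t s"
  using integral_linear[OF gramian_integrand_integrable[OF assms] bounded_linear_transpose]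
  by (simp add: gramian_def o_def matrix_transpose_mul matrix_mul_assoc)

lemma gramian_mult_vector:
  fixes B :: "real \<Rightarrow> real^'m^'n"
  assumes B: "continuous_on {0..1} B" and st: "0 \<le> s" "s \<le> t" "t \<le> 1"
  shows "((\<lambda>\<tau>. \<Phi> t \<tau> *v (B \<tau> *v (transpose (B \<tau>) *v (transpose (\<Phi> t \<tau>) *v v)))) has_integral
    gramian B \<Phi> t s *v v) {s..t}"
proof -
  note gramian_integrand_integrable[OF assms]
  from has_integral_linear[OF integrable_integral[OF this]
      bounded_bilinear.bounded_linear_left[OF bounded_bilinear_matrix_vector_mult, of v]]
  show ?thesis by (simp add: gramian_def o_def matrix_vector_mul_assoc matrix_mul_assoc)
qed

end

section \<open>The closed-loop system steers the covariance\<close>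

lemma matrix_inv_cancel:
  fixes M :: "real^'n^'n"
  assumes "invertible M"
  shows "matrix_inv M ** M = mat 1" "M ** matrix_inv M = mat 1"
  using assms someI_ex[of "\<lambda>M'. M ** M' = mat 1 \<and> M' ** M = mat 1"]
  unfolding invertible_def matrix_inv_def by auto

lemma matrix_inv_eqI:
  fixes M W :: "real^'n^'n"
  assumes "M ** W = mat 1"
  shows "matrix_inv M = W"
proof -
  have "invertible M" using assms by (metis invertible_right_inverse)
  then have "matrix_inv M ** (M ** W) = W"
    by (simp add: matrix_mul_assoc matrix_inv_cancel)
  then show ?thesis by (simp add: assms)
qed

lemma transpose_matrix_inv:
  fixes M :: "real^'n^'n"
  assumes "invertible M"
  shows "transpose (matrix_inv M) = matrix_inv (transpose M)"
  using matrix_inv_cancel(1)[OF assms]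
  by (intro matrix_inv_eqI[symmetric]) (simp flip: matrix_transpose_mul)

lemma pos_semidef_congruence:
  fixes S C :: "real^'n^'n"
  assumes "pos_semidef S"
  shows "pos_semidef (transpose C ** S ** C)"
proof -
  have "x \<bullet> (transpose C ** S ** C *v x) = (C *v x) \<bullet> (S *v (C *v x))" for x
    by (simp add: inner_matrix_vector_right flip: matrix_vector_mul_assoc)
  then show ?thesis
    using assms by (simp add: pos_semidef_def matrix_transpose_mul matrix_mul_assoc)
qed

lemmas matrix_distribs =
  bounded_bilinear.diff_left[OF bounded_bilinear_matrix_matrix_mult]
  bounded_bilinear.diff_right[OF bounded_bilinear_matrix_matrix_mult]
  bounded_bilinear.add_left[OF bounded_bilinear_matrix_matrix_mult]
  bounded_bilinear.add_right[OF bounded_bilinear_matrix_matrix_mult]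
  bounded_bilinear.minus_left[OF bounded_bilinear_matrix_matrix_mult]
  bounded_bilinear.minus_right[OF bounded_bilinear_matrix_matrix_mult]
  bounded_bilinear.diff_left[OF bounded_bilinear_matrix_vector_mult]
  bounded_bilinear.diff_right[OF bounded_bilinear_matrix_vector_mult]
  bounded_bilinear.add_left[OF bounded_bilinear_matrix_vector_mult]
  bounded_bilinear.add_right[OF bounded_bilinear_matrix_vector_mult]
  bounded_bilinear.minus_left[OF bounded_bilinear_matrix_vector_mult]
  bounded_bilinear.minus_right[OF bounded_bilinear_matrix_vector_mult]

lemma transpose_minus: "transpose (- A) = - transpose A"
  by (simp add: transpose_def vec_eq_iff)

locale covariance_steering =
  fixes A :: "real \<Rightarrow> real^'n^'n" and B :: "real \<Rightarrow> real^'m^'n"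
    and \<Phi> \<Phi>hat :: "real \<Rightarrow> real \<Rightarrow> real^'n^'n" and \<Pi>\<^sub>0 :: "real \<Rightarrow> real^'n^'n"
    and \<Sigma>\<^sub>0 \<Sigma>\<^sub>1 :: "real^'n^'n"
  assumes A: "continuous_on {0..1} A" and B: "continuous_on {0..1} B"
    and \<Phi>: "transition_matrix A \<Phi>"
    and ctrl: "controllable B \<Phi>"
    and \<Sigma>\<^sub>0: "pos_def \<Sigma>\<^sub>0" and \<Sigma>\<^sub>1: "pos_def \<Sigma>\<^sub>1"
    and riccati: "riccati_solution A B \<Pi>\<^sub>0"
    and init: "\<Pi>\<^sub>0 0 = riccati_init \<Sigma>\<^sub>0 \<Sigma>\<^sub>1 (\<Phi> 1 0) (gramian B \<Phi> 1 0)"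
    and \<Phi>hat: "transition_matrix (\<lambda>t. A t - B t ** transpose (B t) ** \<Pi>\<^sub>0 t) \<Phi>hat"
begin

lemma Riccati_deriv:
  "t \<in> {0..1} \<Longrightarrow> (\<Pi>\<^sub>0 has_vector_derivative
    - (transpose (A t) ** \<Pi>\<^sub>0 t + \<Pi>\<^sub>0 t ** A t - \<Pi>\<^sub>0 t ** B t ** transpose (B t) ** \<Pi>\<^sub>0 t)) (at t within {0..1})"
  using riccati by (simp add: riccati_solution_def)

lemma Riccati_continuous: "continuous_on {0..1} \<Pi>\<^sub>0"
  by (auto simp: continuous_on_eq_continuous_within intro: has_vector_derivative_continuous[OF Riccati_deriv])

lemma closed_loop_continuous: "continuous_on {0..1} (\<lambda>t. A t - B t ** transpose (B t) ** \<Pi>\<^sub>0 t)"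
  by (intro continuous_intros matrix_continuous_intros A B Riccati_continuous)

sublocale opn: linear_system A \<Phi>
  by unfold_locales (fact A, fact \<Phi>)

sublocale cls: linear_system "\<lambda>t. A t - B t ** transpose (B t) ** \<Pi>\<^sub>0 t" \<Phi>hat
  by unfold_locales (fact closed_loop_continuous, fact \<Phi>hat)

abbreviation "M10 \<equiv> gramian B \<Phi> 1 0"
abbreviation "Mhat \<equiv> gramian B \<Phi>hat 1 0"

lemma M10_invertible: "invertible M10"
  using ctrl by (auto simp: controllable_def)

lemma M10_sym: "transpose M10 = M10"
  by (rule opn.gramian_symmetric[OF B]) auto

lemma sqrt_\<Sigma>\<^sub>0:
  "transpose (msqrt \<Sigma>\<^sub>0) = msqrt \<Sigma>\<^sub>0" "msqrt \<Sigma>\<^sub>0 ** msqrt \<Sigma>\<^sub>0 = \<Sigma>\<^sub>0" "invertible (msqrt \<Sigma>\<^sub>0)"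
  using msqrt[of \<Sigma>\<^sub>0] \<Sigma>\<^sub>0 invertible_factor[of "msqrt \<Sigma>\<^sub>0"] by (auto simp: pos_def_iff pos_semidef_def)

text \<open>The matrix root that is subtracted in the prescribed initial value of \<open>\<Pi>\<^sub>0\<close>.\<close>

definition "T = msqrt (msqrt \<Sigma>\<^sub>0 ** transpose (\<Phi> 1 0) ** matrix_inv M10 ** \<Sigma>\<^sub>1 ** matrix_inv M10 ** \<Phi> 1 0 ** msqrt \<Sigma>\<^sub>0)"

lemma T: "transpose T = T"
  "T ** T = msqrt \<Sigma>\<^sub>0 ** transpose (\<Phi> 1 0) ** matrix_inv M10 ** \<Sigma>\<^sub>1 ** matrix_inv M10 ** \<Phi> 1 0 ** msqrt \<Sigma>\<^sub>0"
proof -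
  let ?C = "matrix_inv M10 ** \<Phi> 1 0 ** msqrt \<Sigma>\<^sub>0"
  have "pos_semidef (transpose ?C ** \<Sigma>\<^sub>1 ** ?C)"
    using \<Sigma>\<^sub>1 by (intro pos_semidef_congruence) (simp add: pos_def_iff)
  also have "transpose ?C ** \<Sigma>\<^sub>1 ** ?C = msqrt \<Sigma>\<^sub>0 ** transpose (\<Phi> 1 0) ** matrix_inv M10 ** \<Sigma>\<^sub>1 **
      matrix_inv M10 ** \<Phi> 1 0 ** msqrt \<Sigma>\<^sub>0"
    by (simp add: matrix_transpose_mul transpose_matrix_inv M10_invertible M10_sym sqrt_\<Sigma>\<^sub>0 matrix_mul_assoc)
  finally show "transpose T = T"
    "T ** T = msqrt \<Sigma>\<^sub>0 ** transpose (\<Phi> 1 0) ** matrix_inv M10 ** \<Sigma>\<^sub>1 ** matrix_inv M10 ** \<Phi> 1 0 ** msqrt \<Sigma>\<^sub>0"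
    using msqrt unfolding T_def by (auto simp: pos_semidef_def)
qed

text \<open>The factors \<open>\<Sigma>\<^sub>0\<^sup>-\<^sup>1\<^sup>/\<^sup>2\<close> cancel against \<open>\<Sigma>\<^sub>0\<^sup>1\<^sup>/\<^sup>2\<close> in the first summand only.\<close>

lemma Riccati_initial_value: "\<Pi>\<^sub>0 0 = transpose (\<Phi> 1 0) ** matrix_inv M10 ** \<Phi> 1 0
    - matrix_inv (msqrt \<Sigma>\<^sub>0) ** T ** matrix_inv (msqrt \<Sigma>\<^sub>0)"
proof -
  note R = matrix_inv_cancel[OF sqrt_\<Sigma>\<^sub>0(3)]
  have R1: "matrix_inv (msqrt \<Sigma>\<^sub>0) ** (msqrt \<Sigma>\<^sub>0 ** Z) = Z" for Z :: "real^'n^'n"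
    by (simp add: matrix_mul_assoc R)
  show ?thesis
    by (simp add: init riccati_init_def Let_def matrix_distribs R R1 flip: T_def matrix_mul_assoc)
      (simp add: R R1 T_def flip: matrix_mul_assoc)
qed

text \<open>\<open>\<Phi>hat' \<Pi>\<^sub>0 \<Phi>hat\<close> starts from the symmetric matrix \<open>\<Pi>\<^sub>0 0\<close> and has a symmetric derivative.\<close>

lemma Riccati_sym:
  assumes t: "t \<in> {0..1}"
  shows "transpose (\<Pi>\<^sub>0 t) = \<Pi>\<^sub>0 t"
proof -
  define S where "S t = transpose (\<Phi>hat t 0) ** \<Pi>\<^sub>0 t ** \<Phi>hat t 0" for t
  have S': "(S has_vector_derivative
      - (transpose (\<Phi>hat s 0) ** transpose (\<Pi>\<^sub>0 s) ** B s ** transpose (B s) ** \<Pi>\<^sub>0 s ** \<Phi>hat s 0)) (at s within {0..1})"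
    if s: "s \<in> {0..1}" for s
  proof -
    \<comment> \<open>The product rule leaves only \<open>- \<Phi>hat' \<Pi>\<^sub>0' B B' \<Pi>\<^sub>0 \<Phi>hat\<close>: the terms with A cancel, and so does the
      quadratic term of the Riccati equation.\<close>
    note d = has_vector_derivative_matrix_mult[OF has_vector_derivative_matrix_mult[OF
        has_vector_derivative_transpose[OF cls.transition_deriv] Riccati_deriv] cls.transition_deriv, of 0 s 0]
    have "(S has_vector_derivative transpose (\<Phi>hat s 0) ** \<Pi>\<^sub>0 s **
         ((A s - B s ** transpose (B s) ** \<Pi>\<^sub>0 s) ** \<Phi>hat s 0) +
        (transpose (\<Phi>hat s 0) ** - (transpose (A s) ** \<Pi>\<^sub>0 s + \<Pi>\<^sub>0 s ** A s - \<Pi>\<^sub>0 s ** B s ** transpose (B s) ** \<Pi>\<^sub>0 s) +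
        transpose ((A s - B s ** transpose (B s) ** \<Pi>\<^sub>0 s) ** \<Phi>hat s 0) ** \<Pi>\<^sub>0 s) ** \<Phi>hat s 0) (at s within {0..1})"
      unfolding S_def[abs_def] using s by (intro d) auto
    then show ?thesis
      by (rule has_vector_derivative_eq_rhs)
        (simp add: matrix_distribs matrix_transpose_mul transpose_diff transpose_add flip: matrix_mul_assoc)
  qed
  have const: "((\<lambda>t. transpose (S t) - S t) has_vector_derivative 0) (at s within {0..1})" if "s \<in> {0..1}" for s
    using has_vector_derivative_diff[OF has_vector_derivative_transpose[OF S'[OF that]] S'[OF that]]
    by (rule has_vector_derivative_eq_rhs) (simp add: matrix_transpose_mul transpose_minus matrix_mul_assoc)
  have "transpose (S t) - S t = transpose (S 0) - S 0"
  proof (rule has_vector_derivative_zero_constant[OF _ const])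
    fix c assume "\<And>s. s \<in> {0..1} \<Longrightarrow> transpose (S s) - S s = c"
    from this[of t] this[of 0] t show ?thesis by simp
  qed auto
  also have "\<dots> = 0"
    by (simp add: S_def Riccati_initial_value transpose_diff matrix_transpose_mul transpose_matrix_inv M10_invertible
        M10_sym sqrt_\<Sigma>\<^sub>0 T matrix_mul_assoc)
  finally have "transpose (S t) = S t" by simp
  then have "transpose (\<Phi>hat 0 t) ** (transpose (S t)) ** \<Phi>hat 0 t = transpose (\<Phi>hat 0 t) ** S t ** \<Phi>hat 0 t"
    by simp
  moreover have 1: "\<Phi>hat t 0 ** \<Phi>hat 0 t = mat 1" using t by (simp add: cls.transition_compose)
  moreover have 2: "transpose (\<Phi>hat 0 t) ** transpose (\<Phi>hat t 0) = mat 1"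
    using arg_cong[OF 1, of transpose] by (simp add: matrix_transpose_mul)
  moreover have "transpose (\<Phi>hat 0 t) ** (transpose (\<Phi>hat t 0) ** Z) = Z" for Z :: "real^'n^'n"
    by (simp add: matrix_mul_assoc 2)
  ultimately show ?thesis
    by (simp add: S_def matrix_transpose_mul flip: matrix_mul_assoc)
qed

lemma neg_transpose_A_continuous: "continuous_on {0..1} (\<lambda>t. - transpose (A t))"
  by (intro continuous_intros matrix_continuous_intros A)

lemma open_adjoint_deriv: "s \<in> {0..1} \<Longrightarrow>
  ((\<lambda>s. transpose (\<Phi> 1 s) *v w) has_vector_derivative - transpose (A s) *v (transpose (\<Phi> 1 s) *v w)) (at s within {0..1})"
  using opn.adjoint_deriv[of 1 s w] by (simp add: matrix_distribs)

text \<open>The Riccati equation linearizes: \<open>\<Pi>\<^sub>0 \<Phi>hat\<close> solves the adjoint equation of the uncontrolled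
  system, and so does the right-hand side, with the same initial value.\<close>

lemma costate:
  assumes t: "t \<in> {0..1}"
  shows "\<Pi>\<^sub>0 t *v (\<Phi>hat t 0 *v v) = transpose (\<Phi> 1 t) *v (transpose (\<Phi> 0 1) *v (\<Pi>\<^sub>0 0 *v v))"
proof (rule linear_solution_unique[OF neg_transpose_A_continuous, of
      "\<lambda>t. \<Pi>\<^sub>0 t *v (\<Phi>hat t 0 *v v)" "\<lambda>t. transpose (\<Phi> 1 t) *v (transpose (\<Phi> 0 1) *v (\<Pi>\<^sub>0 0 *v v))" 0 t])
  show "((\<lambda>t. \<Pi>\<^sub>0 t *v (\<Phi>hat t 0 *v v)) has_vector_derivative
      - transpose (A s) *v (\<Pi>\<^sub>0 s *v (\<Phi>hat s 0 *v v))) (at s within {0..1})" if s: "s \<in> {0..1}" for s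
    using has_vector_derivative_matrix_vector_mult[OF Riccati_deriv[OF s]
        has_vector_derivative_matrix_vector_mult[OF cls.transition_deriv[of 0 s] has_vector_derivative_const]] s
    by (auto elim!: has_vector_derivative_eq_rhs simp: matrix_distribs simp flip: matrix_vector_mul_assoc)
  have "transpose (\<Phi> 1 0) ** transpose (\<Phi> 0 1) = mat 1"
    using arg_cong[OF opn.transition_compose[of 0 1 0], of transpose] by (simp add: matrix_transpose_mul)
  then show "\<Pi>\<^sub>0 0 *v (\<Phi>hat 0 0 *v v) = transpose (\<Phi> 1 0) *v (transpose (\<Phi> 0 1) *v (\<Pi>\<^sub>0 0 *v v))"
    by (simp add: matrix_vector_mul_assoc) (metis matrix_mul_assoc matrix_mul_lid)
qed (use t open_adjoint_deriv in auto)

text \<open>Read the closed loop as the open loop with input \<open>- B B' (\<Pi>\<^sub>0 \<Phi>hat) v\<close>; by the formula for the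
  costate, variation of constants turns this input into the open-loop Gramian.\<close>

lemma closed_loop_transition:
  "\<Phi>hat 1 0 = \<Phi> 1 0 - M10 ** transpose (\<Phi> 0 1) ** \<Pi>\<^sub>0 0"
proof (subst matrix_eq, rule allI)
  fix v
  let ?w = "transpose (\<Phi> 0 1) *v (\<Pi>\<^sub>0 0 *v v)"
  have "((\<lambda>t. \<Phi>hat t 0 *v v) has_vector_derivative
      A t *v (\<Phi>hat t 0 *v v) + - (B t *v (transpose (B t) *v (\<Pi>\<^sub>0 t *v (\<Phi>hat t 0 *v v))))) (at t within {0..1})"
    if "t \<in> {0..1}" for t
    using has_vector_derivative_matrix_vector_mult[OF cls.transition_deriv[of 0 t] has_vector_derivative_const] that
    by (auto elim!: has_vector_derivative_eq_rhs simp: matrix_distribs simp flip: matrix_vector_mul_assoc)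
  from opn.variation_of_constants[OF this, of 0 1]
  have "((\<lambda>\<tau>. \<Phi> 1 \<tau> *v - (B \<tau> *v (transpose (B \<tau>) *v (\<Pi>\<^sub>0 \<tau> *v (\<Phi>hat \<tau> 0 *v v))))) has_integral
      \<Phi>hat 1 0 *v v - \<Phi> 1 0 *v v) {0..1}"
    by simp
  then have "((\<lambda>\<tau>. \<Phi> 1 \<tau> *v (B \<tau> *v (transpose (B \<tau>) *v (transpose (\<Phi> 1 \<tau>) *v ?w)))) has_integral
      - (\<Phi>hat 1 0 *v v - \<Phi> 1 0 *v v)) {0..1}"
    by (intro has_integral_neg[THEN has_integral_eq[rotated]]) (auto simp: matrix_distribs costate)
  then have "- (\<Phi>hat 1 0 *v v - \<Phi> 1 0 *v v) = M10 *v ?w"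
    by (rule has_integral_unique) (use opn.gramian_mult_vector[OF B, of 0 1 ?w] in simp)
  then show "\<Phi>hat 1 0 *v v = (\<Phi> 1 0 - M10 ** transpose (\<Phi> 0 1) ** \<Pi>\<^sub>0 0) *v v"
    by (simp add: matrix_distribs algebra_simps flip: matrix_vector_mul_assoc)
qed

text \<open>Inserting the initial value of \<open>\<Pi>\<^sub>0\<close> leaves \<open>\<Phi>hat 1 0 = M H Q T Q\<close>, where \<open>H\<close> is the inverse of
  \<open>\<Phi>\<^sub>1\<^sub>0'\<close> and \<open>Q = \<Sigma>\<^sub>0\<^sup>-\<^sup>1\<^sup>/\<^sup>2\<close>.  In \<open>\<Phi>hat \<Sigma>\<^sub>0 \<Phi>hat'\<close> the middle factors collapse to \<open>T\<^sup>2\<close>, and the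
  remaining outer factors undo everything in \<open>T\<^sup>2\<close> around \<open>\<Sigma>\<^sub>1\<close>.\<close>

lemma closed_loop_covariance: "\<Phi>hat 1 0 ** \<Sigma>\<^sub>0 ** transpose (\<Phi>hat 1 0) = \<Sigma>\<^sub>1"
proof -
  define G H N R Q where "G = \<Phi> 1 0" and "H = transpose (\<Phi> 0 1)" and "N = matrix_inv M10"
    and "R = msqrt \<Sigma>\<^sub>0" and "Q = matrix_inv (msqrt \<Sigma>\<^sub>0)"
  have GH: "H ** transpose G = mat 1" "transpose G ** H = mat 1"
    using arg_cong[OF opn.transition_compose[of 1 0 1], of transpose]
      arg_cong[OF opn.transition_compose[of 0 1 0], of transpose]
    by (simp_all add: matrix_transpose_mul G_def H_def)
  have GH': "transpose H ** G = mat 1" "G ** transpose H = mat 1"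
    using arg_cong[OF GH(1), of transpose] arg_cong[OF GH(2), of transpose]
    by (simp_all add: matrix_transpose_mul)
  have MN: "M10 ** N = mat 1" "N ** M10 = mat 1" using matrix_inv_cancel[OF M10_invertible] by (auto simp: N_def)
  have RQ: "R ** Q = mat 1" "Q ** R = mat 1" using matrix_inv_cancel[OF sqrt_\<Sigma>\<^sub>0(3)] by (auto simp: R_def Q_def)
  have sym: "transpose Q = Q"
    using transpose_matrix_inv[OF sqrt_\<Sigma>\<^sub>0(3)] by (simp add: Q_def sqrt_\<Sigma>\<^sub>0)
  note cancel = GH GH' MN RQ
  have cancel': "H ** (transpose G ** Z) = Z" "transpose G ** (H ** Z) = Z" "transpose H ** (G ** Z) = Z"
    "G ** (transpose H ** Z) = Z" "M10 ** (N ** Z) = Z"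
    "N ** (M10 ** Z) = Z" "R ** (Q ** Z) = Z" "Q ** (R ** Z) = Z" for Z :: "real^'n^'n"
    using cancel by (simp_all add: matrix_mul_assoc)
  have Y: "\<Phi>hat 1 0 = M10 ** H ** Q ** T ** Q"
    unfolding closed_loop_transition Riccati_initial_value
    by (simp add: matrix_distribs cancel cancel' flip: matrix_mul_assoc G_def H_def N_def Q_def)
  have TT: "T ** (T ** Z) = R ** (transpose G ** (N ** (\<Sigma>\<^sub>1 ** (N ** (G ** (R ** Z))))))" for Z :: "real^'n^'n"
    unfolding matrix_mul_assoc T(2) by (simp add: R_def G_def N_def matrix_mul_assoc)
  have "\<Phi>hat 1 0 ** (R ** R) ** transpose (\<Phi>hat 1 0) = \<Sigma>\<^sub>1"
    unfolding Y by (simp add: matrix_transpose_mul sym T(1) M10_sym cancel cancel' TT flip: matrix_mul_assoc)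
  then show ?thesis by (simp add: R_def sqrt_\<Sigma>\<^sub>0)
qed

text \<open>Feedback does not destroy controllability: on the kernel of the closed-loop Gramian the
  output \<open>B' p\<close> of the closed-loop adjoint solution p vanishes, so p also solves the open-loop adjoint
  equation and lies in the kernel of the open-loop Gramian.\<close>

lemma Mhat_invertible: "invertible Mhat"
  unfolding invertible_iff_ker
proof safe
  fix v assume v: "Mhat *v v = 0"
  define p where "p \<tau> = transpose (\<Phi>hat 1 \<tau>) *v v" for \<tau>
  have p_cont: "continuous_on {0..1} p"
    unfolding p_def by (intro matrix_continuous_intros cls.continuous_transition_right continuous_intros) auto
  have "((\<lambda>\<tau>. \<Phi>hat 1 \<tau> *v (B \<tau> *v (transpose (B \<tau>) *v p \<tau>))) has_integral Mhat *v v) {0..1}"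
    unfolding p_def using cls.gramian_mult_vector[OF B, of 0 1 v] by simp
  from has_integral_linear[OF this bounded_linear_inner_right[of v]]
  have "((\<lambda>\<tau>. (transpose (B \<tau>) *v p \<tau>) \<bullet> (transpose (B \<tau>) *v p \<tau>)) has_integral 0) {0..1}"
    by (simp add: v o_def inner_matrix_vector_right flip: p_def)
  then have "(transpose (B \<tau>) *v p \<tau>) \<bullet> (transpose (B \<tau>) *v p \<tau>) = 0" if "\<tau> \<in> {0..1}" for \<tau>
    using that by (intro has_integral_0_cbox_imp_0[of 0 1 "\<lambda>\<tau>. (transpose (B \<tau>) *v p \<tau>) \<bullet> (transpose (B \<tau>) *v p \<tau>)"])
      (auto intro!: continuous_intros matrix_continuous_intros p_cont B)
  then have Bp: "transpose (B \<tau>) *v p \<tau> = 0" if "\<tau> \<in> {0..1}" for \<tau> using that by simp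
  have p: "p \<tau> = transpose (\<Phi> 1 \<tau>) *v v" if \<tau>: "\<tau> \<in> {0..1}" for \<tau>
  proof (rule linear_solution_unique[OF neg_transpose_A_continuous, of p "\<lambda>\<tau>. transpose (\<Phi> 1 \<tau>) *v v" 1 \<tau>])
    show "(p has_vector_derivative - transpose (A s) *v p s) (at s within {0..1})" if s: "s \<in> {0..1}" for s
      using cls.adjoint_deriv[of 1 s v] s
      unfolding p_def[symmetric] p_def[abs_def, symmetric]
      by (auto elim!: has_vector_derivative_eq_rhs
          simp: transpose_diff matrix_transpose_mul matrix_distribs Bp simp flip: matrix_vector_mul_assoc)
  qed (use \<tau> open_adjoint_deriv in \<open>auto simp: p_def\<close>)
  have "((\<lambda>\<tau>::real. 0) has_integral M10 *v v) {0..1}"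
    by (rule has_integral_eq[OF _ opn.gramian_mult_vector[OF B order_refl zero_le_one order_refl, of v]])
      (auto simp flip: p simp: Bp)
  then have "M10 *v v = 0" by (simp add: has_integral_0_eq)
  then show "v = 0" using M10_invertible by (simp add: invertible_iff_ker)
qed

text \<open>The input \<open>B B' m\<close> contributes \<open>Mhat *v z\<close> with \<open>z = Mhat\<^sup>-\<^sup>1 (m\<^sub>1 - \<Phi>hat 1 0 m\<^sub>0)\<close> at the final time.\<close>

lemma closed_loop_steers_mean:
  assumes x: "\<And>t. t \<in> {0..1} \<Longrightarrow> (x has_vector_derivative
      (A t - B t ** transpose (B t) ** \<Pi>\<^sub>0 t) *v x t + (B t ** transpose (B t)) *v m t) (at t within {0..1})"
    and m: "\<And>t. t \<in> {0..1} \<Longrightarrow> m t = transpose (\<Phi>hat 1 t) *v (matrix_inv Mhat *v (m1 - \<Phi>hat 1 0 *v m0))"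
  shows "x 1 = \<Phi>hat 1 0 *v (x 0 - m0) + m1"
proof -
  let ?z = "matrix_inv Mhat *v (m1 - \<Phi>hat 1 0 *v m0)"
  have "((\<lambda>\<tau>. \<Phi>hat 1 \<tau> *v (B \<tau> *v (transpose (B \<tau>) *v (transpose (\<Phi>hat 1 \<tau>) *v ?z)))) has_integral
      x 1 - \<Phi>hat 1 0 *v x 0) {0..1}"
    using cls.variation_of_constants[OF x order_refl zero_le_one order_refl]
    by (rule has_integral_eq[rotated, where f = "\<lambda>\<tau>. \<Phi>hat 1 \<tau> *v (B \<tau> ** transpose (B \<tau>) *v m \<tau>)"])
      (auto simp: m simp flip: matrix_vector_mul_assoc)
  then have "x 1 - \<Phi>hat 1 0 *v x 0 = Mhat *v ?z"
    by (rule has_integral_unique) (use cls.gramian_mult_vector[OF B, of 0 1 ?z] in simp)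
  also have "\<dots> = m1 - \<Phi>hat 1 0 *v m0"
    by (simp add: matrix_vector_mul_assoc matrix_inv_cancel Mhat_invertible)
  finally show ?thesis by (simp add: matrix_distribs algebra_simps)
qed

end

section \<open>Gaussian densities\<close>

lemma matrix_vector_mult_measurable [measurable]: "(\<lambda>x. M *v x) \<in> borel_measurable borel"
  for M :: "real^'n^'m"
  by (intro borel_measurable_continuous_onI linear_continuous_on
      bounded_bilinear.bounded_linear_right[OF bounded_bilinear_matrix_vector_mult])

lemma gaussian_density_measurable [measurable]: "gaussian_density \<mu> \<Sigma> \<in> borel_measurable borel"
  unfolding gaussian_density_def[abs_def] by measurable

lemma measure_transposition_cbox:
  fixes a b :: "real^'n" and m n :: 'n
  shows "measure lebesgue ((\<lambda>v. \<chi> i. v $ Transposition.transpose m n i) ` cbox a b) = measure lebesgue (cbox a b)"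
proof -
  let ?s = "Transposition.transpose m n" and ?h = "\<lambda>v :: real^'n. \<chi> i. v $ Transposition.transpose m n i"
  have inv: "?h (?h v) = v" for v by (simp add: vec_eq_iff)
  have bij: "bij_betw ?s UNIV UNIV" by (rule bij_transpose)
  have mem: "?h v \<in> cbox (?h a) (?h b) \<longleftrightarrow> v \<in> cbox a b" for v a b
    unfolding mem_box_cart by (simp) (metis transpose_involutory)
  have img: "?h ` cbox a b = cbox (?h a) (?h b)"
  proof (intro set_eqI iffI)
    fix x assume "x \<in> cbox (?h a) (?h b)"
    then have "?h x \<in> cbox a b" using mem[of "?h x"] by (simp add: inv)
    then show "x \<in> ?h ` cbox a b" by (intro image_eqI[of _ _ "?h x"]) (simp_all add: inv)
  qed (use mem in auto)
  have "(\<Prod>i\<in>UNIV. ?h b $ i - ?h a $ i) = (\<Prod>i\<in>UNIV. b $ i - a $ i)"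
    using prod.reindex_bij_betw[OF bij, of "\<lambda>i. b $ i - a $ i"] by simp
  moreover have "cbox (?h a) (?h b) = {} \<longleftrightarrow> cbox a b = {}"
    using img by auto
  ultimately show ?thesis by (simp add: img content_cbox_if_cart)
qed

lemma measure_shear_cbox:
  fixes a b :: "real^'n" and m n :: 'n
  assumes "m \<noteq> n"
  shows "measure lebesgue ((\<lambda>v. \<chi> i. if i = m then v $ m + v $ n else v $ i) ` cbox a b) = measure lebesgue (cbox a b)"
proof (cases "cbox a b = {}")
  case False
  let ?h = "\<lambda>v :: real^'n. \<chi> i. if i = m then v $ m + v $ n else v $ i"
  \<comment> \<open>Translate the box until its lower n-th coordinate is zero.\<close>
  define c where "c = axis n (- a $ n)"
  have "?h ` cbox a b = (+) (- ?h c) ` ?h ` (+) c ` cbox a b"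
    unfolding image_comp by (intro image_cong) (auto simp: vec_eq_iff)
  also have "measure lebesgue \<dots> = measure lebesgue (?h ` cbox (c + a) (c + b))"
    by (simp only: measure_translation cbox_translation)
  also have "\<dots> = measure lebesgue (cbox (c + a) (c + b))"
  proof (rule measure_shear_interval[OF assms])
    show "cbox (c + a) (c + b) \<noteq> {}" using False unfolding cbox_translation by simp
  qed (simp add: c_def)
  also have "\<dots> = measure lebesgue (cbox a b)"
    by (simp only: cbox_translation measure_translation)
  finally show ?thesis .
qed simp

text \<open>Every linear endomorphism is a product of elementary ones, for which the claim is checked on
  boxes; the shears have determinant one because they arise from the identity by a row operation.\<close>

lemma measure_linear_image_cart:
  fixes f :: "real^'n \<Rightarrow> real^'n"
  assumes f: "linear f" and S: "S \<in> lmeasurable"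
  shows "f ` S \<in> lmeasurable" "measure lebesgue (f ` S) = \<bar>det (matrix f)\<bar> * measure lebesgue S"
proof -
  let ?Q = "\<lambda>f :: real^'n \<Rightarrow> real^'n. linear f \<and>
    (\<forall>a b. measure lebesgue (f ` cbox a b) = \<bar>det (matrix f)\<bar> * measure lebesgue (cbox a b))"
  have "?Q f"
  proof (rule induct_linear_elementary[OF f])
    fix f g :: "real^'n \<Rightarrow> real^'n"
    assume "linear f" "linear g" and fg: "?Q f" "?Q g"
    show "?Q (f \<circ> g)"
    proof (intro conjI allI)
      show lin: "linear (f \<circ> g)" using \<open>linear g\<close> \<open>linear f\<close> by (rule linear_compose)
      fix a b
      have "g ` cbox a b \<in> lmeasurable" by (rule measurable_linear_image_interval[OF \<open>linear g\<close>])
      then have "measure lebesgue (f ` g ` cbox a b) = \<bar>det (matrix f)\<bar> * measure lebesgue (g ` cbox a b)"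
        using measure_linear_sufficient[OF \<open>linear f\<close>, of "g ` cbox a b" "\<bar>det (matrix f)\<bar>"] fg by simp
      also have "\<dots> = \<bar>det (matrix f)\<bar> * (\<bar>det (matrix g)\<bar> * measure lebesgue (cbox a b))"
        using fg by simp
      finally show "measure lebesgue ((f \<circ> g) ` cbox a b) = \<bar>det (matrix (f \<circ> g))\<bar> * measure lebesgue (cbox a b)"
        by (simp add: matrix_compose[OF \<open>linear g\<close> \<open>linear f\<close>] det_mul abs_mult image_comp)
    qed
  next
    fix f :: "real^'n \<Rightarrow> real^'n" and i
    assume lin: "linear f" and zero: "\<And>x. f x $ i = 0"
    have "f x \<noteq> axis i 1" for x using zero[of x] by (metis axis_nth zero_neq_one)
    then have ninj: "\<not> inj f" using linear_injective_imp_surjective[OF lin] by (metis surjD)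
    then have "det (matrix f) = 0" using det_nz_iff_inj[OF lin] by blast
    moreover have "measure lebesgue (f ` cbox a b) = 0" for a b
      using negligible_imp_measure0 negligible_linear_singular_image[OF lin ninj] by blast
    ultimately show "?Q f" using lin by simp
  next
    fix c :: "'n \<Rightarrow> real"
    have "det (matrix (\<lambda>a :: real^'n. \<chi> i. c i * a $ i)) = prod c UNIV"
      by (subst det_diagonal) (auto simp: matrix_def axis_def)
    moreover have "linear (\<lambda>a :: real^'n. \<chi> i. c i * a $ i)"
      by (rule linearI) (auto simp: vec_eq_iff algebra_simps)
    ultimately show "?Q (\<lambda>a. \<chi> i. c i * a $ i)"
      by (simp add: measure_stretch)
  next
    fix m n :: 'n assume "m \<noteq> n"
    let ?h = "\<lambda>v :: real^'n. \<chi> i. v $ Transposition.transpose m n i"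
    have "matrix ?h = (\<chi> i. mat 1 $ Transposition.transpose m n i)"
      by (simp add: matrix_def mat_def axis_def vec_eq_iff eq_commute)
    then have "\<bar>det (matrix ?h)\<bar> = 1"
      by (simp add: det_permute_rows permutes_swap_id sign_swap_id)
    moreover have "linear ?h" by (rule linearI) (auto simp: vec_eq_iff)
    ultimately show "?Q ?h" by (simp add: measure_transposition_cbox)
  next
    fix m n :: 'n assume mn: "m \<noteq> n"
    let ?h = "\<lambda>v :: real^'n. \<chi> i. if i = m then v $ m + v $ n else v $ i"
    have "matrix ?h = (\<chi> k. if k = m then row m (mat 1) + 1 *s row n (mat 1) else row k (mat 1))"
      by (simp add: matrix_def mat_def axis_def row_def vec_eq_iff)
    then have "det (matrix ?h) = det (mat 1 :: real^'n^'n)"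
      using det_row_operation[OF mn, of "mat 1 :: real^'n^'n" 1] by simp
    moreover have "linear ?h" by (rule linearI) (auto simp: vec_eq_iff algebra_simps)
    ultimately show "?Q ?h" by (simp add: measure_shear_cbox[OF mn])
  qed
  then show "f ` S \<in> lmeasurable" "measure lebesgue (f ` S) = \<bar>det (matrix f)\<bar> * measure lebesgue S"
    using measure_linear_sufficient[OF f S, of "\<bar>det (matrix f)\<bar>"] by auto
qed

text \<open>Lebesgue measure is determined by its values on boxes, and the preimage of a box is the image of a
  translated box under the inverse matrix.\<close>

lemma lborel_affine_matrix:
  fixes Y :: "real^'n^'n" and c :: "real^'n"
  assumes Y: "invertible Y"
  shows "lborel = density (distr lborel borel (\<lambda>x. Y *v x + c)) (\<lambda>_. ennreal \<bar>det Y\<bar>)"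
proof (rule lborel_eqI)
  fix l u :: "real^'n" assume lu: "\<And>b. b \<in> Basis \<Longrightarrow> l \<bullet> b \<le> u \<bullet> b"
  let ?T = "\<lambda>x. Y *v x + c" and ?W = "matrix_inv Y"
  have inv: "?W *v (Y *v x) = x" "Y *v (?W *v x) = x" for x
    by (simp_all add: matrix_vector_mul_assoc matrix_inv_cancel Y)
  have vim: "?T -` box l u = (*v) ?W ` box (l - c) (u - c)"
  proof (intro set_eqI iffI)
    fix x assume "x \<in> ?T -` box l u"
    then have "Y *v x \<in> box (l - c) (u - c)"
      by (auto simp: mem_box inner_diff_left inner_add_left algebra_simps)
    then show "x \<in> (*v) ?W ` box (l - c) (u - c)"
      by (intro image_eqI[of _ _ "Y *v x"]) (simp_all add: inv)
  next
    fix x assume "x \<in> (*v) ?W ` box (l - c) (u - c)"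
    then show "x \<in> ?T -` box l u"
      by (auto simp: mem_box inner_diff_left inner_add_left algebra_simps inv)
  qed
  have lm: "(*v) ?W ` box (l - c) (u - c) \<in> lmeasurable"
    by (rule measure_linear_image_cart) auto
  have "?T -` box l u \<in> sets borel"
    using measurable_sets[of ?T borel borel "box l u"] by simp
  then have "emeasure lborel (?T -` box l u) = emeasure lebesgue ((*v) ?W ` box (l - c) (u - c))"
    by (simp flip: vim)
  also have "\<dots> = ennreal (measure lebesgue ((*v) ?W ` box (l - c) (u - c)))"
    using lm by (simp add: emeasure_eq_measure2)
  also have "measure lebesgue ((*v) ?W ` box (l - c) (u - c)) = \<bar>det ?W\<bar> * measure lebesgue (box (l - c) (u - c))"
    by (subst measure_linear_image_cart) (auto simp: matrix_of_matrix_vector_mul)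
  also have "measure lebesgue (box (l - c) (u - c)) = (\<Prod>b\<in>Basis. (u - l) \<bullet> b)"
    using lu by (subst measure_completion) (auto simp: measure_lborel_box_eq inner_diff_left)
  finally have e: "emeasure lborel (?T -` box l u) = ennreal (\<bar>det ?W\<bar> * (\<Prod>b\<in>Basis. (u - l) \<bullet> b))" .
  have "det Y * det ?W = 1"
    by (simp add: matrix_inv_cancel Y flip: det_mul)
  then have d: "\<bar>det Y\<bar> * \<bar>det ?W\<bar> = 1" by (simp flip: abs_mult)
  have "emeasure (density (distr lborel borel ?T) (\<lambda>_. ennreal \<bar>det Y\<bar>)) (box l u)
      = ennreal \<bar>det Y\<bar> * emeasure lborel (?T -` box l u)"
    by (subst emeasure_density) (auto simp: nn_integral_cmult emeasure_distr)
  also have "\<dots> = ennreal (\<bar>det Y\<bar> * \<bar>det ?W\<bar> * (\<Prod>b\<in>Basis. (u - l) \<bullet> b))"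
    by (simp add: e ennreal_mult' mult.assoc)
  finally show "emeasure (density (distr lborel borel ?T) (\<lambda>_. ennreal \<bar>det Y\<bar>)) (box l u)
      = (\<Prod>b\<in>Basis. (u - l) \<bullet> b)"
    by (simp add: d)
qed simp

lemma gaussian_density_affine:
  fixes Y :: "real^'n^'n"
  assumes Y: "invertible Y" and \<Sigma>: "invertible \<Sigma>"
  shows "\<bar>det Y\<bar> * gaussian_density \<mu>' (Y ** \<Sigma> ** transpose Y) (Y *v (x - \<mu>) + \<mu>') = gaussian_density \<mu> \<Sigma> x"
proof -
  let ?W = "matrix_inv Y"
  have Y': "transpose Y ** transpose ?W = mat 1"
    by (simp add: matrix_inv_cancel Y flip: matrix_transpose_mul)
  have "(Y ** \<Sigma> ** transpose Y) ** (transpose ?W ** matrix_inv \<Sigma> ** ?W)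
      = Y ** (\<Sigma> ** ((transpose Y ** transpose ?W) ** (matrix_inv \<Sigma> ** ?W)))"
    by (simp add: matrix_mul_assoc)
  also have "\<dots> = Y ** ((\<Sigma> ** matrix_inv \<Sigma>) ** ?W)"
    unfolding Y' by (simp add: matrix_mul_assoc)
  also have "\<dots> = mat 1"
    by (simp add: matrix_inv_cancel Y \<Sigma>)
  finally have inv: "matrix_inv (Y ** \<Sigma> ** transpose Y) = transpose ?W ** matrix_inv \<Sigma> ** ?W"
    by (rule matrix_inv_eqI)
  have WY: "?W *v (Y *v v) = v" for v
    by (simp add: matrix_vector_mul_assoc matrix_inv_cancel Y)
  have q: "(Y *v y) \<bullet> (matrix_inv (Y ** \<Sigma> ** transpose Y) *v (Y *v y)) = y \<bullet> (matrix_inv \<Sigma> *v y)" for y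
    unfolding inv by (simp add: inner_matrix_vector_right WY flip: matrix_vector_mul_assoc)
  have "det Y \<noteq> 0" using Y by (simp add: invertible_det_nz)
  moreover have "sqrt ((2 * pi) ^ CARD('n) * det (Y ** \<Sigma> ** transpose Y))
      = \<bar>det Y\<bar> * sqrt ((2 * pi) ^ CARD('n) * det \<Sigma>)"
  proof -
    have "(2 * pi) ^ CARD('n) * det (Y ** \<Sigma> ** transpose Y) = (det Y)\<^sup>2 * ((2 * pi) ^ CARD('n) * det \<Sigma>)"
      by (simp add: det_mul power2_eq_square)
    then show ?thesis by (simp only: real_sqrt_mult real_sqrt_abs)
  qed
  ultimately show ?thesis
    by (simp add: gaussian_density_def q)
qed

lemma distr_gaussian_affine:
  fixes Y :: "real^'n^'n"
  assumes Y: "invertible Y" and \<Sigma>: "invertible \<Sigma>"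
  shows "distr (density lborel (\<lambda>x. ennreal (gaussian_density \<mu> \<Sigma> x))) lborel (\<lambda>x. Y *v (x - \<mu>) + \<mu>')
    = density lborel (\<lambda>x. ennreal (gaussian_density \<mu>' (Y ** \<Sigma> ** transpose Y) x))" (is "distr _ _ ?T = density _ ?g")
proof (rule measure_eqI)
  fix S assume "S \<in> sets (distr (density lborel (\<lambda>x. ennreal (gaussian_density \<mu> \<Sigma> x))) lborel ?T)"
  then have [measurable]: "S \<in> sets borel" by simp
  have T: "Y *v (x - \<mu>) + \<mu>' = Y *v x + (\<mu>' - Y *v \<mu>)" for x
    by (simp add: matrix_vector_mult_diff_distrib)
  have "emeasure (density lborel ?g) S = (\<integral>\<^sup>+x. ?g x * indicator S x \<partial>lborel)"
    by (rule emeasure_density) auto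
  also have "\<dots> = (\<integral>\<^sup>+x. ennreal \<bar>det Y\<bar> * (?g (?T x) * indicator S (?T x)) \<partial>lborel)"
    by (subst lborel_affine_matrix[OF Y, of "\<mu>' - Y *v \<mu>"])
      (simp add: nn_integral_density nn_integral_distr T)
  also have "\<dots> = (\<integral>\<^sup>+x. ennreal (gaussian_density \<mu> \<Sigma> x) * indicator (?T -` S) x \<partial>lborel)"
    by (intro nn_integral_cong)
      (simp add: gaussian_density_affine[OF Y \<Sigma>, where \<mu> = \<mu> and \<mu>' = \<mu>', symmetric] ennreal_mult' mult.assoc indicator_def)
  also have "\<dots> = emeasure (density lborel (\<lambda>x. ennreal (gaussian_density \<mu> \<Sigma> x))) (?T -` S)"
    using measurable_sets[of ?T borel borel S] by (subst emeasure_density) auto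
  also have "\<dots> = emeasure (distr (density lborel (\<lambda>x. ennreal (gaussian_density \<mu> \<Sigma> x))) lborel ?T) S"
    by (subst emeasure_distr) auto
  finally show "emeasure (distr (density lborel (\<lambda>x. ennreal (gaussian_density \<mu> \<Sigma> x))) lborel ?T) S
    = emeasure (density lborel ?g) S" ..
qed simp

text \<open>The square of the distance to the mean is absorbed by half of the Gaussian exponent, and what
  remains is the same density stretched by \<open>sqrt 2\<close>; its integral is therefore controlled by the
  total mass.\<close>

lemma gaussian_second_moment_finite:
  fixes \<Sigma> :: "real^'n^'n"
  assumes \<Sigma>: "pos_def \<Sigma>" and fin: "(\<integral>\<^sup>+x. ennreal (gaussian_density \<mu> \<Sigma> x) \<partial>lborel) < \<infinity>"
  shows "(\<integral>\<^sup>+x. ennreal ((norm x)\<^sup>2 * gaussian_density \<mu> \<Sigma> x) \<partial>lborel) < \<infinity>"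
proof -
  define g where "g = gaussian_density \<mu> \<Sigma>"
  define q where "q y = y \<bullet> (matrix_inv \<Sigma> *v y)" for y
  define Z where "Z = sqrt ((2 * pi) ^ CARD('n) * det \<Sigma>)"
  \<comment> \<open>Writing the quadratic form as \<open>|R\<^sup>-\<^sup>1 y|\<^sup>2\<close> bounds it from below by a multiple of \<open>|y|\<^sup>2\<close>.\<close>
  define R where "R = msqrt \<Sigma>"
  have R: "transpose R = R" "R ** R = \<Sigma>" "invertible R"
    using msqrt[of \<Sigma>] \<Sigma> invertible_factor[of R] by (auto simp: R_def pos_def_iff pos_semidef_def)
  have inv\<Sigma>: "matrix_inv \<Sigma> = matrix_inv R ** matrix_inv R"
  proof (rule matrix_inv_eqI)
    have "\<Sigma> ** (matrix_inv R ** matrix_inv R) = R ** (R ** matrix_inv R) ** matrix_inv R"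
      by (simp add: R(2) matrix_mul_assoc)
    then show "\<Sigma> ** (matrix_inv R ** matrix_inv R) = mat 1" by (simp add: matrix_inv_cancel R)
  qed
  have q: "q y = (norm (matrix_inv R *v y))\<^sup>2" for y
    by (simp add: q_def inv\<Sigma> inner_matrix_vector_right transpose_matrix_inv R power2_norm_eq_inner
        flip: matrix_vector_mul_assoc)
  obtain K where K: "0 < K" "\<And>v. norm (R *v v) \<le> norm v * K"
    using bounded_linear.pos_bounded[OF bounded_bilinear.bounded_linear_right[OF bounded_bilinear_matrix_vector_mult]]
    by metis
  have yq: "(norm y)\<^sup>2 \<le> K\<^sup>2 * q y" for y
  proof -
    have "norm y = norm (R *v (matrix_inv R *v y))"
      by (simp add: matrix_vector_mul_assoc matrix_inv_cancel R)
    also have "\<dots> \<le> norm (matrix_inv R *v y) * K" by (rule K)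
    finally have "(norm y)\<^sup>2 \<le> (norm (matrix_inv R *v y) * K)\<^sup>2" by (intro power_mono) auto
    then show ?thesis by (simp add: q power_mult_distrib mult.commute)
  qed
  have Z: "0 \<le> Z" unfolding Z_def R(2)[symmetric] by (simp add: det_mul)
  have g: "g x = exp (- q (x - \<mu>) / 2) / Z" for x by (simp add: g_def gaussian_density_def q_def Z_def)
  have g_nonneg: "0 \<le> g x" for x using Z by (simp add: g)
  let ?h = "\<lambda>x. g (\<mu> + (1 / sqrt 2) *\<^sub>R (x - \<mu>))"
  have h: "?h x = exp (- q (x - \<mu>) / 4) / Z" for x
    by (simp add: g q_def matrix_vector_mult_scaleR flip: power2_eq_square) 
  have dom: "(norm x)\<^sup>2 * g x \<le> 2 * (norm \<mu>)\<^sup>2 * g x + 8 * K\<^sup>2 * ?h x" for x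
  proof -
    define y where "y = x - \<mu>"
    have "(norm x)\<^sup>2 \<le> (norm \<mu> + norm y)\<^sup>2"
      using norm_triangle_ineq[of \<mu> y] by (intro power_mono) (auto simp: y_def)
    also have "\<dots> \<le> 2 * (norm \<mu>)\<^sup>2 + 2 * (norm y)\<^sup>2"
      using sum_squares_bound[of "norm \<mu>" "norm y"] by (simp add: power2_sum)
    also have "\<dots> \<le> 2 * (norm \<mu>)\<^sup>2 + 2 * (K\<^sup>2 * q y)" using yq[of y] by simp
    finally have 1: "(norm x)\<^sup>2 * g x \<le> (2 * (norm \<mu>)\<^sup>2 + 2 * (K\<^sup>2 * q y)) * g x"
      using g_nonneg by (intro mult_right_mono)
    \<comment> \<open>The factor \<open>exp (- q/2)\<close> is split in halves, one of which absorbs q.\<close>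
    have "q y / 4 \<le> exp (q y / 4)"
      using exp_ge_add_one_self[of "q y / 4"] by linarith
    then have "q y * exp (- q y / 2) \<le> 4 * exp (q y / 4) * exp (- q y / 2)"
      by (intro mult_right_mono) auto
    also have "\<dots> = 4 * exp (- q y / 4)" by (simp add: mult.assoc flip: exp_add)
    finally have "q y * exp (- q y / 2) / Z \<le> 4 * exp (- q y / 4) / Z"
      using Z by (rule divide_right_mono)
    then have "q y * g x \<le> 4 * ?h x"
      unfolding h by (simp add: g y_def)
    then have "2 * K\<^sup>2 * (q y * g x) \<le> 2 * K\<^sup>2 * (4 * ?h x)" by (intro mult_left_mono) auto
    with 1 show ?thesis by (simp add: algebra_simps)
  qed
  have g_meas [measurable]: "g \<in> borel_measurable borel" by (simp add: g_def)
  have "(\<integral>\<^sup>+x. ennreal (?h x) \<partial>lborel) = ennreal (sqrt 2 ^ DIM(real^'n)) * (\<integral>\<^sup>+x. ennreal (g x) \<partial>lborel)"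
    by (subst lborel_affine[of "sqrt 2" "\<mu> - sqrt 2 *\<^sub>R \<mu>"])
      (simp_all add: nn_integral_density nn_integral_distr nn_integral_cmult algebra_simps)
  then have h_fin: "(\<integral>\<^sup>+x. ennreal (?h x) \<partial>lborel) < \<infinity>"
    using fin by (simp add: g_def ennreal_mult_less_top)
  have "(\<integral>\<^sup>+x. ennreal ((norm x)\<^sup>2 * g x) \<partial>lborel)
      \<le> (\<integral>\<^sup>+x. ennreal (2 * (norm \<mu>)\<^sup>2) * ennreal (g x) + ennreal (8 * K\<^sup>2) * ennreal (?h x) \<partial>lborel)"
    using dom g_nonneg by (intro nn_integral_mono) (simp flip: ennreal_mult' ennreal_plus)
  also have "\<dots> = ennreal (2 * (norm \<mu>)\<^sup>2) * (\<integral>\<^sup>+x. ennreal (g x) \<partial>lborel)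
      + ennreal (8 * K\<^sup>2) * (\<integral>\<^sup>+x. ennreal (?h x) \<partial>lborel)"
    by (subst nn_integral_add) (auto simp: nn_integral_cmult)
  also have "\<dots> < \<infinity>"
    using fin h_fin by (simp add: g_def ennreal_mult_less_top)
  finally show ?thesis by (simp add: g_def)
qed

section \<open>Smooth functions and cutoffs\<close>

lemma higher_differentiable_SucI:
  assumes "\<And>x. (f has_derivative f' x) (at x)" and "\<And>v. higher_differentiable k (\<lambda>x. f' x v)"
  shows "higher_differentiable (Suc k) f"
proof -
  have "frechet_derivative f (at x) = f' x" for x
    using frechet_derivative_at[OF assms(1)] by simp
  then show ?thesis using assms by (auto simp: differentiable_def)
qed

lemma higher_differentiable_Suc_derivative:
  assumes "higher_differentiable (Suc k) f"
  shows "(f has_derivative frechet_derivative f (at x)) (at x)"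
  using assms by (simp add: frechet_derivative_works[symmetric])

lemma higher_differentiable_continuous: "higher_differentiable k f \<Longrightarrow> continuous_on UNIV f"
  by (cases k) (auto intro!: differentiable_imp_continuous_on simp: differentiable_on_def)

lemma higher_differentiable_lower: "higher_differentiable (Suc k) f \<Longrightarrow> higher_differentiable k f"
proof (induction k arbitrary: f)
  case 0
  then show ?case using higher_differentiable_continuous[of "Suc 0" f] by simp
next
  case (Suc k)
  then show ?case by (metis higher_differentiable.simps(2))
qed

lemma higher_differentiable_const: "higher_differentiable k (\<lambda>x. c)"
proof (induction k arbitrary: c)
  case (Suc k)
  show ?case by (rule higher_differentiable_SucI[OF has_derivative_const Suc.IH])
qed simp

lemma higher_differentiable_linear: "bounded_linear f \<Longrightarrow> higher_differentiable k f"
proof (cases k)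
  case (Suc n)
  assume "bounded_linear f"
  then show ?thesis unfolding Suc
    by (intro higher_differentiable_SucI[where f' = "\<lambda>x. f"] bounded_linear_imp_has_derivative
        higher_differentiable_const)
qed (simp add: linear_continuous_on)

lemma higher_differentiable_add:
  "higher_differentiable k f \<Longrightarrow> higher_differentiable k g \<Longrightarrow> higher_differentiable k (\<lambda>x. f x + g x)"
proof (induction k arbitrary: f g)
  case (Suc k)
  show ?case
    by (rule higher_differentiable_SucI[OF has_derivative_add[OF
          Suc.prems[THEN higher_differentiable_Suc_derivative]]])
      (use Suc in auto)
qed (auto intro: continuous_intros)

lemma higher_differentiable_mult:
  "higher_differentiable k f \<Longrightarrow> higher_differentiable k g \<Longrightarrow> higher_differentiable k (\<lambda>x. f x * g x)"
proof (induction k arbitrary: f g)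
  case (Suc k)
  have "higher_differentiable k f" "higher_differentiable k g"
    using Suc.prems higher_differentiable_lower by blast+
  with Suc show ?case
    by (intro higher_differentiable_SucI[OF has_derivative_mult[OF
          Suc.prems[THEN higher_differentiable_Suc_derivative]]] higher_differentiable_add) auto
qed (auto intro: continuous_intros)

lemma higher_differentiable_compose_linear:
  fixes f :: "'a::euclidean_space \<Rightarrow> real" and L :: "'b::euclidean_space \<Rightarrow> 'a"
  assumes L: "bounded_linear L"
  shows "higher_differentiable k f \<Longrightarrow> higher_differentiable k (\<lambda>x. f (L x))"
proof (induction k arbitrary: f)
  case 0
  then show ?case
    using linear_continuous_on[OF L, of UNIV]
    by (auto intro: continuous_on_compose2[of UNIV f UNIV L])
next
  case (Suc k)
  have "((\<lambda>x. f (L x)) has_derivative (\<lambda>v. frechet_derivative f (at (L x)) (L v))) (at x)" for x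
    using diff_chain_at[OF bounded_linear_imp_has_derivative[OF L]
        higher_differentiable_Suc_derivative[OF Suc.prems]] by (simp add: o_def)
  then show ?case
    by (rule higher_differentiable_SucI) (use Suc in auto)
qed

text \<open>By the chain rule a directional derivative of \<open>g \<circ> f\<close> is a product of a derivative of f with
  \<open>g' \<circ> f\<close>, and g' is a one-variable function of one order less; the induction is over all g.\<close>

lemma higher_differentiable_compose:
  fixes f :: "'a::euclidean_space \<Rightarrow> real" and g :: "real \<Rightarrow> real"
  shows "higher_differentiable k g \<Longrightarrow> higher_differentiable k f \<Longrightarrow> higher_differentiable k (\<lambda>x. g (f x))"
proof (induction k arbitrary: f g)
  case 0
  then show ?case by (auto intro: continuous_on_compose2[of UNIV g UNIV f])
next
  case (Suc k)
  have "((\<lambda>x. g (f x)) has_derivative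
      (\<lambda>v. frechet_derivative g (at (f x)) 1 * frechet_derivative f (at x) v)) (at x)" for x
  proof -
    have g: "(g has_derivative frechet_derivative g (at (f x))) (at (f x))"
      by (rule higher_differentiable_Suc_derivative[OF Suc.prems(1)])
    have "((\<lambda>x. g (f x)) has_derivative
      (\<lambda>v. frechet_derivative g (at (f x)) (frechet_derivative f (at x) v))) (at x)"
      using diff_chain_at[OF higher_differentiable_Suc_derivative[OF Suc.prems(2)] g] by (simp add: o_def)
    moreover have "frechet_derivative g (at (f x)) h = frechet_derivative g (at (f x)) 1 * h" for h
      using linear_cmul[OF has_derivative_linear[OF g], of h 1] by simp
    then have "(\<lambda>v. frechet_derivative g (at (f x)) (frechet_derivative f (at x) v)) =
        (\<lambda>v. frechet_derivative g (at (f x)) 1 * frechet_derivative f (at x) v)" by blast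
    ultimately show ?thesis by metis
  qed
  moreover have "higher_differentiable k (\<lambda>x. frechet_derivative g (at (f x)) 1 * frechet_derivative f (at x) v)" for v
  proof (rule higher_differentiable_mult)
    have "higher_differentiable k (\<lambda>y. frechet_derivative g (at y) 1)"
      using Suc.prems(1) by simp
    from Suc.IH[OF this higher_differentiable_lower[OF Suc.prems(2)]]
    show "higher_differentiable k (\<lambda>x. frechet_derivative g (at (f x)) 1)" .
    show "higher_differentiable k (\<lambda>x. frechet_derivative f (at x) v)"
      using Suc.prems(2) by simp
  qed
  ultimately show ?case by (rule higher_differentiable_SucI)
qed

lemma smooth_const: "smooth (\<lambda>x. c)"
  by (simp add: smooth_def higher_differentiable_const)

lemma smooth_linear: "bounded_linear f \<Longrightarrow> smooth f"
  by (simp add: smooth_def higher_differentiable_linear)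

lemma smooth_add: "smooth f \<Longrightarrow> smooth g \<Longrightarrow> smooth (\<lambda>x. f x + g x)"
  by (simp add: smooth_def higher_differentiable_add)

lemma smooth_mult: "smooth f \<Longrightarrow> smooth g \<Longrightarrow> smooth (\<lambda>x. f x * g x)"
  by (simp add: smooth_def higher_differentiable_mult)

lemma smooth_diff: "smooth f \<Longrightarrow> smooth g \<Longrightarrow> smooth (\<lambda>x. f x - g x)"
  using smooth_add[of f "\<lambda>x. - 1 * g x"] smooth_mult[OF smooth_const[of "-1"], of g] by simp

lemma smooth_compose_linear: "bounded_linear L \<Longrightarrow> smooth f \<Longrightarrow> smooth (\<lambda>x. f (L x))"
  by (simp add: smooth_def higher_differentiable_compose_linear)

lemma smooth_compose: "smooth g \<Longrightarrow> smooth f \<Longrightarrow> smooth (\<lambda>x. g (f x))"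
  by (simp add: smooth_def higher_differentiable_compose)

lemma smoothI:
  assumes "\<And>x. (f has_derivative f' x) (at x)" and "\<And>v. smooth (\<lambda>x. f' x v)"
  shows "smooth f"
  unfolding smooth_def
proof
  fix k
  have "higher_differentiable (Suc k) f"
    by (rule higher_differentiable_SucI[OF assms(1)]) (use assms(2) in \<open>simp add: smooth_def\<close>)
  then show "higher_differentiable k f" by (rule higher_differentiable_lower)
qed

lemma smooth_real_antiderivative:
  fixes f :: "real \<Rightarrow> real"
  assumes "\<And>x. (f has_real_derivative f' x) (at x)" and "smooth f'"
  shows "smooth f"
proof (rule smoothI)
  show "(f has_derivative (\<lambda>v. f' x * v)) (at x)" for x
    using assms(1) by (simp add: has_field_derivative_def)
  show "smooth (\<lambda>x. f' x * v)" for v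
    by (intro smooth_mult smooth_const assms(2))
qed

lemma smooth_has_derivative: "smooth f \<Longrightarrow> (f has_derivative frechet_derivative f (at x)) (at x)"
  by (rule higher_differentiable_Suc_derivative[of 0]) (simp only: smooth_def)

lemma smooth_continuous: "smooth f \<Longrightarrow> continuous_on S f"
  unfolding smooth_def using higher_differentiable_continuous[of 0 f]
  by (auto intro: continuous_on_subset)

lemma smooth_frechet_derivative: "smooth f \<Longrightarrow> smooth (\<lambda>x. frechet_derivative f (at x) v)"
  unfolding smooth_def
proof
  show "higher_differentiable k (\<lambda>x. frechet_derivative f (at x) v)" if "\<forall>k. higher_differentiable k f" for k
    using that[rule_format, of "Suc k"] by simp
qed

lemma smooth_inner_self: "smooth (\<lambda>x :: 'a::euclidean_space. x \<bullet> x)"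
proof (rule smoothI)
  show "((\<lambda>x. x \<bullet> x) has_derivative (\<lambda>v. 2 * (x \<bullet> v))) (at x)" for x :: 'a
    by (auto intro!: derivative_eq_intros simp: inner_commute)
  show "smooth (\<lambda>x. 2 * (x \<bullet> v))" for v :: 'a
    by (intro smooth_mult smooth_const smooth_linear bounded_linear_inner_left)
qed

text \<open>The functions \<open>x\<^sup>-\<^sup>n exp (-1/x)\<close>, extended by zero, are closed under differentiation up to
  linear combinations, so one induction shows that all of them are smooth.\<close>

definition flat :: "nat \<Rightarrow> real \<Rightarrow> real" where
  "flat n x = (if x \<le> 0 then 0 else (1 / x) ^ n * exp (- (1 / x)))"

lemma flat_over_x_tendsto_0: "((\<lambda>h. flat n h / h) \<longlongrightarrow> 0) (at 0)"
proof -
  have "((\<lambda>h. flat n h / h) \<longlongrightarrow> 0) (at_left 0)"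
    by (rule tendsto_eventually) (auto simp: eventually_at_filter flat_def)
  moreover have "((\<lambda>h. flat n h / h) \<longlongrightarrow> 0) (at_right 0)"
  proof -
    have "((\<lambda>h. inverse h ^ Suc n / exp (inverse h)) \<longlongrightarrow> (0::real)) (at_right 0)"
      by (rule filterlim_compose[OF tendsto_power_div_exp_0 filterlim_inverse_at_top_right])
    then show ?thesis
      by (rule Lim_transform_eventually)
        (auto simp: eventually_at_filter flat_def exp_minus field_simps)
  qed
  ultimately show ?thesis by (simp add: filterlim_at_split)
qed

lemma flat_deriv: "(flat n has_real_derivative flat (n + 2) x - n * flat (n + 1) x) (at x)"
proof -
  consider "x < 0" | "x = 0" | "x > 0" by linarith
  then show ?thesis
  proof cases
    case 1
    have "((\<lambda>x. 0) has_real_derivative 0) (at x)" by simp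
    then have "(flat n has_real_derivative 0) (at x)"
      by (rule has_field_derivative_transform_within_open[where S = "{..<0}"])
        (use 1 in \<open>auto simp: flat_def\<close>)
    then show ?thesis using 1 by (simp add: flat_def)
  next
    case 2
    show ?thesis
      using flat_over_x_tendsto_0[of n] unfolding 2 has_field_derivative_iff
      by (simp add: flat_def)
  next
    case 3
    have "((\<lambda>x. (1 / x) ^ n * exp (- (1 / x))) has_real_derivative
      (1 / x) ^ (n + 2) * exp (- (1 / x)) - n * ((1 / x) ^ (n + 1) * exp (- (1 / x)))) (at x)"
    proof -
      have *: "x * x ^ (n - Suc 0) = x ^ n" if "n \<noteq> 0"
        using that by (cases n) auto
      show ?thesis
        using 3 * by (cases "n = 0") (auto intro!: derivative_eq_intros simp: field_simps power2_eq_square)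
    qed
    then have "(flat n has_real_derivative
      (1 / x) ^ (n + 2) * exp (- (1 / x)) - n * ((1 / x) ^ (n + 1) * exp (- (1 / x)))) (at x)"
      by (rule has_field_derivative_transform_within_open[where S = "{0<..}"])
        (use 3 in \<open>auto simp: flat_def\<close>)
    then show ?thesis using 3 by (simp add: flat_def)
  qed
qed

lemma smooth_flat: "smooth (flat n)"
proof -
  have "higher_differentiable k (flat n)" for k
  proof (induction k arbitrary: n)
    case 0
    then show ?case by (auto intro!: DERIV_isCont[OF flat_deriv] continuous_at_imp_continuous_on)
  next
    case (Suc k)
    show ?case
    proof (rule higher_differentiable_SucI)
      show "(flat n has_derivative (\<lambda>v. (flat (n + 2) x + (- real n) * flat (n + 1) x) * v)) (at x)" for x
        using flat_deriv[of n x] by (simp add: has_field_derivative_def)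
    qed (intro higher_differentiable_mult higher_differentiable_add higher_differentiable_const Suc.IH)
  qed
  then show ?thesis by (simp add: smooth_def)
qed

lemma continuous_real_antiderivative:
  fixes f :: "real \<Rightarrow> real"
  assumes "continuous_on UNIV f"
  obtains F where "\<And>x. (F has_real_derivative f x) (at x)" "F 0 = 0"
proof -
  obtain F where F: "\<And>x. (F has_vector_derivative f x) (at x)"
    using einterval_antiderivative[of "-\<infinity>" "\<infinity>" f] assms
    by (auto simp: continuous_on_eq_continuous_at)
  show ?thesis
    using F by (intro that[of "\<lambda>x. F x - F 0"])
      (auto simp: has_real_derivative_iff_has_vector_derivative intro!: derivative_eq_intros)
qed

text \<open>S rises smoothly from 0 to 1 across the unit interval and b is its derivative, a bump of mass one.\<close>

definition smooth_step :: "(real \<Rightarrow> real) \<Rightarrow> (real \<Rightarrow> real) \<Rightarrow> bool" where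
  "smooth_step S b \<longleftrightarrow> smooth S \<and> smooth b \<and> (\<forall>x. (S has_real_derivative b x) (at x)) \<and>
     (\<forall>x\<le>0. S x = 0) \<and> (\<forall>x\<ge>1. S x = 1) \<and> (\<forall>x. 0 \<le> b x) \<and> (\<forall>x. x \<notin> {0..1} \<longrightarrow> b x = 0)"

lemma smooth_stepD:
  assumes "smooth_step S b"
  shows "smooth S" "smooth b" "\<And>x. (S has_real_derivative b x) (at x)"
    "\<And>x. x \<le> 0 \<Longrightarrow> S x = 0" "\<And>x. x \<ge> 1 \<Longrightarrow> S x = 1"
    "\<And>x. 0 \<le> b x" "\<And>x. x \<notin> {0..1} \<Longrightarrow> b x = 0"
  using assms unfolding smooth_step_def by auto

lemma smooth_step_mono: "smooth_step S b \<Longrightarrow> x \<le> y \<Longrightarrow> S x \<le> S y"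
  by (rule DERIV_nonneg_imp_nondecreasing) (auto dest: smooth_stepD)

lemma smooth_step_bounds:
  assumes "smooth_step S b"
  shows "0 \<le> S x" "S x \<le> 1"
  using smooth_step_mono[OF assms, of "min x 0" x] smooth_step_mono[OF assms, of x "max x 1"]
    smooth_stepD(4)[OF assms, of "min x 0"] smooth_stepD(5)[OF assms, of "max x 1"] by auto

lemma smooth_step_exists: "\<exists>S b. smooth_step S b"
proof -
  \<comment> \<open>A bump on the unit interval; the step is its normalized antiderivative.\<close>
  define w where "w x = flat 0 x * flat 0 (1 - x)" for x
  have w_smooth: "smooth w"
    unfolding w_def
    by (intro smooth_mult smooth_flat smooth_compose[OF smooth_flat] smooth_diff smooth_const
        smooth_linear bounded_linear_ident)
  have w_nonneg: "0 \<le> w x" for x by (simp add: w_def flat_def)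
  have w_0: "w x = 0" if "x \<le> 0 \<or> 1 \<le> x" for x using that by (auto simp: w_def flat_def)
  obtain F where F: "\<And>x. (F has_real_derivative w x) (at x)" "F 0 = 0"
    using continuous_real_antiderivative smooth_continuous[OF w_smooth] by metis
  have F_cont: "continuous_on T F" for T
    using F(1) by (intro DERIV_continuous_on) (auto intro: has_field_derivative_at_within)
  have F_left: "F x = 0" if "x \<le> 0" for x
  proof (cases "x = 0")
    case False
    have "F 0 = F x"
    proof (rule DERIV_isconst2[of x 0 F 0])
      show "(F has_real_derivative 0) (at y)" if "x < y" "y < 0" for y
        using F(1)[of y] w_0[of y] that by simp
    qed (use that False F_cont in auto)
    then show ?thesis using F(2) by simp
  qed (use F in auto)
  have F_right: "F x = F 1" if "1 \<le> x" for x
  proof (cases "x = 1")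
    case False
    show ?thesis
    proof (rule DERIV_isconst2[of 1 x F x])
      show "(F has_real_derivative 0) (at y)" if "1 < y" "y < x" for y
        using F(1)[of y] w_0[of y] that by simp
    qed (use that False F_cont in auto)
  qed simp
  have "F 0 < F 1"
  proof (rule DERIV_pos_imp_increasing_open[of 0 1 F])
    show "\<exists>y. (F has_real_derivative y) (at x) \<and> 0 < y" if "0 < x" "x < 1" for x
      using F(1)[of x] that by (intro exI[of _ "w x"]) (auto simp: w_def flat_def)
  qed (use F_cont in auto)
  then have F1: "0 < F 1" using F(2) by simp
  show ?thesis
    unfolding smooth_step_def
  proof (rule exI[of _ "\<lambda>x. (1 / F 1) * F x"], rule exI[of _ "\<lambda>x. (1 / F 1) * w x"], intro conjI allI impI)
    show "smooth (\<lambda>x. 1 / F 1 * F x)" "smooth (\<lambda>x. 1 / F 1 * w x)"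
      by (intro smooth_mult smooth_const smooth_real_antiderivative[OF F(1)] w_smooth)+
    show "((\<lambda>x. 1 / F 1 * F x) has_real_derivative 1 / F 1 * w x) (at x)" for x
      using F(1) by (rule DERIV_cmult)
    show "1 / F 1 * F x = 0" if "x \<le> 0" for x using F_left[OF that] by simp
    show "1 / F 1 * F x = 1" if "1 \<le> x" for x using F_right[OF that] F1 by simp
    show "0 \<le> 1 / F 1 * w x" for x
      using F1 w_nonneg[of x] by simp
    show "1 / F 1 * w x = 0" if "x \<notin> {0..1}" for x
      using w_0[of x] that by auto
  qed
qed

lemma radius_square_over_ge:
  fixes x :: "'a::real_inner"
  assumes N: "1 \<le> N" and x: "2 * N \<le> norm x"
  shows "2 \<le> (x \<bullet> x) / N"
proof -
  have "2 * N \<le> (2 * N) * (2 * N)" using N by (simp add: mult_le_cancel_left1)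
  also have "\<dots> \<le> norm x * norm x" using x N by (intro mult_mono) auto
  also have "\<dots> = x \<bullet> x" by (simp only: power2_norm_eq_inner power2_eq_square[symmetric])
  finally show ?thesis using N by (simp add: pos_le_divide_eq)
qed

text \<open>The model is \<open>N \<eta> (|x|\<^sup>2 / N)\<close> with a smooth concave \<open>\<eta>\<close> that is the identity near 0 and constant
  far out; then \<open>s x = \<eta>' (|x|\<^sup>2 / N)\<close>.  Concavity gives \<open>s x * |x|\<^sup>2 \<le> f x\<close>, which makes the gradient
  of f controllable by f itself.\<close>

definition quadratic_truncation ::
  "real \<Rightarrow> ('a::euclidean_space \<Rightarrow> real) \<Rightarrow> ('a \<Rightarrow> real) \<Rightarrow> real \<Rightarrow> bool" where
  "quadratic_truncation N f s c \<longleftrightarrow> smooth f \<and> (\<forall>x. 2 * N \<le> norm x \<longrightarrow> f x = c) \<and>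
     (\<forall>x. (norm x)\<^sup>2 \<le> N \<longrightarrow> f x = (norm x)\<^sup>2) \<and> (\<forall>x. f x \<le> (norm x)\<^sup>2) \<and>
     (\<forall>x v. frechet_derivative f (at x) v = s x * (2 * (x \<bullet> v))) \<and>
     (\<forall>x. 0 \<le> s x \<and> s x \<le> 1 \<and> s x * (norm x)\<^sup>2 \<le> f x)"

lemma quadratic_truncationD:
  assumes "quadratic_truncation N f s c"
  shows "smooth f" "\<And>x. 2 * N \<le> norm x \<Longrightarrow> f x = c" "\<And>x. (norm x)\<^sup>2 \<le> N \<Longrightarrow> f x = (norm x)\<^sup>2"
    "\<And>x. f x \<le> (norm x)\<^sup>2" "\<And>x v. frechet_derivative f (at x) v = s x * (2 * (x \<bullet> v))"
    "\<And>x. 0 \<le> s x" "\<And>x. s x \<le> 1" "\<And>x. s x * (norm x)\<^sup>2 \<le> f x"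
  using assms unfolding quadratic_truncation_def by auto

lemma quadratic_truncation_exists:
  assumes N: "1 \<le> N"
  shows "\<exists>(f :: 'a::euclidean_space \<Rightarrow> real) s c. quadratic_truncation N f s c"
proof -
  obtain S b where step: "smooth_step S b" using smooth_step_exists by blast
  note S = smooth_stepD[OF step] and S_bounds = smooth_step_bounds[OF step]
  \<comment> \<open>\<open>\<eta>\<close> is the identity up to 1 and constant from 2 on.\<close>
  obtain \<eta> where \<eta>: "\<And>r. (\<eta> has_real_derivative S (2 - r)) (at r)" "\<eta> 0 = 0"
  proof (rule continuous_real_antiderivative[of "\<lambda>r. S (2 - r)"])
    show "continuous_on UNIV (\<lambda>r. S (2 - r))"
      by (intro continuous_on_compose2[OF smooth_continuous[OF S(1), of UNIV]] continuous_intros) auto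
  qed blast
  have \<eta>_smooth: "smooth \<eta>"
    by (rule smooth_real_antiderivative[OF \<eta>(1)])
      (intro smooth_compose[OF S(1)] smooth_diff smooth_const smooth_linear bounded_linear_ident)
  have \<eta>_mvt: "\<exists>q. 0 < q \<and> q < s \<and> \<eta> s = s * S (2 - q)" if "0 < s" for s
    using MVT2[of 0 s \<eta> "\<lambda>r. S (2 - r)"] \<eta> that by auto
  have \<eta>_le: "\<eta> s \<le> s" and \<eta>_ge: "s * S (2 - s) \<le> \<eta> s" and \<eta>_eq: "s \<le> 1 \<Longrightarrow> \<eta> s = s" if s: "0 \<le> s" for s
  proof -
    have "\<eta> s \<le> s \<and> s * S (2 - s) \<le> \<eta> s \<and> (s \<le> 1 \<longrightarrow> \<eta> s = s)"
    proof (cases "s = 0")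
      case False
      then obtain q where q: "0 < q" "q < s" "\<eta> s = s * S (2 - q)" using \<eta>_mvt[of s] s by auto
      then show ?thesis
        using s S_bounds[of "2 - q"] smooth_step_mono[OF step, of "2 - s" "2 - q"] S(5)[of "2 - q"]
        by (auto intro: mult_left_mono mult_left_le)
    qed (simp add: \<eta>)
    then show "\<eta> s \<le> s" "s * S (2 - s) \<le> \<eta> s" "s \<le> 1 \<Longrightarrow> \<eta> s = s" by auto
  qed
  have \<eta>_const: "\<eta> s = \<eta> 2" if "2 \<le> s" for s
  proof (cases "s = 2")
    case False
    then have "2 < s" using that by simp
    then obtain q where "2 < q" "\<eta> s - \<eta> 2 = (s - 2) * S (2 - q)"
      using MVT2[of 2 s \<eta> "\<lambda>r. S (2 - r)"] \<eta>(1) by blast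
    then show ?thesis using S(4)[of "2 - q"] by simp
  qed simp
  define f where "f x = N * \<eta> ((x \<bullet> x) / N)" for x :: 'a
  have "quadratic_truncation N f (\<lambda>x. S (2 - (x \<bullet> x) / N)) (N * \<eta> 2)"
    unfolding quadratic_truncation_def
  proof (intro conjI allI impI)
    show "smooth f"
      using smooth_mult[OF smooth_const[of N] smooth_compose[OF \<eta>_smooth smooth_mult[OF smooth_const[of "1 / N"] smooth_inner_self]]]
      by (simp add: f_def[abs_def])
    fix x v :: 'a
    have "((\<lambda>x. (x \<bullet> x) / N) has_derivative (\<lambda>v. (2 * (x \<bullet> v)) / N)) (at x)"
      using N by (auto intro!: derivative_eq_intros simp: inner_commute)
    from has_derivative_compose[OF this \<eta>(1)[of "(x \<bullet> x) / N", unfolded has_field_derivative_def]]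
    have "(f has_derivative (\<lambda>v. S (2 - (x \<bullet> x) / N) * (2 * (x \<bullet> v)))) (at x)"
      unfolding f_def using N by (auto intro!: derivative_eq_intros)
    from frechet_derivative_at[OF this, symmetric]
    show "frechet_derivative f (at x) v = S (2 - (x \<bullet> x) / N) * (2 * (x \<bullet> v))" by simp
    show "0 \<le> S (2 - (x \<bullet> x) / N)" "S (2 - (x \<bullet> x) / N) \<le> 1" by (rule S_bounds)+
    show "f x \<le> (norm x)\<^sup>2"
      using \<eta>_le[of "(x \<bullet> x) / N"] N by (simp add: f_def power2_norm_eq_inner field_simps)
    show "S (2 - (x \<bullet> x) / N) * (norm x)\<^sup>2 \<le> f x"
      using \<eta>_ge[of "(x \<bullet> x) / N"] N by (simp add: f_def power2_norm_eq_inner field_simps)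
    show "f x = N * \<eta> 2" if "2 * N \<le> norm x"
      using \<eta>_const[OF radius_square_over_ge[OF N that]] by (simp only: f_def)
    show "f x = (norm x)\<^sup>2" if "(norm x)\<^sup>2 \<le> N"
      using that N \<eta>_eq[of "(x \<bullet> x) / N"] by (simp add: f_def power2_norm_eq_inner)
  qed
  then show ?thesis by blast
qed

text \<open>The last condition states \<open>|\<nabla>\<kappa>| \<le> k |x| / (1 + |x|\<^sup>2)\<close> with k independent of N, so that
  multiplying a function of quadratic growth by \<open>\<kappa>\<close> adds to its gradient a term of linear growth,
  uniformly in N.\<close>

definition radial_cutoff :: "real \<Rightarrow> real \<Rightarrow> ('a::euclidean_space \<Rightarrow> real) \<Rightarrow> bool" where
  "radial_cutoff k N \<kappa> \<longleftrightarrow> smooth \<kappa> \<and> (\<forall>x. 0 \<le> \<kappa> x \<and> \<kappa> x \<le> 1) \<and> (\<forall>x. 2 * N \<le> norm x \<longrightarrow> \<kappa> x = 0) \<and>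
     (\<forall>x. (norm x)\<^sup>2 < N \<longrightarrow> \<kappa> x = 1 \<and> (\<forall>v. frechet_derivative \<kappa> (at x) v = 0)) \<and>
     (\<forall>x v. (1 + (norm x)\<^sup>2) * \<bar>frechet_derivative \<kappa> (at x) v\<bar> \<le> k * (norm x * norm v))"

lemma radial_cutoffD:
  assumes "radial_cutoff k N \<kappa>"
  shows "smooth \<kappa>" "\<And>x. 0 \<le> \<kappa> x" "\<And>x. \<kappa> x \<le> 1" "\<And>x. 2 * N \<le> norm x \<Longrightarrow> \<kappa> x = 0"
    "\<And>x. (norm x)\<^sup>2 < N \<Longrightarrow> \<kappa> x = 1" "\<And>x v. (norm x)\<^sup>2 < N \<Longrightarrow> frechet_derivative \<kappa> (at x) v = 0"
    "\<And>x v. (1 + (norm x)\<^sup>2) * \<bar>frechet_derivative \<kappa> (at x) v\<bar> \<le> k * (norm x * norm v)"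
  using assms unfolding radial_cutoff_def by auto

lemma radial_cutoff_exists:
  "\<exists>k\<ge>0. \<forall>N\<ge>1. \<exists>\<kappa> :: 'a::euclidean_space \<Rightarrow> real. radial_cutoff k N \<kappa>"
proof -
  obtain S b where step: "smooth_step S b" using smooth_step_exists by blast
  note S = smooth_stepD[OF step] and S_bounds = smooth_step_bounds[OF step]
  obtain kb where kb0: "0 \<le> kb" and kb1: "\<And>y. y \<in> {0..1} \<Longrightarrow> norm (b y) \<le> kb"
    using continuous_path_bounded[OF smooth_continuous[OF S(2)]] by blast
  have kb: "b y \<le> kb" for y
  proof (cases "y \<in> {0..1}")
    case True
    then show ?thesis using kb1[of y] by simp
  next
    case False
    then show ?thesis using S(7)[of y] kb0 by simp
  qed
  have "radial_cutoff (6 * kb) N (\<lambda>x :: 'a. S (2 - (x \<bullet> x) / N))" if N: "1 \<le> N" for N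
    unfolding radial_cutoff_def
  proof (intro conjI allI impI)
    show "smooth (\<lambda>x :: 'a. S (2 - (x \<bullet> x) / N))"
      using smooth_compose[OF S(1) smooth_diff[OF smooth_const[of 2] smooth_mult[OF smooth_const[of "1 / N"] smooth_inner_self]]]
      by simp
    fix x v :: 'a
    let ?s = "2 - (x \<bullet> x) / N"
    show "0 \<le> S ?s" "S ?s \<le> 1" by (rule S_bounds)+
    show "S ?s = 0" if "2 * N \<le> norm x"
      using radius_square_over_ge[OF N that] by (simp add: S(4))
    have "((\<lambda>x. 2 - (x \<bullet> x) / N) has_derivative (\<lambda>v. - (2 * (x \<bullet> v) / N))) (at x)"
      using N by (auto intro!: derivative_eq_intros simp: inner_commute)
    from has_derivative_compose[OF this S(3)[of ?s, unfolded has_field_derivative_def]]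
    have "((\<lambda>x. S (2 - (x \<bullet> x) / N)) has_derivative (\<lambda>v. - (b ?s * (2 * (x \<bullet> v) / N)))) (at x)"
      by simp
    from frechet_derivative_at[OF this, symmetric]
    have D: "frechet_derivative (\<lambda>x. S (2 - (x \<bullet> x) / N)) (at x) v = - (b ?s * (2 * (x \<bullet> v) / N))" for v by simp
    show "S ?s = 1" "frechet_derivative (\<lambda>x. S (2 - (x \<bullet> x) / N)) (at x) v = 0" if "(norm x)\<^sup>2 < N"
    proof -
      have "1 < ?s" using that N by (simp add: power2_norm_eq_inner field_simps)
      then show "S ?s = 1" "frechet_derivative (\<lambda>x. S (2 - (x \<bullet> x) / N)) (at x) v = 0"
        unfolding D by (simp_all add: S(5) S(7))
    qed
    show "(1 + (norm x)\<^sup>2) * \<bar>frechet_derivative (\<lambda>x. S (2 - (x \<bullet> x) / N)) (at x) v\<bar> \<le> 6 * kb * (norm x * norm v)"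
    proof (cases "b ?s = 0")
      case False
      then have "?s \<in> {0..1}" using S(7) by blast
      \<comment> \<open>The derivative of the cutoff lives where \<open>N \<le> |x|\<^sup>2 \<le> 2N\<close>.\<close>
      then have "(norm x)\<^sup>2 \<le> 2 * N" using N by (simp add: power2_norm_eq_inner field_simps)
      then have "(1 + (norm x)\<^sup>2) / N \<le> 3" using N by (simp add: field_simps)
      moreover have "\<bar>x \<bullet> v\<bar> \<le> norm x * norm v" by (rule Cauchy_Schwarz_ineq2)
      ultimately have "(1 + (norm x)\<^sup>2) / N * b ?s * (2 * \<bar>x \<bullet> v\<bar>) \<le> 3 * kb * (2 * (norm x * norm v))"
        using kb kb0 S(6)[of ?s] by (intro mult_mono) auto
      moreover have "(1 + (norm x)\<^sup>2) * \<bar>frechet_derivative (\<lambda>x. S (2 - (x \<bullet> x) / N)) (at x) v\<bar>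
          = (1 + (norm x)\<^sup>2) / N * b ?s * (2 * \<bar>x \<bullet> v\<bar>)"
        unfolding D using N S(6)[of ?s] by (simp add: abs_mult)
      ultimately show ?thesis by simp
    qed (use kb0 in \<open>simp add: D\<close>)
  qed
  then show ?thesis using kb0 by (intro exI[of _ "6 * kb"]) auto
qed

section \<open>Weak derivatives in time\<close>

definition unit_time :: "real measure" where
  "unit_time = restrict_space lborel {0..1}"

lemma space_unit_time [simp]: "space unit_time = {0..1}"
  by (simp add: unit_time_def space_restrict_space)

lemma sets_unit_time [measurable_cong]: "sets unit_time = sets (restrict_space borel {0..1})"
  unfolding unit_time_def by (rule sets_restrict_space_cong) simp

lemma prob_space_unit_time: "prob_space unit_time"
  by standard (simp add: unit_time_def space_restrict_space emeasure_restrict_space)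

interpretation unit_time: prob_space unit_time
  by (rule prob_space_unit_time)

lemma unit_time_measurable_id [measurable]: "(\<lambda>t. t) \<in> borel_measurable unit_time"
  unfolding unit_time_def by (rule measurable_restrict_space1) simp

lemma continuous_on_unit_time_measurable:
  fixes f :: "real \<Rightarrow> 'a::topological_space"
  assumes "continuous_on {0..1} f"
  shows "f \<in> borel_measurable unit_time"
  using borel_measurable_continuous_on_restrict[OF assms] measurable_cong_sets[OF sets_unit_time refl] by blast

lemma continuous_on_unit_time_integrable:
  fixes f :: "real \<Rightarrow> real"
  assumes "continuous_on {0..1} f"
  shows "integrable unit_time f"
proof -
  obtain c where c: "\<And>t. t \<in> {0..1} \<Longrightarrow> norm (f t) \<le> c"
    using continuous_path_bounded[OF assms] by blast
  show ?thesis
    by (rule unit_time.integrable_const_bound[of f c])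
      (use c in \<open>auto intro: continuous_on_unit_time_measurable assms\<close>)
qed

lemma integral_unit_time: "(\<integral>t. f t \<partial>unit_time) = (LINT t:{0..1}|lborel. f t)"
  for f :: "real \<Rightarrow> real"
  by (simp add: unit_time_def integral_restrict_space set_lebesgue_integral_def)

lemma AE_unit_time_neq: "AE t in unit_time. t \<noteq> c"
  unfolding unit_time_def by (subst AE_restrict_space_iff) (auto intro: AE_mp[OF AE_lborel_singleton[of c]])

lemma integral_unit_time_FTC:
  fixes a :: "real \<Rightarrow> real"
  assumes a: "\<And>t. t \<in> {0..1} \<Longrightarrow> (a has_real_derivative a' t) (at t within {0..1})"
    and a': "continuous_on {0..1} a'" and st: "0 \<le> s" "s \<le> t" "t \<le> 1"
  shows "(\<integral>r. indicator {s..t} r * a' r \<partial>unit_time) = a t - a s"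
proof -
  have "(\<integral>r. indicator {s..t} r * a' r \<partial>unit_time) = (\<integral>r. indicator {s..t} r *\<^sub>R a' r \<partial>lborel)"
    unfolding integral_unit_time set_lebesgue_integral_def
    using st by (intro Bochner_Integration.integral_cong) (auto simp: indicator_def)
  also have "\<dots> = a t - a s"
  proof (rule integral_FTC_atLeastAtMost[OF st(2)])
    show "(a has_vector_derivative a' r) (at r within {s..t})" if "s \<le> r" "r \<le> t" for r
      using a[of r] that st
      by (auto simp: has_real_derivative_iff_has_vector_derivative intro: has_vector_derivative_within_subset)
    show "continuous_on {s..t} a'" using st by (intro continuous_on_subset[OF a']) auto
  qed
  finally show ?thesis .
qed

lemma indefinite_integral_continuous_unit_time:
  fixes G :: "real \<Rightarrow> real"
  assumes G: "integrable unit_time G"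
  shows "continuous_on {0..1} (\<lambda>t. \<integral>r. indicator {0..t} r * G r \<partial>unit_time)"
  unfolding continuous_on_sequentially comp_def
proof safe
  fix x :: "nat \<Rightarrow> real" and t assume t: "x \<longlonglongrightarrow> t"
  have [measurable]: "G \<in> borel_measurable unit_time" using G by auto
  show "(\<lambda>n. \<integral>r. indicator {0..x n} r * G r \<partial>unit_time) \<longlonglongrightarrow> (\<integral>r. indicator {0..t} r * G r \<partial>unit_time)"
  proof (rule integral_dominated_convergence[where w = "\<lambda>r. norm (G r)"])
    show "AE r in unit_time. (\<lambda>n. indicator {0..x n} r * G r) \<longlonglongrightarrow> indicator {0..t} r * G r"
      using AE_unit_time_neq[of t] AE_space
    proof eventually_elim
      case (elim r)
      consider "r < t" | "t < r" using elim by linarith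
      then have "\<forall>\<^sub>F n in sequentially. indicator {0..x n} r = (indicator {0..t} r :: real)"
      proof cases
        case 1
        from order_tendstoD(1)[OF t this] show ?thesis
          by eventually_elim (use 1 in \<open>auto simp: indicator_def\<close>)
      next
        case 2
        from order_tendstoD(2)[OF t this] show ?thesis
          by eventually_elim (use 2 in \<open>auto simp: indicator_def\<close>)
      qed
      then show ?case by (intro tendsto_mult_right tendsto_eventually)
    qed
  qed (use G in \<open>auto simp: indicator_def\<close>)
qed

text \<open>The bumps \<open>b ((r - p) / \<epsilon>) / \<epsilon>\<close> have mass one on the unit interval and concentrate at p from the
  right.\<close>

lemma smooth_mollifier_tendsto:
  fixes F :: "real \<Rightarrow> real"
  assumes F: "continuous_on {0..1} F" and p: "0 < p" and \<epsilon>: "\<And>n. 0 < \<epsilon> n" "\<And>n. p + \<epsilon> n < 1" "\<epsilon> \<longlonglongrightarrow> 0"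
    and S: "\<And>x. (S has_real_derivative b x) (at x)" "\<And>x. x \<le> 0 \<Longrightarrow> S x = 0" "\<And>x. x \<ge> 1 \<Longrightarrow> S x = 1"
    and b: "continuous_on UNIV b" "\<And>x. 0 \<le> b x" "\<And>x. x \<notin> {0..1} \<Longrightarrow> b x = (0::real)"
  shows "(\<lambda>n. \<integral>r. b ((r - p) / \<epsilon> n) / \<epsilon> n * F r \<partial>unit_time) \<longlonglongrightarrow> F p"
proof (rule LIMSEQ_I)
  fix e :: real assume e: "0 < e"
  let ?b = "\<lambda>n r. b ((r - p) / \<epsilon> n) / \<epsilon> n"
  have bc: "continuous_on {0..1} (?b n)" for n
    using \<epsilon>(1)[of n] by (intro continuous_intros continuous_on_compose2[OF b(1)]) auto
  have b1: "(\<integral>r. ?b n r \<partial>unit_time) = 1" for n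
  proof -
    have "(\<integral>r. ?b n r \<partial>unit_time) = (\<integral>r. indicator {0..1} r * ?b n r \<partial>unit_time)"
      by (intro Bochner_Integration.integral_cong) auto
    also have "\<dots> = S ((1 - p) / \<epsilon> n) - S ((0 - p) / \<epsilon> n)"
    proof (rule integral_unit_time_FTC)
      show "((\<lambda>r. S ((r - p) / \<epsilon> n)) has_real_derivative ?b n r) (at r within {0..1})" for r
      proof -
        have "((\<lambda>r. (r - p) / \<epsilon> n) has_real_derivative 1 / \<epsilon> n) (at r within {0..1})"
          using \<epsilon>(1)[of n] by (auto intro!: derivative_eq_intros)
        from DERIV_chain'[OF this S(1)] show ?thesis by simp
      qed
    qed (use bc in auto)
    also have "\<dots> = 1"
      using p \<epsilon>(1,2)[of n] by (subst S(2), simp add: field_simps, subst S(3)) (auto simp: field_simps)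
    finally show ?thesis .
  qed
  have p1: "p \<in> {0..1}" using p \<epsilon>(1,2)[of 0] by auto
  obtain \<eta> where \<eta>: "0 < \<eta>" "\<And>r. r \<in> {0..1} \<Longrightarrow> dist r p < \<eta> \<Longrightarrow> dist (F r) (F p) < e / 2"
    using F p1 e unfolding continuous_on_iff by (meson half_gt_zero)
  obtain N where N: "\<And>n. n \<ge> N \<Longrightarrow> \<epsilon> n < \<eta>"
    using order_tendstoD(2)[OF \<epsilon>(3) \<eta>(1)] by (auto simp: eventually_sequentially)
  show "\<exists>N. \<forall>n\<ge>N. norm ((\<integral>r. ?b n r * F r \<partial>unit_time) - F p) < e"
  proof (intro exI allI impI)
    fix n assume n: "N \<le> n"
    have "(\<integral>r. ?b n r * F r \<partial>unit_time) - F p = (\<integral>r. ?b n r * F r - ?b n r * F p \<partial>unit_time)"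
    proof (subst Bochner_Integration.integral_diff)
      show "integrable unit_time (\<lambda>r. ?b n r * F r)" "integrable unit_time (\<lambda>r. ?b n r * F p)"
        by (intro continuous_on_unit_time_integrable continuous_on_mult bc F continuous_on_const)+
      show "(\<integral>r. ?b n r * F r \<partial>unit_time) - F p = (\<integral>r. ?b n r * F r \<partial>unit_time) - (\<integral>r. ?b n r * F p \<partial>unit_time)"
        unfolding integral_mult_left_zero b1 by simp
    qed
    then have "norm ((\<integral>r. ?b n r * F r \<partial>unit_time) - F p) = norm (\<integral>r. ?b n r * F r - ?b n r * F p \<partial>unit_time)" by simp
    also have "\<dots> \<le> (\<integral>r. ?b n r * (e / 2) \<partial>unit_time)"
    proof (rule Bochner_Integration.integral_norm_bound_integral)
      fix r assume "r \<in> space unit_time"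
      then have r: "r \<in> {0..1}" by simp
      show "norm (?b n r * F r - ?b n r * F p) \<le> ?b n r * (e / 2)"
      proof (cases "(r - p) / \<epsilon> n \<in> {0..1}")
        case True
        then have "dist r p < \<eta>"
          using N[OF n] \<epsilon>(1)[of n] by (auto simp: dist_real_def field_simps)
        from \<eta>(2)[OF r this] have "\<bar>F r - F p\<bar> \<le> e / 2" by (simp add: dist_real_def)
        then have "?b n r * \<bar>F r - F p\<bar> \<le> ?b n r * (e / 2)"
          using b(2) \<epsilon>(1)[of n] by (intro mult_left_mono) auto
        then show ?thesis
          unfolding real_norm_def right_diff_distrib[symmetric] abs_mult
          using b(2) \<epsilon>(1)[of n] by (simp only: abs_of_nonneg divide_nonneg_pos)
      qed (simp add: b(3))
    qed (intro continuous_on_unit_time_integrable continuous_on_mult continuous_on_diff bc F continuous_on_const)+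
    also have "\<dots> = e / 2" unfolding integral_mult_left_zero b1 by simp
    finally show "norm ((\<integral>r. ?b n r * F r \<partial>unit_time) - F p) < e" using e by simp
  qed
qed

text \<open>The lemma of du Bois-Reymond: testing with a smoothed indicator of \<open>{s..t}\<close>, whose derivative
  concentrates at the two end points, turns the weak derivative into an increment.\<close>

lemma weak_derivative_increment:
  fixes F G :: "real \<Rightarrow> real"
  assumes F: "continuous_on {0..1} F" and G: "integrable unit_time G"
    and weak: "\<And>\<theta> \<theta>' a b. smooth \<theta> \<Longrightarrow> (\<And>t. (\<theta> has_real_derivative \<theta>' t) (at t)) \<Longrightarrow> 0 < a \<Longrightarrow> b < 1 \<Longrightarrow>
      (\<And>t. t \<notin> {a..b} \<Longrightarrow> \<theta> t = 0) \<Longrightarrow> (\<integral>t. \<theta>' t * F t + \<theta> t * G t \<partial>unit_time) = 0"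
    and t: "t \<in> {0..1}"
  shows "F t = F 0 + (\<integral>r. indicator {0..t} r * G r \<partial>unit_time)"
proof -
  obtain S b where step: "smooth_step S b" using smooth_step_exists by blast
  note S = smooth_stepD(1)[OF step] and b_smooth = smooth_stepD(2)[OF step] and S' = smooth_stepD(3)[OF step]
    and S0 = smooth_stepD(4)[OF step] and S1 = smooth_stepD(5)[OF step]
    and b = smooth_stepD(6,7)[OF step] and S_bounds = smooth_step_bounds[OF step]
  note b_cont = smooth_continuous[OF b_smooth]
  have [measurable]: "G \<in> borel_measurable unit_time" "S \<in> borel_measurable borel"
    using G smooth_continuous[OF S] by (auto intro: borel_measurable_continuous_onI)
  define I where "I t = (\<integral>r. indicator {0..t} r * G r \<partial>unit_time)" for t
  have ind_int: "integrable unit_time (\<lambda>r. indicator A r * G r)" if [measurable]: "A \<in> sets borel" for A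
    by (rule Bochner_Integration.integrable_bound[OF G]) (auto simp: indicator_def)
  have incr: "F t - F s = I t - I s" if st: "0 < s" "s < t" "t < 1" for s t
  proof -
    \<comment> \<open>Small enough to keep the support of the test function, \<open>{s..t + \<epsilon> n}\<close>, inside the open interval.\<close>
    define \<epsilon> where "\<epsilon> n = (1 - t) / (2 + real n)" for n
    have \<epsilon>_pos: "0 < \<epsilon> n" for n using st by (simp add: \<epsilon>_def)
    have \<epsilon>_le: "\<epsilon> n \<le> (1 - t) / 2" for n
      unfolding \<epsilon>_def using st by (intro divide_left_mono) auto
    have \<epsilon>_lt: "t + \<epsilon> n < 1" for n using \<epsilon>_le[of n] st by (simp add: field_simps)
    have \<epsilon>_lim: "\<epsilon> \<longlonglongrightarrow> 0"
      unfolding \<epsilon>_def by real_asymp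
    define \<theta> where "\<theta> n r = S ((r - s) / \<epsilon> n) - S ((r - t) / \<epsilon> n)" for n r
    define \<theta>' where "\<theta>' n r = b ((r - s) / \<epsilon> n) / \<epsilon> n - b ((r - t) / \<epsilon> n) / \<epsilon> n" for n r
    have smooth_arg: "smooth (\<lambda>r. (r - p) / \<epsilon> n)" for p n
      using smooth_mult[OF smooth_const[of "1 / \<epsilon> n"] smooth_diff[OF smooth_linear[OF bounded_linear_ident] smooth_const[of p]]]
      by simp
    have \<theta>_deriv: "(\<theta> n has_real_derivative \<theta>' n r) (at r)" for n r
      unfolding \<theta>_def \<theta>'_def using \<epsilon>_pos[of n]
      by (auto intro!: derivative_eq_intros DERIV_chain'[OF _ S'] simp: field_simps)
    have \<theta>_supp: "\<theta> n r = 0" if "r \<notin> {s..t + \<epsilon> n}" for n r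
    proof (cases "r < s")
      case True
      then show ?thesis using st \<epsilon>_pos[of n] by (simp add: \<theta>_def S0 divide_nonpos_pos)
    next
      case False
      then have "1 \<le> (r - t) / \<epsilon> n" "1 \<le> (r - s) / \<epsilon> n"
        using that st \<epsilon>_pos[of n] by (auto simp: field_simps)
      then show ?thesis by (simp add: \<theta>_def S1)
    qed
    have zero: "(\<integral>r. \<theta>' n r * F r + \<theta> n r * G r \<partial>unit_time) = 0" for n
      unfolding \<theta>_def by (rule weak[OF smooth_diff[OF smooth_compose[OF S smooth_arg] smooth_compose[OF S smooth_arg]]
            \<theta>_deriv[unfolded \<theta>_def] _ _ \<theta>_supp[unfolded \<theta>_def]]) (use st \<epsilon>_lt in auto)
    have \<theta>_bound: "\<bar>\<theta> n r\<bar> \<le> 1" for n r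
      unfolding \<theta>_def using S_bounds[of "(r - s) / \<epsilon> n"] S_bounds[of "(r - t) / \<epsilon> n"] by (simp add: abs_le_iff)
    have \<theta>_meas [measurable]: "\<theta> n \<in> borel_measurable borel" for n unfolding \<theta>_def by measurable
    have \<theta>G: "integrable unit_time (\<lambda>r. \<theta> n r * G r)" for n
      by (rule Bochner_Integration.integrable_bound[OF G])
        (use \<theta>_bound[of n] in \<open>auto simp: abs_mult intro!: mult_left_le_one_le\<close>)
    have b_int: "integrable unit_time (\<lambda>r. b ((r - p) / \<epsilon> n) / \<epsilon> n * F r)" for n p
      using \<epsilon>_pos[of n] by (intro continuous_on_unit_time_integrable continuous_intros F
          continuous_on_compose2[OF b_cont[of UNIV]]) auto
    have split: "(\<integral>r. b ((r - s) / \<epsilon> n) / \<epsilon> n * F r \<partial>unit_time) - (\<integral>r. b ((r - t) / \<epsilon> n) / \<epsilon> n * F r \<partial>unit_time)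
        + (\<integral>r. \<theta> n r * G r \<partial>unit_time) = 0" for n
      using zero[of n] \<theta>G[of n] b_int[of s n] b_int[of t n] by (simp add: \<theta>'_def left_diff_distrib)
    have lim_b: "(\<lambda>n. \<integral>r. b ((r - p) / \<epsilon> n) / \<epsilon> n * F r \<partial>unit_time) \<longlonglongrightarrow> F p" if "p = s \<or> p = t" for p
    proof (rule smooth_mollifier_tendsto[OF F _ \<epsilon>_pos _ \<epsilon>_lim S' S0 S1 b_cont b])
      show "p + \<epsilon> n < 1" for n using that st \<epsilon>_lt[of n] by auto
    qed (use that st in auto)
    have lim_\<theta>: "(\<lambda>n. \<integral>r. \<theta> n r * G r \<partial>unit_time) \<longlonglongrightarrow> (\<integral>r. indicator {s<..t} r * G r \<partial>unit_time)"
    proof (rule integral_dominated_convergence[where w = "\<lambda>r. norm (G r)"])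
      show "AE r in unit_time. (\<lambda>n. \<theta> n r * G r) \<longlonglongrightarrow> indicator {s<..t} r * G r"
      proof (intro AE_I2 tendsto_mult_right tendsto_eventually)
        fix r
        have step: "\<forall>\<^sub>F n in sequentially. S ((r - p) / \<epsilon> n) = (if p < r then 1 else 0)" for p
        proof (cases "p < r")
          case True
          from order_tendstoD(2)[OF \<epsilon>_lim, of "r - p"] True
          have "\<forall>\<^sub>F n in sequentially. \<epsilon> n < r - p" by simp
          then show ?thesis
            by eventually_elim (use True \<epsilon>_pos in \<open>auto intro!: S1 simp: field_simps less_imp_le\<close>)
        next
          case False
          then show ?thesis using \<epsilon>_pos by (auto intro!: S0 always_eventually divide_nonpos_pos)
        qed
        from step[of s] step[of t]
        show "\<forall>\<^sub>F n in sequentially. \<theta> n r = indicator {s<..t} r"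
          by eventually_elim (use st in \<open>auto simp: \<theta>_def indicator_def\<close>)
      qed
      show "AE r in unit_time. norm (\<theta> n r * G r) \<le> norm (G r)" for n
        using \<theta>_bound[of n] by (auto simp: abs_mult intro!: mult_left_le_one_le)
    qed (use G in auto)
    have "(\<lambda>n. 0) \<longlonglongrightarrow> F s - F t + (\<integral>r. indicator {s<..t} r * G r \<partial>unit_time)"
      using tendsto_add[OF tendsto_diff[OF lim_b[of s] lim_b[of t]] lim_\<theta>] unfolding split by simp
    then have "F s - F t + (\<integral>r. indicator {s<..t} r * G r \<partial>unit_time) = 0"
      by (simp add: LIMSEQ_const_iff)
    moreover have "I t = (\<integral>r. indicator {0..s} r * G r + indicator {s<..t} r * G r \<partial>unit_time)"
      unfolding I_def using st by (intro Bochner_Integration.integral_cong) (auto simp: indicator_def)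
    ultimately show ?thesis using ind_int by (simp add: I_def)
  qed
  define H where "H t = F t - I t" for t
  have H_cont: "continuous_on {0..1} H"
    unfolding H_def I_def by (intro continuous_intros F indefinite_integral_continuous_unit_time G)
  have H_const: "H x = H (1/2)" if x: "x \<in> {0..1}" for x
  proof (rule continuous_constant_on_closure[of "{0<..<1}" H])
    show "H x = H (1/2)" if x: "x \<in> {0<..<1}" for x
    proof (cases x "1/2 :: real" rule: linorder_cases)
      case less
      then show ?thesis using incr[of x "1/2"] x by (simp add: H_def)
    next
      case greater
      then show ?thesis using incr[of "1/2" x] x by (simp add: H_def)
    qed (simp only:)
  qed (use H_cont x in \<open>auto simp: closure_greaterThanLessThan\<close>)
  have "I 0 = (\<integral>r. 0 \<partial>unit_time)"
    unfolding I_def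
  proof (rule integral_cong_AE)
    show "AE r in unit_time. indicator {0..0} r * G r = 0"
      using AE_unit_time_neq[of 0] by eventually_elim (auto simp: indicator_def)
  qed measurable
  then have "I 0 = 0" by simp
  then show ?thesis
    using H_const[OF t] H_const[of 0] by (simp add: H_def I_def)
qed

text \<open>Integration by parts for a function F that is only an indefinite Lebesgue integral, by Fubini's
  theorem on the triangle \<open>{(s, t). s \<le> t}\<close>.\<close>

lemma product_rule_unit_time:
  fixes F G a a' :: "real \<Rightarrow> real"
  assumes F: "\<And>t. t \<in> {0..1} \<Longrightarrow> F t = F 0 + (\<integral>r. indicator {0..t} r * G r \<partial>unit_time)"
    and G: "integrable unit_time G"
    and a: "\<And>t. t \<in> {0..1} \<Longrightarrow> (a has_real_derivative a' t) (at t within {0..1})"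
    and a': "continuous_on {0..1} a'"
  shows "integrable unit_time (\<lambda>t. a' t * F t)" "integrable unit_time (\<lambda>t. a t * G t)"
    and "a 1 * F 1 - a 0 * F 0 = (\<integral>t. a' t * F t \<partial>unit_time) + (\<integral>t. a t * G t \<partial>unit_time)"
proof -
  interpret P: pair_sigma_finite unit_time unit_time ..
  have a_cont: "continuous_on {0..1} a"
    using a by (intro DERIV_continuous_on) auto
  have [measurable]: "G \<in> borel_measurable unit_time" "a' \<in> borel_measurable unit_time" "a \<in> borel_measurable unit_time"
    using G by (auto intro: continuous_on_unit_time_measurable a' a_cont)
  have F_cont: "continuous_on {0..1} F"
    by (subst continuous_on_cong[OF refl F]) (auto intro!: continuous_intros indefinite_integral_continuous_unit_time G)
  show int1: "integrable unit_time (\<lambda>t. a' t * F t)"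
    by (intro continuous_on_unit_time_integrable continuous_intros a' F_cont)
  have bounded_times_G: "integrable unit_time (\<lambda>t. c t * G t)" if c: "continuous_on {0..1} c" for c
  proof -
    obtain k where "0 \<le> k" and k: "\<And>t. t \<in> {0..1} \<Longrightarrow> \<bar>c t\<bar> \<le> k"
      using continuous_path_bounded[OF c] unfolding real_norm_def by blast
    have [measurable]: "c \<in> borel_measurable unit_time" by (rule continuous_on_unit_time_measurable[OF c])
    show ?thesis
      using G \<open>0 \<le> k\<close> by (intro Bochner_Integration.integrable_bound[OF integrable_mult_right[OF G, of k]])
        (auto simp: abs_mult intro!: mult_right_mono k)
  qed
  show int2: "integrable unit_time (\<lambda>t. a t * G t)" by (rule bounded_times_G[OF a_cont])
  let ?f = "\<lambda>t s. a' t * (if s \<le> t then G s else 0)"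
  have f_int: "integrable (unit_time \<Otimes>\<^sub>M unit_time) (case_prod ?f)"
  proof (rule Bochner_Integration.integrable_bound)
    show "integrable (unit_time \<Otimes>\<^sub>M unit_time) (\<lambda>(t, s). a' t * G s)"
    proof (rule P.Fubini_integrable)
      show "integrable unit_time (\<lambda>t. \<integral>s. norm (case (t, s) of (t, s) \<Rightarrow> a' t * G s) \<partial>unit_time)"
        by (auto simp: abs_mult intro!: integrable_mult_left integrable_abs continuous_on_unit_time_integrable continuous_intros a')
      show "AE t in unit_time. integrable unit_time (\<lambda>s. case (t, s) of (t, s) \<Rightarrow> a' t * G s)"
        using G by auto
    qed measurable
  qed (auto split: prod.split)
  have swap: "(\<integral>t. \<integral>s. ?f t s \<partial>unit_time \<partial>unit_time) = (\<integral>s. \<integral>t. ?f t s \<partial>unit_time \<partial>unit_time)"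
    using P.Fubini_integral[OF f_int] by simp
  have inner: "(\<integral>s. ?f t s \<partial>unit_time) = a' t * (F t - F 0)" if "t \<in> space unit_time" for t
  proof -
    have "(\<integral>s. ?f t s \<partial>unit_time) = a' t * (\<integral>s. indicator {0..t} s * G s \<partial>unit_time)"
      by (subst integral_mult_right_zero[symmetric], intro Bochner_Integration.integral_cong) (auto simp: indicator_def)
    then show ?thesis using F[of t] that by simp
  qed
  have outer: "(\<integral>t. ?f t s \<partial>unit_time) = (a 1 - a s) * G s" if "s \<in> space unit_time" for s
  proof -
    have "(\<integral>t. ?f t s \<partial>unit_time) = (\<integral>t. indicator {s..1} t * a' t \<partial>unit_time) * G s"
      by (subst integral_mult_left_zero[symmetric], intro Bochner_Integration.integral_cong) (auto simp: indicator_def)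
    then show ?thesis using integral_unit_time_FTC[OF a a', of s 1] that by simp
  qed
  have "(\<integral>t. a' t * (F t - F 0) \<partial>unit_time) = (\<integral>t. \<integral>s. ?f t s \<partial>unit_time \<partial>unit_time)"
    by (intro Bochner_Integration.integral_cong refl inner[symmetric])
  also have "\<dots> = (\<integral>s. (a 1 - a s) * G s \<partial>unit_time)"
    unfolding swap by (intro Bochner_Integration.integral_cong refl outer)
  finally have "(\<integral>t. a' t * (F t - F 0) \<partial>unit_time) = (\<integral>s. (a 1 - a s) * G s \<partial>unit_time)" .
  moreover have "(\<integral>t. a' t * (F t - F 0) \<partial>unit_time) = (\<integral>t. a' t * F t \<partial>unit_time) - (a 1 - a 0) * F 0"
  proof -
    have "(\<integral>t. a' t \<partial>unit_time) = (\<integral>t. indicator {0..1} t * a' t \<partial>unit_time)"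
      by (intro Bochner_Integration.integral_cong) auto
    also have "\<dots> = a 1 - a 0" by (rule integral_unit_time_FTC[OF a a']) auto
    finally have "(\<integral>t. a' t \<partial>unit_time) = a 1 - a 0" .
    then show ?thesis
      using int1 continuous_on_unit_time_integrable[OF a'] by (simp add: right_diff_distrib)
  qed
  moreover have "(\<integral>s. (a 1 - a s) * G s \<partial>unit_time) = a 1 * (F 1 - F 0) - (\<integral>t. a t * G t \<partial>unit_time)"
  proof -
    have "(\<integral>r. G r \<partial>unit_time) = (\<integral>r. indicator {0..1} r * G r \<partial>unit_time)"
      by (intro Bochner_Integration.integral_cong) auto
    then have "(\<integral>r. G r \<partial>unit_time) = F 1 - F 0" using F[of 1] by simp
    then show ?thesis using int2 G by (simp add: left_diff_distrib)
  qed
  ultimately show "a 1 * F 1 - a 0 * F 0 = (\<integral>t. a' t * F t \<partial>unit_time) + (\<integral>t. a t * G t \<partial>unit_time)"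
    by (simp add: algebra_simps)
qed

text \<open>Gronwall's inequality in integral form.  At a maximizer of \<open>e t * exp (-2Kt)\<close> the integral on
  the right-hand side absorbs only half of the left-hand side.\<close>

lemma gronwall_unit_time:
  fixes e :: "real \<Rightarrow> real"
  assumes e: "continuous_on {0..1} e" and nonneg: "\<And>t. t \<in> {0..1} \<Longrightarrow> 0 \<le> e t" and K: "0 < K"
    and le: "\<And>t. t \<in> {0..1} \<Longrightarrow> e t \<le> c + K * (\<integral>r. indicator {0..t} r * e r \<partial>unit_time)"
    and t: "t \<in> {0..1}"
  shows "e t \<le> 2 * c * exp (2 * K)"
proof -
  let ?g = "\<lambda>t. e t * exp (- (2 * K * t))"
  have "continuous_on {0..1} ?g" by (intro continuous_intros e)
  then obtain p where p: "p \<in> {0..1}" and max: "\<And>t. t \<in> {0..1} \<Longrightarrow> ?g t \<le> ?g p"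
    using continuous_attains_sup[of "{0..1::real}" ?g] by auto
  have le_exp: "e r \<le> ?g p * exp (2 * K * r)" if "r \<in> {0..1}" for r
    using max[OF that] by (simp add: exp_minus field_simps)
  have meas: "e \<in> borel_measurable unit_time" by (rule continuous_on_unit_time_measurable[OF e])
  have "(\<integral>r. indicator {0..p} r * e r \<partial>unit_time) \<le> (\<integral>r. indicator {0..p} r * (?g p * exp (2 * K * r)) \<partial>unit_time)"
  proof (rule integral_mono)
    show "integrable unit_time (\<lambda>r. indicator {0..p} r * e r)"
      by (rule Bochner_Integration.integrable_bound[OF continuous_on_unit_time_integrable[OF e]])
        (use meas in \<open>auto simp: indicator_def\<close>)
    have "continuous_on {0..1} (\<lambda>r. ?g p * exp (2 * K * r))" by (intro continuous_intros)
    then show "integrable unit_time (\<lambda>r. indicator {0..p} r * (?g p * exp (2 * K * r)))"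
      by (intro Bochner_Integration.integrable_bound[OF continuous_on_unit_time_integrable])
        (auto simp: indicator_def)
  qed (auto simp: indicator_def le_exp)
  also have "\<dots> = ?g p / (2 * K) * exp (2 * K * p) - ?g p / (2 * K) * exp (2 * K * 0)"
  proof (rule integral_unit_time_FTC)
    show "((\<lambda>r. ?g p / (2 * K) * exp (2 * K * r)) has_real_derivative ?g p * exp (2 * K * r)) (at r within {0..1})" for r
      using K by (auto intro!: derivative_eq_intros)
  qed (use p in \<open>auto intro!: continuous_intros\<close>)
  finally have "K * (\<integral>r. indicator {0..p} r * e r \<partial>unit_time) \<le> K * (?g p / (2 * K) * exp (2 * K * p) - ?g p / (2 * K))"
    using K by (intro mult_left_mono) auto
  also have "\<dots> \<le> e p / 2"
    using K nonneg[OF p] by (simp add: exp_minus field_simps)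
  finally have "e p \<le> 2 * c" using le[OF p] by simp
  then have "0 \<le> c" using nonneg[OF p] by simp
  have "?g p \<le> 2 * c"
  proof -
    have "?g p \<le> e p * 1" using p K nonneg[OF p] by (intro mult_left_mono) auto
    then show ?thesis using \<open>e p \<le> 2 * c\<close> by simp
  qed
  then have "e t \<le> 2 * c * exp (2 * K * t)"
    using le_exp[OF t] by (meson exp_ge_zero mult_right_mono order_trans)
  also have "\<dots> \<le> 2 * c * exp (2 * K)"
    using t K \<open>0 \<le> c\<close> by (intro mult_left_mono) auto
  finally show ?thesis .
qed

section \<open>Flows of densities driven by a control\<close>

lemma smooth_frechet_derivative_continuous:
  fixes f :: "'a::euclidean_space \<Rightarrow> real"
  assumes f: "smooth f" and g: "continuous_on S g" and h: "continuous_on S h"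
  shows "continuous_on S (\<lambda>z. frechet_derivative f (at (g z)) (h z))"
proof -
  have "frechet_derivative f (at x) v = (\<Sum>b\<in>Basis. (v \<bullet> b) * frechet_derivative f (at x) b)" for x v
  proof -
    interpret linear "frechet_derivative f (at x)"
      by (rule has_derivative_linear[OF smooth_has_derivative[OF f]])
    have "frechet_derivative f (at x) (\<Sum>b\<in>Basis. (v \<bullet> b) *\<^sub>R b) = (\<Sum>b\<in>Basis. (v \<bullet> b) * frechet_derivative f (at x) b)"
      by (simp add: sum scale)
    then show ?thesis by (simp add: euclidean_representation)
  qed
  then have "(\<lambda>z. frechet_derivative f (at (g z)) (h z)) =
      (\<lambda>z. \<Sum>b\<in>Basis. (h z \<bullet> b) * frechet_derivative f (at (g z)) b)" by blast
  moreover have "continuous_on S (\<lambda>z. frechet_derivative f (at (g z)) b)" for b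
    by (rule continuous_on_compose2[OF smooth_continuous[OF smooth_frechet_derivative[OF f], of UNIV] g]) simp
  ultimately show ?thesis by (simp only:) (intro continuous_intros h)
qed

abbreviation strip :: "(real \<times> (real^'n)) measure" where
  "strip \<equiv> unit_time \<Otimes>\<^sub>M lborel"

lemma space_strip: "space (strip :: (real \<times> (real^'n)) measure) = {0..1} \<times> UNIV"
  by (simp add: space_pair_measure)

lemma continuous_on_strip_measurable:
  fixes f :: "real \<times> (real^'n) \<Rightarrow> 'b::topological_space"
  assumes "continuous_on ({0..1} \<times> UNIV) f"
  shows "f \<in> borel_measurable strip"
proof -
  have fst: "fst \<in> borel_measurable (strip :: (real \<times> (real^'n)) measure)"
    using measurable_compose[OF measurable_fst unit_time_measurable_id] by simp
  have snd: "snd \<in> borel_measurable (strip :: (real \<times> (real^'n)) measure)"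
    using measurable_snd[of unit_time "lborel :: (real^'n) measure"] by simp
  have "(\<lambda>z. (fst z, snd z)) \<in> borel_measurable (strip :: (real \<times> (real^'n)) measure)"
    by (rule borel_measurable_Pair[OF fst snd])
  then have "(\<lambda>z. z) \<in> measurable strip (restrict_space borel ({0..1} \<times> (UNIV :: (real^'n) set)))"
    by (intro measurable_restrict_space2) (auto simp: space_strip)
  from measurable_compose[OF this borel_measurable_continuous_on_restrict[OF assms]]
  show ?thesis by simp
qed

lemma continuous_on_strip_fst:
  assumes "continuous_on {0..1} h"
  shows "continuous_on ({0..1} \<times> UNIV) (\<lambda>z. h (fst z))"
  by (rule continuous_on_compose2[OF assms]) (auto intro!: continuous_intros)

lemma strip_measurable_fst [measurable]: "fst \<in> borel_measurable (strip :: (real \<times> (real^'n)) measure)"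
  by (intro continuous_on_strip_measurable continuous_intros)

lemma strip_measurable_snd [measurable]: "snd \<in> borel_measurable (strip :: (real \<times> (real^'n)) measure)"
  by (intro continuous_on_strip_measurable continuous_intros)

locale controlled_flow =
  fixes A :: "real \<Rightarrow> real^'n^'n" and B :: "real \<Rightarrow> real^'m^'n"
    and \<rho> :: "real \<Rightarrow> real^'n \<Rightarrow> real" and u :: "real \<Rightarrow> real^'n \<Rightarrow> real^'m"
  assumes A_cont: "continuous_on {0..1} A" and B_cont: "continuous_on {0..1} B"
    and flow: "density_flow \<rho>"
    and u_cont: "continuous_on ({0..1} \<times> UNIV) (\<lambda>(t, x). u t x)"
    and cont_eq: "continuity_equation A B \<rho> u"
begin

definition velocity :: "real \<Rightarrow> real^'n \<Rightarrow> real^'n" where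
  "velocity t x = A t *v x + B t *v u t x"

text \<open>The space-time law of the flow, with uniformly distributed time: a probability measure for which
  the cost and the tested continuity equation are plain integrals.\<close>

definition \<nu> :: "(real \<times> (real^'n)) measure" where
  "\<nu> = density strip (\<lambda>z. ennreal (\<rho> (fst z) (snd z)))"

lemma space_\<nu>: "space \<nu> = {0..1} \<times> UNIV"
  by (simp add: \<nu>_def space_strip)

lemma sets_\<nu> [measurable_cong]: "sets \<nu> = sets (strip :: (real \<times> (real^'n)) measure)"
  by (simp add: \<nu>_def)

lemma \<rho>_measurable [measurable]: "(\<lambda>z. \<rho> (fst z) (snd z)) \<in> borel_measurable (strip :: (real \<times> (real^'n)) measure)"
proof -
  have "sets (strip :: (real \<times> (real^'n)) measure) = sets (restrict_space borel {0..1} \<Otimes>\<^sub>M borel)"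
    by (rule sets_pair_measure_cong) (auto simp: sets_unit_time)
  then show ?thesis
    using flow measurable_cong_sets unfolding density_flow_def jointly_measurable_on_strip_def case_prod_beta
    by blast
qed

lemma \<rho>_nonneg: "t \<in> {0..1} \<Longrightarrow> 0 \<le> \<rho> t x"
  using flow by (auto simp: density_flow_def)

lemma \<rho>_total: "t \<in> {0..1} \<Longrightarrow> (\<integral>\<^sup>+x. ennreal (\<rho> t x) \<partial>lborel) = 1"
  using flow by (auto simp: density_flow_def)

lemma \<rho>_slice_measurable: "t \<in> {0..1} \<Longrightarrow> \<rho> t \<in> borel_measurable borel"
  using measurable_compose[OF measurable_Pair1'[of t unit_time lborel] \<rho>_measurable] by simp

lemma \<rho>_integrable: "t \<in> {0..1} \<Longrightarrow> integrable lborel (\<rho> t)"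
  using \<rho>_slice_measurable \<rho>_total \<rho>_nonneg by (intro integrableI_nonneg) auto

lemma \<rho>_integral: "t \<in> {0..1} \<Longrightarrow> (\<integral>x. \<rho> t x \<partial>lborel) = 1"
  using \<rho>_slice_measurable \<rho>_total \<rho>_nonneg
  by (subst integral_eq_nn_integral) auto

lemma slice_integrable:
  assumes t: "t \<in> {0..1}" and [measurable]: "f \<in> borel_measurable borel" and c: "\<And>x. \<bar>f x\<bar> \<le> c"
  shows "integrable lborel (\<lambda>x. f x * \<rho> t x)"
proof (rule Bochner_Integration.integrable_bound)
  show "integrable lborel (\<lambda>x. c * \<rho> t x)" using \<rho>_integrable[OF t] by auto
  have [measurable]: "\<rho> t \<in> borel_measurable borel" by (rule \<rho>_slice_measurable[OF t])
  show "(\<lambda>x. f x * \<rho> t x) \<in> borel_measurable lborel" by measurable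
  have "0 \<le> c" using c by (meson abs_ge_zero order_trans)
  then show "AE x in lborel. norm (f x * \<rho> t x) \<le> norm (c * \<rho> t x)"
    using \<rho>_nonneg[OF t] by (auto simp: abs_mult intro!: mult_right_mono c)
qed

lemma nn_integral_\<nu>:
  assumes [measurable]: "g \<in> borel_measurable (strip :: (real \<times> (real^'n)) measure)"
  shows "(\<integral>\<^sup>+z. g z \<partial>\<nu>) = (\<integral>\<^sup>+t. \<integral>\<^sup>+x. ennreal (\<rho> t x) * g (t, x) \<partial>lborel \<partial>unit_time)"
proof -
  have "(\<integral>\<^sup>+z. g z \<partial>\<nu>) = (\<integral>\<^sup>+z. ennreal (\<rho> (fst z) (snd z)) * g z \<partial>strip)"
    unfolding \<nu>_def by (rule nn_integral_density) measurable
  also have "\<dots> = (\<integral>\<^sup>+t. \<integral>\<^sup>+x. ennreal (\<rho> t x) * g (t, x) \<partial>lborel \<partial>unit_time)"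
    by (subst lborel.nn_integral_fst[symmetric]) auto
  finally show ?thesis .
qed

lemma prob_space_\<nu>: "prob_space \<nu>"
proof
  have "emeasure \<nu> (space \<nu>) = (\<integral>\<^sup>+z. 1 \<partial>\<nu>)" by simp
  also have "\<dots> = (\<integral>\<^sup>+t. \<integral>\<^sup>+x. ennreal (\<rho> t x) * 1 \<partial>lborel \<partial>unit_time)" by (rule nn_integral_\<nu>) simp
  also have "\<dots> = (\<integral>\<^sup>+t. 1 \<partial>unit_time)" by (intro nn_integral_cong) (simp add: \<rho>_total)
  also have "\<dots> = 1" using unit_time.emeasure_space_1 by simp
  finally show "emeasure \<nu> (space \<nu>) = 1" .
qed

lemma \<nu>_integrable_bounded:
  fixes g :: "real \<times> (real^'n) \<Rightarrow> real"
  assumes "g \<in> borel_measurable strip" and "\<And>t x. t \<in> {0..1} \<Longrightarrow> \<bar>g (t, x)\<bar> \<le> c"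
  shows "integrable \<nu> g"
proof -
  interpret prob_space \<nu> by (rule prob_space_\<nu>)
  show ?thesis
    by (rule integrable_const_bound[of g c]) (use assms in \<open>auto simp: space_\<nu> sets_\<nu> cong: measurable_cong_sets\<close>)
qed

lemma \<nu>_disintegration:
  fixes g :: "real \<times> (real^'n) \<Rightarrow> real"
  assumes g: "integrable \<nu> g"
  shows "integrable unit_time (\<lambda>t. \<integral>x. g (t, x) * \<rho> t x \<partial>lborel)"
    and "(\<integral>z. g z \<partial>\<nu>) = (\<integral>t. \<integral>x. g (t, x) * \<rho> t x \<partial>lborel \<partial>unit_time)"
proof -
  interpret P: pair_sigma_finite unit_time "lborel :: (real^'n) measure" ..
  have [measurable]: "g \<in> borel_measurable (strip :: (real \<times> (real^'n)) measure)"
    using borel_measurable_integrable[OF g] by (simp add: sets_\<nu> cong: measurable_cong_sets)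
  have nn: "AE z in (strip :: (real \<times> (real^'n)) measure). 0 \<le> \<rho> (fst z) (snd z)"
    using \<rho>_nonneg by (auto simp: space_strip)
  have int: "integrable (strip :: (real \<times> (real^'n)) measure) (\<lambda>z. g z * \<rho> (fst z) (snd z))"
    using g nn unfolding \<nu>_def by (subst (asm) integrable_density) (auto simp: mult.commute)
  show "integrable unit_time (\<lambda>t. \<integral>x. g (t, x) * \<rho> t x \<partial>lborel)"
    using P.integrable_fst'[OF int] by simp
  have "(\<integral>z. g z \<partial>\<nu>) = (\<integral>z. g z * \<rho> (fst z) (snd z) \<partial>strip)"
    using nn unfolding \<nu>_def by (subst integral_density) (auto simp: mult.commute)
  also have "\<dots> = (\<integral>t. \<integral>x. g (t, x) * \<rho> t x \<partial>lborel \<partial>unit_time)"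
    using P.integral_fst'[OF int] by simp
  finally show "(\<integral>z. g z \<partial>\<nu>) = (\<integral>t. \<integral>x. g (t, x) * \<rho> t x \<partial>lborel \<partial>unit_time)" .
qed

lemma cost_eq_nn_integral_\<nu>: "cost \<rho> u = (\<integral>\<^sup>+z. ennreal (1/2 * (norm (u (fst z) (snd z)))\<^sup>2) \<partial>\<nu>)"
proof -
  interpret P: pair_sigma_finite unit_time "lborel :: (real^'n) measure" ..
  have [measurable]: "(\<lambda>z. u (fst z) (snd z)) \<in> borel_measurable (strip :: (real \<times> (real^'n)) measure)"
    using continuous_on_strip_measurable[OF u_cont] by (simp add: case_prod_beta)
  let ?f = "\<lambda>t x. ennreal (1/2 * (norm (u t x))\<^sup>2 * \<rho> t x)"
  have "cost \<rho> u = (\<integral>\<^sup>+x. \<integral>\<^sup>+t. ?f t x \<partial>unit_time \<partial>lborel)"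
    by (simp add: cost_def unit_time_def nn_integral_restrict_space)
  also have "\<dots> = (\<integral>\<^sup>+t. \<integral>\<^sup>+x. ?f t x \<partial>lborel \<partial>unit_time)"
    by (rule P.Fubini') (simp add: case_prod_beta)
  also have "\<dots> = (\<integral>\<^sup>+t. \<integral>\<^sup>+x. ennreal (\<rho> t x) * ennreal (1/2 * (norm (u t x))\<^sup>2) \<partial>lborel \<partial>unit_time)"
    using \<rho>_nonneg by (intro nn_integral_cong) (simp add: mult.commute flip: ennreal_mult')
  also have "\<dots> = (\<integral>\<^sup>+z. ennreal (1/2 * (norm (u (fst z) (snd z)))\<^sup>2) \<partial>\<nu>)"
    by (subst nn_integral_\<nu>) auto
  finally show ?thesis .
qed

lemma velocity_continuous: "continuous_on ({0..1} \<times> UNIV) (\<lambda>z. velocity (fst z) (snd z))"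
proof -
  have "continuous_on ({0..1} \<times> (UNIV :: (real^'n) set)) (\<lambda>z. u (fst z) (snd z))"
    using u_cont by (simp add: case_prod_beta)
  then show ?thesis
    unfolding velocity_def
    by (intro continuous_intros matrix_continuous_intros continuous_on_strip_fst A_cont B_cont)
qed

lemma transport_continuous:
  "smooth f \<Longrightarrow> continuous_on ({0..1} \<times> UNIV) (\<lambda>z. frechet_derivative f (at (snd z)) (velocity (fst z) (snd z)))"
  by (intro smooth_frechet_derivative_continuous velocity_continuous continuous_intros)

lemma frechet_derivative_eq_0_at_infinity:
  assumes f: "smooth f" and const: "\<And>x. r \<le> norm x \<Longrightarrow> f x = c" and x: "r < norm x"
  shows "frechet_derivative f (at x) = (\<lambda>v. 0)"
proof -
  have "((\<lambda>x. c) has_derivative (\<lambda>v. 0)) (at x)" by simp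
  then have "(f has_derivative (\<lambda>v. 0)) (at x)"
    by (rule has_derivative_transform_within_open[where s = "{x. r < norm x}"])
      (use x const in \<open>auto intro!: open_Collect_less continuous_intros\<close>)
  then show ?thesis by (simp add: frechet_derivative_at[symmetric])
qed

lemma transport_bounded:
  assumes f: "smooth f" and const: "\<And>x. r \<le> norm x \<Longrightarrow> f x = c"
  shows "\<exists>k. \<forall>t\<in>{0..1}. \<forall>x. \<bar>frechet_derivative f (at x) (velocity t x)\<bar> \<le> k"
proof -
  have "bounded ((\<lambda>z. frechet_derivative f (at (snd z)) (velocity (fst z) (snd z))) ` ({0..1} \<times> cball 0 r))"
    by (intro compact_imp_bounded compact_continuous_image continuous_on_subset[OF transport_continuous[OF f]]
        compact_Times) auto
  then obtain k where k: "\<And>t x. t \<in> {0..1} \<Longrightarrow> x \<in> cball 0 r \<Longrightarrow> \<bar>frechet_derivative f (at x) (velocity t x)\<bar> \<le> k"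
    unfolding bounded_iff by fastforce
  have "\<bar>frechet_derivative f (at x) (velocity t x)\<bar> \<le> max k 0" if "t \<in> {0..1}" for t x
  proof (cases "norm x \<le> r")
    case True
    then show ?thesis using k[OF that, of x] by simp
  next
    case False
    then show ?thesis using frechet_derivative_eq_0_at_infinity[OF f const] by simp
  qed
  then show ?thesis by blast
qed

lemma bounded_of_constant_at_infinity:
  fixes f :: "real^'n \<Rightarrow> real"
  assumes f: "smooth f" and const: "\<And>x. r \<le> norm x \<Longrightarrow> f x = c"
  shows "\<exists>k. \<forall>x. \<bar>f x\<bar> \<le> k"
proof -
  have "bounded (f ` cball 0 r)"
    by (intro compact_imp_bounded compact_continuous_image smooth_continuous[OF f]) auto
  then obtain k where k: "\<And>x. norm x \<le> r \<Longrightarrow> \<bar>f x\<bar> \<le> k"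
    unfolding bounded_iff by fastforce
  have "\<bar>f x\<bar> \<le> max k \<bar>c\<bar>" for x
    using k[of x] const[of x] by (cases "norm x \<le> r") auto
  then show ?thesis by blast
qed

text \<open>Test functions of product form separate time from space: the continuity equation then says that
  the mean of the transport of f is the weak time derivative of the mean of f.\<close>

lemma weak_equation_product:
  assumes \<theta>: "smooth \<theta>" "\<And>t. (\<theta> has_real_derivative \<theta>' t) (at t)" "0 < a" "b < 1" "\<And>t. t \<notin> {a..b} \<Longrightarrow> \<theta> t = 0"
    and f: "smooth f" "\<And>x. r \<le> norm x \<Longrightarrow> f x = 0"
  shows "(\<integral>t. \<theta>' t * (\<integral>x. f x * \<rho> t x \<partial>lborel)
    + \<theta> t * (\<integral>x. frechet_derivative f (at x) (velocity t x) * \<rho> t x \<partial>lborel) \<partial>unit_time) = 0"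
proof -
  define \<phi> where "\<phi> z = \<theta> (fst z) * f (snd z)" for z :: "real \<times> (real^'n)"
  have supp: "{z. \<phi> z \<noteq> 0} \<subseteq> {a..b} \<times> cball 0 r"
  proof safe
    fix t x assume nz: "\<phi> (t, x) \<noteq> 0"
    show "t \<in> {a..b}" using nz \<theta>(5)[of t] by (auto simp: \<phi>_def)
    show "x \<in> cball 0 r" using nz f(2)[of x] by (force simp: \<phi>_def)
  qed
  have "test_function \<phi>"
    unfolding test_function_def
  proof (intro conjI)
    show "smooth \<phi>"
      unfolding \<phi>_def by (intro smooth_mult smooth_compose_linear[OF bounded_linear_fst \<theta>(1)]
          smooth_compose_linear[OF bounded_linear_snd f(1)])
    have "bounded ({a..b} \<times> cball (0::real^'n) r)" by (intro bounded_Times) auto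
    then show "compact (closure {z. \<phi> z \<noteq> 0})"
      unfolding compact_closure using supp by (rule bounded_subset)
    have "closure {z. \<phi> z \<noteq> 0} \<subseteq> {a..b} \<times> cball 0 r"
      using supp by (rule closure_minimal) (intro closed_Times closed_cball closed_atLeastAtMost)
    then show "closure {z. \<phi> z \<noteq> 0} \<subseteq> {0<..<1} \<times> UNIV" using \<theta>(3,4) by fastforce
  qed
  then have "(\<integral>t. \<integral>x. frechet_derivative \<phi> (at (t, x)) (1, velocity t x) * \<rho> t x \<partial>lborel \<partial>unit_time) = 0"
    using cont_eq unfolding continuity_equation_def integral_unit_time velocity_def by blast
  also have "(\<integral>t. \<integral>x. frechet_derivative \<phi> (at (t, x)) (1, velocity t x) * \<rho> t x \<partial>lborel \<partial>unit_time) =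
      (\<integral>t. \<theta>' t * (\<integral>x. f x * \<rho> t x \<partial>lborel)
    + \<theta> t * (\<integral>x. frechet_derivative f (at x) (velocity t x) * \<rho> t x \<partial>lborel) \<partial>unit_time)"
  proof (intro Bochner_Integration.integral_cong refl)
    fix t assume "t \<in> space unit_time"
    then have t: "t \<in> {0..1}" by simp
    have D: "frechet_derivative \<phi> (at (t, x)) (1, v) = \<theta>' t * f x + \<theta> t * frechet_derivative f (at x) v" for x v
    proof -
      have 1: "((\<lambda>z :: real \<times> (real^'n). \<theta> (fst z)) has_derivative (\<lambda>h. \<theta>' t * fst h)) (at (t, x))"
        by (rule has_derivative_compose[of fst fst "(t, x)" UNIV \<theta> "\<lambda>h. \<theta>' t * h"])
          (use \<theta>(2)[of t] in \<open>auto simp: has_field_derivative_def intro!: derivative_eq_intros\<close>)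
      have 2: "((\<lambda>z :: real \<times> (real^'n). f (snd z)) has_derivative (\<lambda>h. frechet_derivative f (at x) (snd h))) (at (t, x))"
        by (rule has_derivative_compose[of snd snd "(t, x)" UNIV f "frechet_derivative f (at x)"])
          (use smooth_has_derivative[OF f(1), of x] in \<open>auto intro!: derivative_eq_intros\<close>)
      have "(\<phi> has_derivative (\<lambda>h. \<theta> t * frechet_derivative f (at x) (snd h) + \<theta>' t * fst h * f x)) (at (t, x))"
        unfolding \<phi>_def using has_derivative_mult[OF 1 2] by simp
      from frechet_derivative_at[OF this, symmetric] show ?thesis by simp
    qed
    obtain k1 where k1: "\<And>x. \<bar>f x\<bar> \<le> k1"
      using bounded_of_constant_at_infinity[OF f] by blast
    obtain k2 where k2: "\<And>x. \<bar>frechet_derivative f (at x) (velocity t x)\<bar> \<le> k2"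
      using transport_bounded[OF f] t by blast
    have "continuous_on UNIV (\<lambda>x. frechet_derivative f (at x) (velocity t x))"
      by (rule continuous_on_compose2[OF transport_continuous[OF f(1)], where f = "\<lambda>x. (t, x)", simplified])
        (use t in \<open>auto intro!: continuous_intros\<close>)
    then have int2: "integrable lborel (\<lambda>x. frechet_derivative f (at x) (velocity t x) * \<rho> t x)"
      by (intro slice_integrable[OF t _ k2] borel_measurable_continuous_onI)
    have int1: "integrable lborel (\<lambda>x. f x * \<rho> t x)"
      by (intro slice_integrable[OF t _ k1] borel_measurable_continuous_onI smooth_continuous[OF f(1)])
    show "(\<integral>x. frechet_derivative \<phi> (at (t, x)) (1, velocity t x) * \<rho> t x \<partial>lborel) =
      \<theta>' t * (\<integral>x. f x * \<rho> t x \<partial>lborel)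
      + \<theta> t * (\<integral>x. frechet_derivative f (at x) (velocity t x) * \<rho> t x \<partial>lborel)"
      unfolding D using int1 int2 by (simp add: distrib_right mult.assoc)
  qed
  finally show ?thesis .
qed

lemma transport_integrable:
  assumes f: "smooth f" "\<And>x. r \<le> norm x \<Longrightarrow> f x = c"
  shows "integrable \<nu> (\<lambda>z. frechet_derivative f (at (snd z)) (velocity (fst z) (snd z)))"
proof -
  obtain k where k: "\<And>t x. t \<in> {0..1} \<Longrightarrow> \<bar>frechet_derivative f (at x) (velocity t x)\<bar> \<le> k"
    using transport_bounded[OF f] by blast
  show ?thesis
    using k by (intro \<nu>_integrable_bounded continuous_on_strip_measurable transport_continuous f) auto
qed

text \<open>Functions that are constant near infinity are admitted because the total mass is constant; this
  covers bounded truncations of \<open>|x|\<^sup>2\<close>.\<close>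

lemma flow_increment:
  assumes f: "smooth f" "\<And>x. r \<le> norm x \<Longrightarrow> f x = c" and t: "t \<in> {0..1}"
  shows "(\<integral>x. f x * \<rho> t x \<partial>lborel) = (\<integral>x. f x * \<rho> 0 x \<partial>lborel) +
    (\<integral>s. indicator {0..t} s * (\<integral>x. frechet_derivative f (at x) (velocity s x) * \<rho> s x \<partial>lborel) \<partial>unit_time)"
proof -
  let ?g = "\<lambda>x. f x - c"
  have g: "smooth ?g" by (intro smooth_diff f smooth_const)
  have g0: "?g x = 0" if "r \<le> norm x" for x using f(2)[OF that] by simp
  have Dg: "frechet_derivative ?g (at x) = frechet_derivative f (at x)" for x
  proof -
    have "(?g has_derivative frechet_derivative f (at x)) (at x)"
      using has_derivative_diff[OF smooth_has_derivative[OF f(1)] has_derivative_const[of c]] by simp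
    from frechet_derivative_at[OF this] show ?thesis by simp
  qed
  have g_int: "(\<integral>x. ?g x * \<rho> t x \<partial>lborel) = (\<integral>x. f x * \<rho> t x \<partial>lborel) - c" if t: "t \<in> {0..1}" for t
  proof -
    obtain k where k: "\<And>x. \<bar>f x\<bar> \<le> k"
      using bounded_of_constant_at_infinity[OF f] by blast
    have "integrable lborel (\<lambda>x. f x * \<rho> t x)"
      by (intro slice_integrable[OF t _ k] borel_measurable_continuous_onI smooth_continuous[OF f(1)])
    then show ?thesis using \<rho>_integrable[OF t] by (simp add: left_diff_distrib \<rho>_integral[OF t])
  qed
  obtain k where k: "\<And>x. \<bar>?g x\<bar> \<le> k"
    using bounded_of_constant_at_infinity[OF g g0] by blast
  then have "bounded (range ?g)" by (auto simp: bounded_iff)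
  then have "continuous_on {0..1} (\<lambda>t. \<integral>x. ?g x * \<rho> t x \<partial>lborel)"
    using flow smooth_continuous[OF g, of UNIV] unfolding density_flow_def by blast
  from weak_derivative_increment[OF this \<nu>_disintegration(1)[OF transport_integrable[OF g g0]] _ t]
  have "(\<integral>x. ?g x * \<rho> t x \<partial>lborel) = (\<integral>x. ?g x * \<rho> 0 x \<partial>lborel) +
    (\<integral>s. indicator {0..t} s * (\<integral>x. frechet_derivative ?g (at x) (velocity s x) * \<rho> s x \<partial>lborel) \<partial>unit_time)"
    using weak_equation_product[OF _ _ _ _ _ g g0] by simp
  then show ?thesis using g_int[OF t] g_int[of 0] by (simp add: Dg)
qed

text \<open>The fundamental theorem of calculus for the mean of \<open>a t * f x\<close>, by the product rule; a need
  not be smooth.\<close>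

lemma flow_identity_constant_at_infinity:
  assumes f: "smooth f" "\<And>x. r \<le> norm x \<Longrightarrow> f x = c"
    and a: "\<And>t. t \<in> {0..1} \<Longrightarrow> (a has_real_derivative a' t) (at t within {0..1})" "continuous_on {0..1} a'"
  shows "a 1 * (\<integral>x. f x * \<rho> 1 x \<partial>lborel) - a 0 * (\<integral>x. f x * \<rho> 0 x \<partial>lborel)
    = (\<integral>z. a' (fst z) * f (snd z) + a (fst z) * frechet_derivative f (at (snd z)) (velocity (fst z) (snd z)) \<partial>\<nu>)"
proof -
  have a_cont: "continuous_on {0..1} a" using a(1) by (intro DERIV_continuous_on) auto
  obtain ka where ka: "\<And>t. t \<in> {0..1} \<Longrightarrow> \<bar>a t\<bar> \<le> ka"
    using continuous_path_bounded[OF a_cont] unfolding real_norm_def by blast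
  obtain kb where kb: "\<And>t. t \<in> {0..1} \<Longrightarrow> \<bar>a' t\<bar> \<le> kb"
    using continuous_path_bounded[OF a(2)] unfolding real_norm_def by blast
  obtain k1 where k1: "\<And>x. \<bar>f x\<bar> \<le> k1" using bounded_of_constant_at_infinity[OF f] by blast
  obtain k2 where k2: "\<And>t x. t \<in> {0..1} \<Longrightarrow> \<bar>frechet_derivative f (at x) (velocity t x)\<bar> \<le> k2"
    using transport_bounded[OF f] by blast
  have int1: "integrable \<nu> (\<lambda>z. a' (fst z) * f (snd z))"
  proof (rule \<nu>_integrable_bounded)
    show "\<bar>a' (fst (t, x)) * f (snd (t, x))\<bar> \<le> kb * k1" if "t \<in> {0..1}" for t x
      unfolding abs_mult using kb[OF that] k1[of x] by (auto intro!: mult_mono order_trans[OF abs_ge_zero kb[OF that]])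
  qed (intro continuous_on_strip_measurable continuous_on_mult continuous_on_strip_fst a(2)
      continuous_on_compose2[OF smooth_continuous[OF f(1), of UNIV] continuous_on_snd[OF continuous_on_id]] subset_UNIV)
  have int2: "integrable \<nu> (\<lambda>z. a (fst z) * frechet_derivative f (at (snd z)) (velocity (fst z) (snd z)))"
  proof (rule \<nu>_integrable_bounded)
    show "\<bar>a (fst (t, x)) * frechet_derivative f (at (snd (t, x))) (velocity (fst (t, x)) (snd (t, x)))\<bar> \<le> ka * k2"
      if "t \<in> {0..1}" for t x
      unfolding abs_mult using ka[OF that] k2[OF that, of x]
      by (auto intro!: mult_mono order_trans[OF abs_ge_zero ka[OF that]])
  qed (intro continuous_on_strip_measurable continuous_on_mult continuous_on_strip_fst a_cont transport_continuous f)
  have "a 1 * (\<integral>x. f x * \<rho> 1 x \<partial>lborel) - a 0 * (\<integral>x. f x * \<rho> 0 x \<partial>lborel)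
    = (\<integral>t. a' t * (\<integral>x. f x * \<rho> t x \<partial>lborel) \<partial>unit_time)
      + (\<integral>t. a t * (\<integral>x. frechet_derivative f (at x) (velocity t x) * \<rho> t x \<partial>lborel) \<partial>unit_time)"
    using \<nu>_disintegration(1)[OF transport_integrable[OF f]]
    by (intro product_rule_unit_time(3)[OF flow_increment[OF f] _ a]) auto
  also have "\<dots> = (\<integral>z. a' (fst z) * f (snd z) \<partial>\<nu>)
      + (\<integral>z. a (fst z) * frechet_derivative f (at (snd z)) (velocity (fst z) (snd z)) \<partial>\<nu>)"
    unfolding \<nu>_disintegration(2)[OF int1] \<nu>_disintegration(2)[OF int2] by (simp add: mult.assoc)
  finally show ?thesis using int1 int2 by simp
qed

end

context controlled_flow
begin

lemma velocity_bound: "\<exists>K\<ge>0. \<forall>t\<in>{0..1}. \<forall>x. norm (velocity t x) \<le> K * (norm x + norm (u t x))"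
proof -
  obtain KA where KA: "0 \<le> KA" "\<And>t x. t \<in> {0..1} \<Longrightarrow> norm (A t *v x) \<le> KA * norm x"
    using matrix_path_bounded[OF A_cont] by metis
  obtain KB where KB: "0 \<le> KB" "\<And>t v. t \<in> {0..1} \<Longrightarrow> norm (B t *v v) \<le> KB * norm v"
    using matrix_path_bounded[OF B_cont] by metis
  have "norm (velocity t x) \<le> (KA + KB) * (norm x + norm (u t x))" if t: "t \<in> {0..1}" for t x
  proof -
    have "norm (velocity t x) \<le> KA * norm x + KB * norm (u t x)"
      unfolding velocity_def using norm_triangle_ineq KA(2)[OF t] KB(2)[OF t] by (meson add_mono order_trans)
    also have "\<dots> \<le> (KA + KB) * norm x + (KA + KB) * norm (u t x)"
      using KA KB by (intro add_mono mult_right_mono) auto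
    finally show ?thesis by (simp add: distrib_left)
  qed
  then show ?thesis using KA KB by (intro exI[of _ "KA + KB"]) auto
qed

lemma u_measurable [measurable]: "(\<lambda>z. u (fst z) (snd z)) \<in> borel_measurable (strip :: (real \<times> (real^'n)) measure)"
  using continuous_on_strip_measurable[OF u_cont] by (simp add: case_prod_beta)

text \<open>A control of finite energy preserves finite second moments: for the truncations \<open>f\<close> of
  \<open>|x|\<^sup>2\<close> the gradient obeys \<open>|\<nabla>f|\<^sup>2 \<le> 4 f\<close> and \<open>|x| |\<nabla>f| \<le> 2 f\<close>, so Gronwall's inequality
  bounds the mean of \<open>f\<close> independently of the truncation.\<close>

lemma second_moment_integrable:
  assumes energy: "integrable \<nu> (\<lambda>z. (norm (u (fst z) (snd z)))\<^sup>2)"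
    and init: "integrable lborel (\<lambda>x. (norm x)\<^sup>2 * \<rho> 0 x)"
  shows "integrable \<nu> (\<lambda>z. (norm (snd z))\<^sup>2)"
proof -
  define N where "N n = real (Suc n)" for n
  have "\<forall>n. \<exists>(f :: real^'n \<Rightarrow> real) s c. quadratic_truncation (N n) f s c"
    by (intro allI quadratic_truncation_exists) (simp add: N_def)
  then obtain f :: "nat \<Rightarrow> real^'n \<Rightarrow> real" and s c where "\<And>n. quadratic_truncation (N n) (f n) (s n) (c n)"
    by metis
  note f_smooth = quadratic_truncationD(1)[OF this] and f_const = quadratic_truncationD(2)[OF this]
    and f_eq = quadratic_truncationD(3)[OF this] and f_le = quadratic_truncationD(4)[OF this]
    and Df = quadratic_truncationD(5)[OF this] and s_bounds = quadratic_truncationD(6,7)[OF this]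
    and f_ge = quadratic_truncationD(8)[OF this]
  have f_nonneg: "0 \<le> f n x" for n x
    using f_ge[of n x] s_bounds(1)[of n x] by (meson mult_nonneg_nonneg order_trans zero_le_power2)
  have f_bounded: "\<exists>k. \<forall>x. \<bar>f n x\<bar> \<le> k" for n
    by (rule bounded_of_constant_at_infinity[OF f_smooth f_const])
  have f_meas [measurable]: "f n \<in> borel_measurable borel" for n
    by (rule borel_measurable_continuous_onI[OF smooth_continuous[OF f_smooth]])
  have f_int: "integrable lborel (\<lambda>x. f n x * \<rho> t x)" if "t \<in> {0..1}" for n t
    using f_bounded[of n] that by (auto intro: slice_integrable)
  have f_\<nu>: "integrable \<nu> (\<lambda>z. f n (snd z))" for n
    using f_bounded[of n] by (auto intro!: \<nu>_integrable_bounded measurable_compose[OF strip_measurable_snd f_meas])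
  define e where "e n t = (\<integral>x. f n x * \<rho> t x \<partial>lborel)" for n t
  have e_nonneg: "0 \<le> e n t" if "t \<in> {0..1}" for n t
    unfolding e_def using f_nonneg \<rho>_nonneg[OF that] by (intro integral_nonneg_AE) auto
  have e_cont: "continuous_on {0..1} (e n)" for n
  proof -
    have "bounded (range (f n))" using f_bounded[of n] by (auto simp: bounded_iff)
    then show ?thesis
      unfolding e_def using flow smooth_continuous[OF f_smooth, of UNIV] unfolding density_flow_def by blast
  qed
  obtain K where K: "0 \<le> K" "\<And>t x. t \<in> {0..1} \<Longrightarrow> norm (velocity t x) \<le> K * (norm x + norm (u t x))"
    using velocity_bound by metis
  define K' where "K' = 2 * K + K\<^sup>2 + 1"
  have K': "0 < K'" using K(1) by (simp add: K'_def add_nonneg_pos)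
  have transport_le: "frechet_derivative (f n) (at x) (velocity t x) \<le> K' * f n x + (norm (u t x))\<^sup>2"
    if t: "t \<in> {0..1}" for n t x
  proof -
    have "x \<bullet> velocity t x \<le> norm x * (K * (norm x + norm (u t x)))"
      using norm_cauchy_schwarz[of x "velocity t x"] K(2)[OF t, of x] by (meson mult_left_mono norm_ge_zero order_trans)
    then have "s n x * (2 * (x \<bullet> velocity t x)) \<le> s n x * (2 * (norm x * (K * (norm x + norm (u t x)))))"
      using s_bounds[of n x] by (intro mult_left_mono) auto
    also have "2 * (norm x * (K * (norm x + norm (u t x)))) = 2 * K * (norm x)\<^sup>2 + 2 * (K * norm x) * norm (u t x)"
      by (simp add: power2_eq_square algebra_simps)
    also have "s n x * \<dots> \<le> s n x * (2 * K * (norm x)\<^sup>2 + ((K * norm x)\<^sup>2 + (norm (u t x))\<^sup>2))"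
      using s_bounds[of n x] sum_squares_bound[of "K * norm x" "norm (u t x)"] by (intro mult_left_mono add_left_mono) auto
    also have "\<dots> = (2 * K + K\<^sup>2) * (s n x * (norm x)\<^sup>2) + s n x * (norm (u t x))\<^sup>2"
      by (simp add: power_mult_distrib algebra_simps)
    also have "\<dots> \<le> (2 * K + K\<^sup>2) * f n x + 1 * (norm (u t x))\<^sup>2"
      using f_ge[of n x] s_bounds[of n x] K(1) by (intro add_mono mult_left_mono mult_right_mono) auto
    also have "\<dots> \<le> K' * f n x + (norm (u t x))\<^sup>2"
      using f_nonneg[of n x] by (simp add: K'_def distrib_right)
    finally show ?thesis unfolding Df .
  qed
  define M U where "M = (\<integral>x. (norm x)\<^sup>2 * \<rho> 0 x \<partial>lborel)" and "U = (\<integral>z. (norm (u (fst z) (snd z)))\<^sup>2 \<partial>\<nu>)"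
  have e_le: "e n t \<le> 2 * (M + U) * exp (2 * K')" if t: "t \<in> {0..1}" for n t
  proof (rule gronwall_unit_time[OF e_cont e_nonneg K' _ t])
    fix t :: real assume t: "t \<in> {0..1}"
    have ind [measurable]: "(\<lambda>z. indicator {0..t} (fst z) :: real) \<in> borel_measurable (strip :: (real \<times> (real^'n)) measure)"
      by measurable
    let ?I = "\<lambda>z :: real \<times> (real^'n). indicator {0..t} (fst z) :: real"
    have tr_int: "integrable \<nu> (\<lambda>z. frechet_derivative (f n) (at (snd z)) (velocity (fst z) (snd z)))"
      by (rule transport_integrable[OF f_smooth f_const])
    have cut: "integrable \<nu> (\<lambda>z. ?I z * g z)" if "integrable \<nu> g" for g :: "real \<times> (real^'n) \<Rightarrow> real"
      by (rule Bochner_Integration.integrable_bound[OF that])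
        (use borel_measurable_integrable[OF that] ind in \<open>auto simp: indicator_def \<nu>_def\<close>)
    have e0: "e n 0 \<le> M"
      unfolding e_def M_def using f_int[of 0 n] init f_le \<rho>_nonneg[of 0]
      by (intro integral_mono) (auto intro!: mult_right_mono)
    have "e n t = e n 0 + (\<integral>s. indicator {0..t} s * (\<integral>x. frechet_derivative (f n) (at x) (velocity s x) * \<rho> s x \<partial>lborel) \<partial>unit_time)"
      unfolding e_def by (rule flow_increment[OF f_smooth f_const t])
    also have "(\<integral>s. indicator {0..t} s * (\<integral>x. frechet_derivative (f n) (at x) (velocity s x) * \<rho> s x \<partial>lborel) \<partial>unit_time)
        = (\<integral>z. ?I z * frechet_derivative (f n) (at (snd z)) (velocity (fst z) (snd z)) \<partial>\<nu>)"
      unfolding \<nu>_disintegration(2)[OF cut[OF tr_int]] by (simp add: mult.assoc)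
    also have "\<dots> \<le> (\<integral>z. K' * (?I z * f n (snd z)) + (norm (u (fst z) (snd z)))\<^sup>2 \<partial>\<nu>)"
    proof (rule integral_mono)
      show "integrable \<nu> (\<lambda>z. K' * (?I z * f n (snd z)) + (norm (u (fst z) (snd z)))\<^sup>2)"
        using cut[OF f_\<nu>] energy by auto
      fix z assume "z \<in> space \<nu>"
      then have "fst z \<in> {0..1}" by (auto simp: space_\<nu>)
      from transport_le[OF this, of n "snd z"]
      show "?I z * frechet_derivative (f n) (at (snd z)) (velocity (fst z) (snd z))
          \<le> K' * (?I z * f n (snd z)) + (norm (u (fst z) (snd z)))\<^sup>2"
        by (auto simp: indicator_def)
    qed (rule cut[OF tr_int])
    also have "\<dots> = K' * (\<integral>z. ?I z * f n (snd z) \<partial>\<nu>) + U"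
      using cut[OF f_\<nu>] energy by (simp add: U_def)
    also have "(\<integral>z. ?I z * f n (snd z) \<partial>\<nu>) = (\<integral>s. indicator {0..t} s * e n s \<partial>unit_time)"
      unfolding \<nu>_disintegration(2)[OF cut[OF f_\<nu>]] e_def by (simp add: mult.assoc)
    finally show "e n t \<le> (M + U) + K' * (\<integral>s. indicator {0..t} s * e n s \<partial>unit_time)"
      using e0 by simp
  qed
  \<comment> \<open>Remove the truncation by Fatou's lemma.\<close>
  have "(\<integral>\<^sup>+z. ennreal ((norm (snd z))\<^sup>2) \<partial>\<nu>) = (\<integral>\<^sup>+z. liminf (\<lambda>n. ennreal (f n (snd z))) \<partial>\<nu>)"
  proof (rule nn_integral_cong)
    fix z :: "real \<times> (real^'n)"
    obtain n0 where n0: "(norm (snd z))\<^sup>2 \<le> real n0" using real_arch_simple by blast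
    have "\<forall>\<^sub>F n in sequentially. f n (snd z) = (norm (snd z))\<^sup>2"
      unfolding eventually_sequentially using n0 by (intro exI[of _ n0] allI impI f_eq) (simp add: N_def)
    then have "(\<lambda>n. ennreal (f n (snd z))) \<longlonglongrightarrow> ennreal ((norm (snd z))\<^sup>2)"
      by (intro tendsto_eventually) (auto elim: eventually_mono)
    then show "ennreal ((norm (snd z))\<^sup>2) = liminf (\<lambda>n. ennreal (f n (snd z)))"
      by (intro lim_imp_Liminf[symmetric]) auto
  qed
  also have "\<dots> \<le> liminf (\<lambda>n. \<integral>\<^sup>+z. ennreal (f n (snd z)) \<partial>\<nu>)"
    using f_\<nu> by (intro nn_integral_liminf) (auto intro!: measurable_compose[OF borel_measurable_integrable measurable_ennreal])
  also have "\<dots> \<le> liminf (\<lambda>n. ennreal (2 * (M + U) * exp (2 * K')))"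
  proof (intro Liminf_mono always_eventually allI)
    fix n
    have "(\<integral>\<^sup>+z. ennreal (f n (snd z)) \<partial>\<nu>) = ennreal (\<integral>z. f n (snd z) \<partial>\<nu>)"
      using f_nonneg by (intro nn_integral_eq_integral f_\<nu>) auto
    also have "(\<integral>z. f n (snd z) \<partial>\<nu>) = (\<integral>t. e n t \<partial>unit_time)"
      unfolding \<nu>_disintegration(2)[OF f_\<nu>] by (simp add: e_def)
    also have "\<dots> \<le> (\<integral>t. 2 * (M + U) * exp (2 * K') \<partial>unit_time)"
      using e_le by (intro integral_mono continuous_on_unit_time_integrable e_cont) auto
    finally show "(\<integral>\<^sup>+z. ennreal (f n (snd z)) \<partial>\<nu>) \<le> ennreal (2 * (M + U) * exp (2 * K'))"
      using unit_time.prob_space by (simp add: ennreal_leI)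
  qed
  also have "\<dots> < \<infinity>" by (simp add: Liminf_const)
  finally show ?thesis
    by (intro integrableI_nonneg) (auto simp: \<nu>_def)
qed

text \<open>Cutting off at a radius of order \<open>sqrt n\<close> extends the identity to functions of quadratic growth.
  The integrands are dominated by a multiple of \<open>1 + |x|\<^sup>2 + |u|\<^sup>2\<close>, which is integrable thanks to the
  second moments.\<close>

lemma flow_identity_quadratic_growth:
  assumes energy: "integrable \<nu> (\<lambda>z. (norm (u (fst z) (snd z)))\<^sup>2)"
    and init: "integrable lborel (\<lambda>x. (norm x)\<^sup>2 * \<rho> 0 x)" and final: "integrable lborel (\<lambda>x. (norm x)\<^sup>2 * \<rho> 1 x)"
    and p: "smooth p" and C: "0 \<le> C" "\<And>x. \<bar>p x\<bar> \<le> C * (1 + (norm x)\<^sup>2)"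
      "\<And>x v. \<bar>frechet_derivative p (at x) v\<bar> \<le> C * (1 + norm x) * norm v"
    and a: "\<And>t. t \<in> {0..1} \<Longrightarrow> (a has_real_derivative a' t) (at t within {0..1})" "continuous_on {0..1} a'"
  shows "integrable \<nu> (\<lambda>z. a' (fst z) * p (snd z) + a (fst z) * frechet_derivative p (at (snd z)) (velocity (fst z) (snd z)))"
    and "a 1 * (\<integral>x. p x * \<rho> 1 x \<partial>lborel) - a 0 * (\<integral>x. p x * \<rho> 0 x \<partial>lborel)
    = (\<integral>z. a' (fst z) * p (snd z) + a (fst z) * frechet_derivative p (at (snd z)) (velocity (fst z) (snd z)) \<partial>\<nu>)"
proof -
  interpret prob_space \<nu> by (rule prob_space_\<nu>)
  define N where "N n = real (Suc n)" for n
  obtain kc where kc: "0 \<le> kc" "\<forall>N\<ge>1. \<exists>\<kappa> :: real^'n \<Rightarrow> real. radial_cutoff kc N \<kappa>"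
    using radial_cutoff_exists by blast
  have "\<forall>n. \<exists>\<kappa> :: real^'n \<Rightarrow> real. radial_cutoff kc (N n) \<kappa>"
    using kc(2) by (simp add: N_def)
  then obtain \<kappa> :: "nat \<Rightarrow> real^'n \<Rightarrow> real" where "\<And>n. radial_cutoff kc (N n) (\<kappa> n)"
    by metis
  note \<kappa> = radial_cutoffD[OF this]
  define f where "f n x = p x * \<kappa> n x" for n x
  have f_smooth: "smooth (f n)" for n
    unfolding f_def by (intro smooth_mult p \<kappa>(1))
  have f_const: "f n x = 0" if "2 * N n \<le> norm x" for n x
    using \<kappa>(4)[OF that] by (simp add: f_def)
  have Df: "frechet_derivative (f n) (at x) v =
      p x * frechet_derivative (\<kappa> n) (at x) v + frechet_derivative p (at x) v * \<kappa> n x" for n x v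
  proof -
    have "(f n has_derivative (\<lambda>v. p x * frechet_derivative (\<kappa> n) (at x) v + frechet_derivative p (at x) v * \<kappa> n x)) (at x)"
      unfolding f_def by (intro has_derivative_mult smooth_has_derivative p \<kappa>(1))
    from frechet_derivative_at[OF this, symmetric] show ?thesis by simp
  qed
  have f_le: "\<bar>f n x\<bar> \<le> C * (1 + (norm x)\<^sup>2)" for n x
  proof -
    have "\<bar>f n x\<bar> \<le> \<bar>p x\<bar>" unfolding f_def abs_mult using \<kappa>(2,3) by (intro mult_left_le) auto
    then show ?thesis using C(2)[of x] by simp
  qed
  have Df_le: "\<bar>frechet_derivative (f n) (at x) v\<bar> \<le> C * (1 + kc) * (1 + norm x) * norm v" for n x v
  proof -
    have 1: "\<bar>frechet_derivative p (at x) v * \<kappa> n x\<bar> \<le> C * (1 + norm x) * norm v"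
      using mult_left_le[of "\<bar>\<kappa> n x\<bar>" "\<bar>frechet_derivative p (at x) v\<bar>"] \<kappa>(2,3)[of n x] C(3)[of x v]
      by (simp add: abs_mult)
    have "\<bar>p x * frechet_derivative (\<kappa> n) (at x) v\<bar> \<le> C * (1 + (norm x)\<^sup>2) * \<bar>frechet_derivative (\<kappa> n) (at x) v\<bar>"
      unfolding abs_mult using C(2) by (intro mult_right_mono) auto
    also have "\<dots> \<le> C * (kc * (norm x * norm v))"
      unfolding mult.assoc by (intro mult_left_mono \<kappa>(7) C(1))
    also have "\<dots> \<le> C * (kc * ((1 + norm x) * norm v))"
      using C(1) kc(1) by (intro mult_left_mono mult_right_mono) auto
    finally have 2: "\<bar>p x * frechet_derivative (\<kappa> n) (at x) v\<bar> \<le> C * (kc * ((1 + norm x) * norm v))" .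
    have "\<bar>frechet_derivative (f n) (at x) v\<bar> \<le> C * (1 + norm x) * norm v + C * (kc * ((1 + norm x) * norm v))"
      unfolding Df using 1 2 by linarith
    then show ?thesis by (simp add: algebra_simps)
  qed
  have ev: "\<forall>\<^sub>F n in sequentially. f n x = p x \<and> frechet_derivative (f n) (at x) v = frechet_derivative p (at x) v" for x v
  proof -
    obtain n0 where n0: "(norm x)\<^sup>2 \<le> real n0" using real_arch_simple by blast
    show ?thesis
      unfolding eventually_sequentially
    proof (intro exI[of _ n0] allI impI)
      fix n assume "n0 \<le> n"
      then have "(norm x)\<^sup>2 < N n" using n0 by (simp add: N_def)
      then show "f n x = p x \<and> frechet_derivative (f n) (at x) v = frechet_derivative p (at x) v"
        unfolding Df by (simp add: f_def \<kappa>(5,6))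
    qed
  qed
  have a_cont: "continuous_on {0..1} a" using a(1) by (intro DERIV_continuous_on) auto
  obtain ka where ka: "0 \<le> ka" "\<And>t. t \<in> {0..1} \<Longrightarrow> \<bar>a t\<bar> \<le> ka"
    using continuous_path_bounded[OF a_cont] unfolding real_norm_def by blast
  obtain kd where kd: "0 \<le> kd" "\<And>t. t \<in> {0..1} \<Longrightarrow> \<bar>a' t\<bar> \<le> kd"
    using continuous_path_bounded[OF a(2)] unfolding real_norm_def by blast
  obtain K where K: "0 \<le> K" "\<And>t x. t \<in> {0..1} \<Longrightarrow> norm (velocity t x) \<le> K * (norm x + norm (u t x))"
    using velocity_bound by metis
  define w where "w z = kd * (C * (1 + (norm (snd z))\<^sup>2))
      + ka * (C * (1 + kc)) * (K * (2 * (1 + (norm (snd z))\<^sup>2 + (norm (u (fst z) (snd z)))\<^sup>2)))" for z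
  have w_int: "integrable \<nu> w"
    unfolding w_def using second_moment_integrable[OF energy init] energy by auto
  have meas: "(\<lambda>z. a' (fst z) * g (snd z) + a (fst z) * frechet_derivative g (at (snd z)) (velocity (fst z) (snd z)))
      \<in> borel_measurable \<nu>" if g: "smooth g" for g
  proof -
    have "(\<lambda>z. a' (fst z) * g (snd z) + a (fst z) * frechet_derivative g (at (snd z)) (velocity (fst z) (snd z)))
      \<in> borel_measurable strip"
      by (intro continuous_on_strip_measurable continuous_on_add continuous_on_mult continuous_on_strip_fst a(2) a_cont transport_continuous g
          continuous_on_compose2[OF smooth_continuous[OF g, of UNIV] continuous_on_snd[OF continuous_on_id]] subset_UNIV)
    then show ?thesis by (simp add: \<nu>_def)
  qed
  have dom: "norm (a' t * f n x + a t * frechet_derivative (f n) (at x) (velocity t x)) \<le> w (t, x)"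
    if t: "t \<in> {0..1}" for n t x
  proof -
    have "\<bar>a' t * f n x\<bar> \<le> kd * (C * (1 + (norm x)\<^sup>2))"
      unfolding abs_mult using kd(1) kd(2)[OF t] f_le[of n x] by (intro mult_mono) auto
    moreover have "\<bar>a t * frechet_derivative (f n) (at x) (velocity t x)\<bar>
        \<le> ka * (C * (1 + kc) * (1 + norm x) * (K * (norm x + norm (u t x))))"
      unfolding abs_mult
    proof (intro mult_mono ka(2) t)
      show "\<bar>frechet_derivative (f n) (at x) (velocity t x)\<bar> \<le> C * (1 + kc) * (1 + norm x) * (K * (norm x + norm (u t x)))"
        using C(1) kc(1) K(2)[OF t, of x]
        by (intro order_trans[OF Df_le] mult_left_mono) auto
    qed (use ka(1) in auto)
    moreover have "(1 + norm x) * (norm x + norm (u t x)) \<le> 2 * (1 + (norm x)\<^sup>2 + (norm (u t x))\<^sup>2)"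
    proof -
      have "2 * norm x \<le> 1 + (norm x)\<^sup>2" "2 * norm (u t x) \<le> 1 + (norm (u t x))\<^sup>2"
        "2 * (norm x * norm (u t x)) \<le> (norm x)\<^sup>2 + (norm (u t x))\<^sup>2"
        using sum_squares_bound[of 1 "norm x"] sum_squares_bound[of 1 "norm (u t x)"]
          sum_squares_bound[of "norm x" "norm (u t x)"] by (simp_all add: mult.assoc)
      moreover have "(1 + norm x) * (norm x + norm (u t x)) = norm x + norm (u t x) + (norm x)\<^sup>2 + norm x * norm (u t x)"
        by (simp add: algebra_simps power2_eq_square)
      moreover have "0 \<le> (norm (u t x))\<^sup>2" "0 \<le> (norm x)\<^sup>2" by simp_all
      ultimately show ?thesis unfolding distrib_left by linarith
    qed
    then have "(ka * (C * (1 + kc)) * K) * ((1 + norm x) * (norm x + norm (u t x)))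
        \<le> (ka * (C * (1 + kc)) * K) * (2 * (1 + (norm x)\<^sup>2 + (norm (u t x))\<^sup>2))"
      using ka(1) C(1) kc(1) K(1) by (intro mult_left_mono) auto
    ultimately show ?thesis unfolding w_def by (simp add: mult_ac)
  qed
  let ?g = "\<lambda>n z. a' (fst z) * f n (snd z) + a (fst z) * frechet_derivative (f n) (at (snd z)) (velocity (fst z) (snd z))"
  let ?h = "\<lambda>z. a' (fst z) * p (snd z) + a (fst z) * frechet_derivative p (at (snd z)) (velocity (fst z) (snd z))"
  have lim_pt: "AE z in \<nu>. (\<lambda>n. ?g n z) \<longlonglongrightarrow> ?h z"
  proof (intro AE_I2 tendsto_eventually)
    fix z
    show "\<forall>\<^sub>F n in sequentially. ?g n z = ?h z"
      using ev[of "snd z" "velocity (fst z) (snd z)"] by (rule eventually_mono) simp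
  qed
  have dom_AE: "AE z in \<nu>. norm (?g n z) \<le> w z" for n
    using dom by (intro AE_I2) (auto simp: space_\<nu>)
  show "integrable \<nu> ?h"
    by (rule integrable_dominated_convergence[OF meas[OF p] meas[OF f_smooth] w_int lim_pt dom_AE])
  have lim: "(\<lambda>n. \<integral>z. ?g n z \<partial>\<nu>) \<longlonglongrightarrow> (\<integral>z. ?h z \<partial>\<nu>)"
    by (rule integral_dominated_convergence[OF meas[OF p] meas[OF f_smooth] w_int lim_pt dom_AE])
  have lim_end: "(\<lambda>n. \<integral>x. f n x * \<rho> t x \<partial>lborel) \<longlonglongrightarrow> (\<integral>x. p x * \<rho> t x \<partial>lborel)"
    if t: "t \<in> {0..1}" and mom: "integrable lborel (\<lambda>x. (norm x)\<^sup>2 * \<rho> t x)" for t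
  proof (rule integral_dominated_convergence[where w = "\<lambda>x. C * (1 + (norm x)\<^sup>2) * \<rho> t x"])
    have [measurable]: "\<rho> t \<in> borel_measurable borel" by (rule \<rho>_slice_measurable[OF t])
    have [measurable]: "p \<in> borel_measurable borel" "f n \<in> borel_measurable borel" for n
      by (intro borel_measurable_continuous_onI smooth_continuous p f_smooth)+
    show "(\<lambda>x. p x * \<rho> t x) \<in> borel_measurable lborel" "(\<lambda>x. f n x * \<rho> t x) \<in> borel_measurable lborel" for n
      by measurable
    have "integrable lborel (\<lambda>x. C * \<rho> t x + C * ((norm x)\<^sup>2 * \<rho> t x))"
      using \<rho>_integrable[OF t] mom by auto
    then show "integrable lborel (\<lambda>x. C * (1 + (norm x)\<^sup>2) * \<rho> t x)" by (simp add: algebra_simps)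
    show "AE x in lborel. (\<lambda>n. f n x * \<rho> t x) \<longlonglongrightarrow> p x * \<rho> t x"
      by (intro AE_I2 tendsto_eventually eventually_mono[OF ev]) auto
    show "AE x in lborel. norm (f n x * \<rho> t x) \<le> C * (1 + (norm x)\<^sup>2) * \<rho> t x" for n
      using f_le \<rho>_nonneg[OF t] by (intro AE_I2) (auto simp: abs_mult intro!: mult_right_mono)
  qed
  have "(\<lambda>n. a 1 * (\<integral>x. f n x * \<rho> 1 x \<partial>lborel) - a 0 * (\<integral>x. f n x * \<rho> 0 x \<partial>lborel))
      \<longlonglongrightarrow> a 1 * (\<integral>x. p x * \<rho> 1 x \<partial>lborel) - a 0 * (\<integral>x. p x * \<rho> 0 x \<partial>lborel)"
    by (intro tendsto_intros lim_end init final) auto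
  then have "(\<lambda>n. \<integral>z. ?g n z \<partial>\<nu>)
      \<longlonglongrightarrow> a 1 * (\<integral>x. p x * \<rho> 1 x \<partial>lborel) - a 0 * (\<integral>x. p x * \<rho> 0 x \<partial>lborel)"
    using flow_identity_constant_at_infinity[OF f_smooth f_const a] by simp
  from LIMSEQ_unique[OF this lim]
  show "a 1 * (\<integral>x. p x * \<rho> 1 x \<partial>lborel) - a 0 * (\<integral>x. p x * \<rho> 0 x \<partial>lborel) = (\<integral>z. ?h z \<partial>\<nu>)" .
qed

end

section \<open>Verification\<close>

text \<open>The difference of the means of \<open>\<psi> 1\<close> under g1 and of \<open>\<psi> 0\<close> under g0, where
  \<open>\<psi> t x = - x \<bullet> \<Pi>\<^sub>0 t x / 2 + m t \<bullet> x\<close>, written out in the monomials to which the identity for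
  single products applies.\<close>

definition boundary_value ::
  "(real \<Rightarrow> real^'n^'n) \<Rightarrow> (real \<Rightarrow> real^'n) \<Rightarrow> (real^'n \<Rightarrow> real) \<Rightarrow> (real^'n \<Rightarrow> real) \<Rightarrow> real" where
  "boundary_value \<Pi>\<^sub>0 m g0 g1 =
    (\<Sum>i\<in>UNIV. \<Sum>j\<in>UNIV. (- 1/2 * \<Pi>\<^sub>0 1 $ i $ j) * (LINT x|lborel. x $ i * x $ j * g1 x)
      - (- 1/2 * \<Pi>\<^sub>0 0 $ i $ j) * (LINT x|lborel. x $ i * x $ j * g0 x))
    + (\<Sum>i\<in>UNIV. m 1 $ i * (LINT x|lborel. x $ i * g1 x) - m 0 $ i * (LINT x|lborel. x $ i * g0 x))"

lemma boundary_value_cong_AE: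
  assumes [measurable]: "g0 \<in> borel_measurable borel" "g1 \<in> borel_measurable borel"
      "h0 \<in> borel_measurable borel" "h1 \<in> borel_measurable borel"
    and "AE x in lborel. g0 x = h0 x" "AE x in lborel. g1 x = h1 x"
  shows "boundary_value \<Pi>\<^sub>0 m g0 g1 = boundary_value \<Pi>\<^sub>0 m h0 h1"
proof -
  have c: "(LINT x|lborel. f x * g x) = (LINT x|lborel. f x * h x)"
    if "AE x in lborel. g x = h x" and [measurable]: "f \<in> borel_measurable borel" "g \<in> borel_measurable borel" "h \<in> borel_measurable borel"
    for f g h :: "real^'n \<Rightarrow> real"
    using that(1) by (intro integral_cong_AE) (auto elim!: AE_mp)
  have nth [measurable]: "(\<lambda>x :: real^'n. x $ i) \<in> borel_measurable borel" for i
    by (intro borel_measurable_continuous_onI continuous_intros)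
  show ?thesis
    unfolding boundary_value_def
    using c[OF assms(5)] c[OF assms(6)] by simp
qed

text \<open>The function \<open>\<psi> t x = - x \<bullet> \<Pi> x / 2 + m \<bullet> x\<close> solves, up to a function of time, the
  Hamilton-Jacobi equation, so its derivative along any velocity \<open>A x + B v\<close> equals, up to that
  function of time, the right-hand side of Young's inequality \<open>|v|\<^sup>2 / 2 \<ge> v \<bullet> w - |w|\<^sup>2 / 2\<close> with \<open>w = B' \<nabla>\<psi>\<close>.\<close>

lemma hamilton_jacobi_pointwise:
  fixes A :: "real^'n^'n" and B :: "real^'m^'n" and \<Pi>\<^sub>0 :: "real^'n^'n" and m x :: "real^'n" and v :: "real^'m"
  assumes sym: "transpose \<Pi>\<^sub>0 = \<Pi>\<^sub>0"
  defines "P' \<equiv> - (transpose A ** \<Pi>\<^sub>0 + \<Pi>\<^sub>0 ** A - \<Pi>\<^sub>0 ** B ** transpose B ** \<Pi>\<^sub>0)"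
    and "m' \<equiv> - (transpose (A - B ** transpose B ** \<Pi>\<^sub>0) *v m)"
    and "w \<equiv> - (transpose B *v (\<Pi>\<^sub>0 *v x)) + transpose B *v m"
    and "V \<equiv> A *v x + B *v v"
  shows "- 1/2 * (x \<bullet> (P' *v x) + x \<bullet> (\<Pi>\<^sub>0 *v V) + V \<bullet> (\<Pi>\<^sub>0 *v x)) + (m' \<bullet> x + m \<bullet> V)
    = v \<bullet> w - 1/2 * (norm w)\<^sup>2 + 1/2 * (norm (transpose B *v m))\<^sup>2"
proof -
  define y where "y = \<Pi>\<^sub>0 *v x"
  define b c where "b = transpose B *v y" and "c = transpose B *v m"
  have sw: "p \<bullet> (\<Pi>\<^sub>0 *v q) = (\<Pi>\<^sub>0 *v p) \<bullet> q" for p q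
    by (simp add: inner_matrix_vector_right sym)
  have tA: "p \<bullet> (transpose A *v q) = (A *v p) \<bullet> q" for p q
    by (simp add: inner_matrix_vector_right)
  have tB: "p \<bullet> (B *v q) = (transpose B *v p) \<bullet> q" for p and q :: "real^'m"
    by (rule inner_matrix_vector_right)
  have 1: "x \<bullet> (P' *v x) = - 2 * ((A *v x) \<bullet> y) + b \<bullet> b"
    unfolding P'_def
    by (simp add: matrix_distribs inner_diff_right inner_add_right sw tA tB inner_commute[of y] b_def
        flip: matrix_vector_mul_assoc y_def)
  have 2: "x \<bullet> (\<Pi>\<^sub>0 *v V) + V \<bullet> (\<Pi>\<^sub>0 *v x) = 2 * ((A *v x) \<bullet> y) + 2 * (b \<bullet> v)"
  proof -
    have "y \<bullet> V = (A *v x) \<bullet> y + b \<bullet> v"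
      by (simp add: V_def inner_add_right tB b_def inner_commute[of y])
    moreover have "x \<bullet> (\<Pi>\<^sub>0 *v V) = y \<bullet> V" "V \<bullet> (\<Pi>\<^sub>0 *v x) = y \<bullet> V"
      unfolding y_def by (rule sw) (rule inner_commute)
    ultimately show ?thesis by simp
  qed
  have 3: "m' \<bullet> x = - (m \<bullet> (A *v x)) + c \<bullet> b"
  proof -
    have "m' \<bullet> x = - (m \<bullet> ((A - B ** transpose B ** \<Pi>\<^sub>0) *v x))"
      unfolding m'_def by (simp add: inner_matrix_vector_right)
    then show ?thesis
      by (simp add: matrix_distribs inner_diff_right tB b_def c_def flip: matrix_vector_mul_assoc y_def)
  qed
  have 4: "m \<bullet> V = m \<bullet> (A *v x) + c \<bullet> v"
    unfolding V_def by (simp add: inner_add_right tB c_def)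
  have w: "w = c - b" by (simp add: w_def b_def c_def y_def)
  have 5: "(norm w)\<^sup>2 = c \<bullet> c - 2 * (c \<bullet> b) + b \<bullet> b"
    unfolding w power2_norm_eq_inner by (simp add: inner_diff_left inner_diff_right inner_commute[of b c])
  have "- 1/2 * (x \<bullet> (P' *v x) + x \<bullet> (\<Pi>\<^sub>0 *v V) + V \<bullet> (\<Pi>\<^sub>0 *v x)) + (m' \<bullet> x + m \<bullet> V)
    = - 1/2 * (x \<bullet> (P' *v x) + (x \<bullet> (\<Pi>\<^sub>0 *v V) + V \<bullet> (\<Pi>\<^sub>0 *v x))) + (m' \<bullet> x + m \<bullet> V)" by simp
  also have "\<dots> = v \<bullet> w - 1/2 * (norm w)\<^sup>2 + 1/2 * (c \<bullet> c)"
    unfolding 1 2 3 4 5 unfolding w by (simp add: inner_diff_right inner_commute[of v] algebra_simps)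
  finally show ?thesis by (simp add: power2_norm_eq_inner c_def)
qed

context controlled_flow
begin

lemma verification_identity:
  assumes energy: "integrable \<nu> (\<lambda>z. (norm (u (fst z) (snd z)))\<^sup>2)"
    and init: "integrable lborel (\<lambda>x. (norm x)\<^sup>2 * \<rho> 0 x)" and final: "integrable lborel (\<lambda>x. (norm x)\<^sup>2 * \<rho> 1 x)"
    and \<Pi>\<^sub>0: "riccati_solution A B \<Pi>\<^sub>0" and sym: "\<And>t. t \<in> {0..1} \<Longrightarrow> transpose (\<Pi>\<^sub>0 t) = \<Pi>\<^sub>0 t"
    and m: "\<And>t. t \<in> {0..1} \<Longrightarrow> (m has_vector_derivative
        - (transpose (A t - B t ** transpose (B t) ** \<Pi>\<^sub>0 t) *v m t)) (at t within {0..1})"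
    and w_def: "\<And>t x. w t x = - (transpose (B t) *v (\<Pi>\<^sub>0 t *v x)) + transpose (B t) *v m t"
  shows "integrable \<nu> (\<lambda>z. u (fst z) (snd z) \<bullet> w (fst z) (snd z) - 1/2 * (norm (w (fst z) (snd z)))\<^sup>2)"
    and "(\<integral>z. u (fst z) (snd z) \<bullet> w (fst z) (snd z) - 1/2 * (norm (w (fst z) (snd z)))\<^sup>2 \<partial>\<nu>)
      = boundary_value \<Pi>\<^sub>0 m (\<rho> 0) (\<rho> 1) - (\<integral>t. 1/2 * (norm (transpose (B t) *v m t))\<^sup>2 \<partial>unit_time)"
proof -
  define P' where "P' t = - (transpose (A t) ** \<Pi>\<^sub>0 t + \<Pi>\<^sub>0 t ** A t - \<Pi>\<^sub>0 t ** B t ** transpose (B t) ** \<Pi>\<^sub>0 t)" for t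
  define m' where "m' t = - (transpose (A t - B t ** transpose (B t) ** \<Pi>\<^sub>0 t) *v m t)" for t
  have \<Pi>_deriv: "(\<Pi>\<^sub>0 has_vector_derivative P' t) (at t within {0..1})" if "t \<in> {0..1}" for t
    using \<Pi>\<^sub>0 that by (simp add: riccati_solution_def P'_def)
  have \<Pi>_cont: "continuous_on {0..1} \<Pi>\<^sub>0"
    by (auto simp: continuous_on_eq_continuous_within intro: has_vector_derivative_continuous[OF \<Pi>_deriv])
  have m_cont: "continuous_on {0..1} m"
    by (auto simp: continuous_on_eq_continuous_within intro: has_vector_derivative_continuous[OF m])
  have P'_cont: "continuous_on {0..1} P'"
    unfolding P'_def by (intro continuous_intros matrix_continuous_intros A_cont B_cont \<Pi>_cont)
  have m'_cont: "continuous_on {0..1} m'"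
    unfolding m'_def by (intro continuous_intros matrix_continuous_intros A_cont B_cont \<Pi>_cont m_cont)
  have m_deriv: "((\<lambda>t. m t $ i) has_real_derivative m' t $ i) (at t within {0..1})" if "t \<in> {0..1}" for t i
    using bounded_linear.has_vector_derivative[OF bounded_linear_vec_nth m[OF that], of i]
    by (simp add: has_real_derivative_iff_has_vector_derivative m'_def)
  have \<Pi>_nth_deriv: "((\<lambda>t. - 1/2 * \<Pi>\<^sub>0 t $ i $ j) has_real_derivative - 1/2 * P' t $ i $ j) (at t within {0..1})"
    if "t \<in> {0..1}" for t i j
    using bounded_linear.has_vector_derivative[OF bounded_linear_vec_nth
        bounded_linear.has_vector_derivative[OF bounded_linear_vec_nth \<Pi>_deriv[OF that], of i], of j]
    unfolding has_real_derivative_iff_has_vector_derivative[symmetric] by (rule DERIV_cmult)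
  have nth_bl: "bounded_linear (\<lambda>x :: real^'n. x $ i)" for i by (rule bounded_linear_vec_nth)
  have D1: "frechet_derivative (\<lambda>x :: real^'n. x $ i) (at x) v = v $ i" for i x v
    using frechet_derivative_at[OF bounded_linear_imp_has_derivative[OF nth_bl], of i x, symmetric] by simp
  have D2: "frechet_derivative (\<lambda>x :: real^'n. x $ i * x $ j) (at x) v = x $ i * v $ j + v $ i * x $ j" for i j x v
  proof -
    have "((\<lambda>x :: real^'n. x $ i * x $ j) has_derivative (\<lambda>v. x $ i * v $ j + v $ i * x $ j)) (at x)"
      by (intro has_derivative_mult bounded_linear_imp_has_derivative nth_bl)
    from frechet_derivative_at[OF this, symmetric] show ?thesis by simp
  qed
  let ?V = "\<lambda>z. velocity (fst z) (snd z)"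
  let ?q = "\<lambda>i j z. (- 1/2 * P' (fst z) $ i $ j) * (snd z $ i * snd z $ j)
      + (- 1/2 * \<Pi>\<^sub>0 (fst z) $ i $ j) * (snd z $ i * ?V z $ j + ?V z $ i * snd z $ j)"
  let ?l = "\<lambda>i z. m' (fst z) $ i * snd z $ i + m (fst z) $ i * ?V z $ i"
  have quad: "integrable \<nu> (?q i j)"
    "(\<integral>z. ?q i j z \<partial>\<nu>) = (- 1/2 * \<Pi>\<^sub>0 1 $ i $ j) * (LINT x|lborel. x $ i * x $ j * \<rho> 1 x)
      - (- 1/2 * \<Pi>\<^sub>0 0 $ i $ j) * (LINT x|lborel. x $ i * x $ j * \<rho> 0 x)" for i j
  proof -
    have p: "smooth (\<lambda>x :: real^'n. x $ i * x $ j)" by (intro smooth_mult smooth_linear nth_bl)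
    have b1: "\<bar>x $ i * x $ j\<bar> \<le> 2 * (1 + (norm x)\<^sup>2)" for x :: "real^'n"
    proof -
      have "\<bar>x $ i * x $ j\<bar> \<le> (norm x)\<^sup>2"
        using mult_mono[OF component_le_norm_cart[of x i] component_le_norm_cart[of x j]]
        by (simp add: abs_mult power2_eq_square)
      moreover have "0 \<le> (norm x)\<^sup>2" by simp
      ultimately show ?thesis unfolding distrib_left by linarith
    qed
    have b2: "\<bar>frechet_derivative (\<lambda>x :: real^'n. x $ i * x $ j) (at x) v\<bar> \<le> 2 * (1 + norm x) * norm v" for x v
    proof -
      have "\<bar>x $ i * v $ j + v $ i * x $ j\<bar> \<le> \<bar>x $ i\<bar> * \<bar>v $ j\<bar> + \<bar>v $ i\<bar> * \<bar>x $ j\<bar>"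
        using abs_triangle_ineq[of "x $ i * v $ j" "v $ i * x $ j"] by (simp add: abs_mult)
      also have "\<dots> \<le> norm x * norm v + norm v * norm x"
        by (intro add_mono mult_mono component_le_norm_cart) auto
      also have "\<dots> \<le> 2 * (1 + norm x) * norm v" by (simp add: algebra_simps)
      finally show ?thesis unfolding D2 .
    qed
    have c: "continuous_on {0..1} (\<lambda>t. - 1/2 * P' t $ i $ j)"
      by (intro continuous_intros P'_cont)
    note identity = flow_identity_quadratic_growth[OF energy init final p _ b1 b2 \<Pi>_nth_deriv c]
    show "integrable \<nu> (?q i j)" using identity(1) by (simp add: D2)
    show "(\<integral>z. ?q i j z \<partial>\<nu>) = (- 1/2 * \<Pi>\<^sub>0 1 $ i $ j) * (LINT x|lborel. x $ i * x $ j * \<rho> 1 x)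
      - (- 1/2 * \<Pi>\<^sub>0 0 $ i $ j) * (LINT x|lborel. x $ i * x $ j * \<rho> 0 x)"
      using identity(2) by (simp add: D2)
  qed
  have lin: "integrable \<nu> (?l i)"
    "(\<integral>z. ?l i z \<partial>\<nu>) = m 1 $ i * (LINT x|lborel. x $ i * \<rho> 1 x) - m 0 $ i * (LINT x|lborel. x $ i * \<rho> 0 x)" for i
  proof -
    have p: "smooth (\<lambda>x :: real^'n. x $ i)" by (intro smooth_linear nth_bl)
    have b1: "\<bar>x $ i\<bar> \<le> 1 * (1 + (norm x)\<^sup>2)" for x :: "real^'n"
      using component_le_norm_cart[of x i] sum_squares_bound[of 1 "norm x"] by simp
    have b2: "\<bar>frechet_derivative (\<lambda>x :: real^'n. x $ i) (at x) v\<bar> \<le> 1 * (1 + norm x) * norm v" for x v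
      using component_le_norm_cart[of v i] by (simp add: D1 distrib_right add_increasing2)
    have c: "continuous_on {0..1} (\<lambda>t. m' t $ i)" by (intro continuous_intros m'_cont)
    note identity = flow_identity_quadratic_growth[OF energy init final p _ b1 b2 m_deriv c]
    show "integrable \<nu> (?l i)" using identity(1) by (simp add: D1)
    show "(\<integral>z. ?l i z \<partial>\<nu>) = m 1 $ i * (LINT x|lborel. x $ i * \<rho> 1 x) - m 0 $ i * (LINT x|lborel. x $ i * \<rho> 0 x)"
      using identity(2) by (simp add: D1)
  qed
  have bil: "(\<Sum>i\<in>UNIV. \<Sum>j\<in>UNIV. M $ i $ j * (p $ i * q $ j)) = p \<bullet> (M *v q)" for M :: "real^'n^'n" and p q
    by (simp add: inner_vec_def matrix_vector_mult_def sum_distrib_left mult_ac)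
  have pointwise: "(\<Sum>i\<in>UNIV. \<Sum>j\<in>UNIV. ?q i j z) + (\<Sum>i\<in>UNIV. ?l i z)
      = u (fst z) (snd z) \<bullet> w (fst z) (snd z) - 1/2 * (norm (w (fst z) (snd z)))\<^sup>2
        + 1/2 * (norm (transpose (B (fst z)) *v m (fst z)))\<^sup>2" if "fst z \<in> {0..1}" for z
  proof -
    define t x where "t = fst z" and "x = snd z"
    have "(\<Sum>i\<in>UNIV. \<Sum>j\<in>UNIV. ?q i j z) = - 1/2 * ((\<Sum>i\<in>UNIV. \<Sum>j\<in>UNIV. P' t $ i $ j * (x $ i * x $ j))
        + (\<Sum>i\<in>UNIV. \<Sum>j\<in>UNIV. \<Pi>\<^sub>0 t $ i $ j * (x $ i * velocity t x $ j))
        + (\<Sum>i\<in>UNIV. \<Sum>j\<in>UNIV. \<Pi>\<^sub>0 t $ i $ j * (velocity t x $ i * x $ j)))"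
      unfolding t_def[symmetric] x_def[symmetric] sum_distrib_left sum.distrib[symmetric]
      by (intro sum.cong refl) (simp add: algebra_simps)
    moreover have "(\<Sum>i\<in>UNIV. ?l i z) = m' t \<bullet> x + m t \<bullet> velocity t x"
      unfolding t_def[symmetric] x_def[symmetric] by (simp add: inner_vec_def sum.distrib)
    ultimately show ?thesis
      using hamilton_jacobi_pointwise[OF sym[OF that], of x "A t" "B t" "u t x" "m t"]
      unfolding bil velocity_def w_def P'_def m'_def t_def[symmetric] x_def[symmetric] by simp
  qed
  let ?k = "\<lambda>t. 1/2 * (norm (transpose (B t) *v m t))\<^sup>2"
  have k_cont: "continuous_on {0..1} ?k"
    by (intro continuous_intros matrix_continuous_intros B_cont m_cont)
  have k_int: "integrable \<nu> (\<lambda>z. ?k (fst z))" and k_val: "(\<integral>z. ?k (fst z) \<partial>\<nu>) = (\<integral>t. ?k t \<partial>unit_time)"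
  proof -
    obtain c where c: "\<And>t. t \<in> {0..1} \<Longrightarrow> \<bar>?k t\<bar> \<le> c"
      using continuous_path_bounded[OF k_cont] unfolding real_norm_def by blast
    show int: "integrable \<nu> (\<lambda>z. ?k (fst z))"
    proof (rule \<nu>_integrable_bounded)
      show "(\<lambda>z. ?k (fst z)) \<in> borel_measurable strip"
        by (intro continuous_on_strip_measurable continuous_on_compose2[OF k_cont]) (auto intro: continuous_intros)
    qed (use c in simp)
    show "(\<integral>z. ?k (fst z) \<partial>\<nu>) = (\<integral>t. ?k t \<partial>unit_time)"
      unfolding \<nu>_disintegration(2)[OF int]
      by (intro Bochner_Integration.integral_cong) (auto simp: \<rho>_integral)
  qed
  let ?h = "\<lambda>z. u (fst z) (snd z) \<bullet> w (fst z) (snd z) - 1/2 * (norm (w (fst z) (snd z)))\<^sup>2"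
  let ?s = "\<lambda>z. (\<Sum>i\<in>UNIV. \<Sum>j\<in>UNIV. ?q i j z) + (\<Sum>i\<in>UNIV. ?l i z)"
  have s_int: "integrable \<nu> ?s"
    by (intro Bochner_Integration.integrable_add Bochner_Integration.integrable_sum quad lin)
  have s_val: "(\<integral>z. ?s z \<partial>\<nu>) = boundary_value \<Pi>\<^sub>0 m (\<rho> 0) (\<rho> 1)"
  proof -
    have "(\<integral>z. ?s z \<partial>\<nu>) = (\<integral>z. (\<Sum>i\<in>UNIV. \<Sum>j\<in>UNIV. ?q i j z) \<partial>\<nu>) + (\<integral>z. (\<Sum>i\<in>UNIV. ?l i z) \<partial>\<nu>)"
      by (intro Bochner_Integration.integral_add Bochner_Integration.integrable_sum quad lin)
    also have "(\<integral>z. (\<Sum>i\<in>UNIV. \<Sum>j\<in>UNIV. ?q i j z) \<partial>\<nu>) = (\<Sum>i\<in>UNIV. \<Sum>j\<in>UNIV. (\<integral>z. ?q i j z \<partial>\<nu>))"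
      by (subst Bochner_Integration.integral_sum, intro Bochner_Integration.integrable_sum quad,
          intro sum.cong refl Bochner_Integration.integral_sum quad)
    also have "(\<integral>z. (\<Sum>i\<in>UNIV. ?l i z) \<partial>\<nu>) = (\<Sum>i\<in>UNIV. (\<integral>z. ?l i z \<partial>\<nu>))"
      by (intro Bochner_Integration.integral_sum lin)
    finally show ?thesis unfolding quad(2) lin(2) boundary_value_def .
  qed
  have eq: "?h z = ?s z - ?k (fst z)" if "z \<in> space \<nu>" for z
    using pointwise[of z] that by (auto simp: space_\<nu>)
  have diff_int: "integrable \<nu> (\<lambda>z. ?s z - ?k (fst z))"
    by (intro Bochner_Integration.integrable_diff s_int k_int)
  then show "integrable \<nu> ?h"
    by (rule Bochner_Integration.integrable_cong[THEN iffD1, rotated 2]) (simp_all only: eq)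
  have "(\<integral>z. ?h z \<partial>\<nu>) = (\<integral>z. ?s z - ?k (fst z) \<partial>\<nu>)"
    by (intro Bochner_Integration.integral_cong refl eq)
  also have "\<dots> = (\<integral>z. ?s z \<partial>\<nu>) - (\<integral>z. ?k (fst z) \<partial>\<nu>)"
    by (intro Bochner_Integration.integral_diff s_int k_int)
  finally show "(\<integral>z. ?h z \<partial>\<nu>) = boundary_value \<Pi>\<^sub>0 m (\<rho> 0) (\<rho> 1) - (\<integral>t. ?k t \<partial>unit_time)"
    unfolding s_val k_val .
qed

end

section \<open>The feedback flow and its optimality\<close>

lemma gaussian_density_nonneg:
  assumes "pos_def \<Sigma>"
  shows "0 \<le> gaussian_density \<mu> \<Sigma> x"
proof -
  have "det \<Sigma> = det (msqrt \<Sigma>) * det (msqrt \<Sigma>)"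
    using msqrt(2)[of \<Sigma>] assms by (simp add: pos_def_iff flip: det_mul)
  then show ?thesis by (simp add: gaussian_density_def)
qed

text \<open>The Gaussian has finite mass here because it agrees almost everywhere with a probability density.\<close>

lemma density_flow_second_moment:
  assumes flow: "density_flow \<rho>" and t: "t \<in> {0..1}" and \<Sigma>: "pos_def \<Sigma>"
    and AE: "AE x in lborel. \<rho> t x = gaussian_density \<mu> \<Sigma> x"
    and meas: "\<rho> t \<in> borel_measurable borel"
  shows "integrable lborel (\<lambda>x. (norm x)\<^sup>2 * \<rho> t x)"
proof -
  have [measurable]: "\<rho> t \<in> borel_measurable borel" by (rule meas)
  have "(\<integral>\<^sup>+x. ennreal (gaussian_density \<mu> \<Sigma> x) \<partial>lborel) = (\<integral>\<^sup>+x. ennreal (\<rho> t x) \<partial>lborel)"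
    using AE by (intro nn_integral_cong_AE) auto
  also have "\<dots> = 1" using flow t by (simp add: density_flow_def)
  finally have "(\<integral>\<^sup>+x. ennreal ((norm x)\<^sup>2 * gaussian_density \<mu> \<Sigma> x) \<partial>lborel) < \<infinity>"
    by (intro gaussian_second_moment_finite \<Sigma>) simp
  also have "(\<integral>\<^sup>+x. ennreal ((norm x)\<^sup>2 * gaussian_density \<mu> \<Sigma> x) \<partial>lborel)
      = (\<integral>\<^sup>+x. ennreal ((norm x)\<^sup>2 * \<rho> t x) \<partial>lborel)"
    using AE by (intro nn_integral_cong_AE) auto
  finally show ?thesis
    using flow t by (intro integrableI_nonneg) (auto simp: density_flow_def)
qed

locale gaussian_steering = covariance_steering A B \<Phi> \<Phi>hat \<Pi>\<^sub>0 \<Sigma>\<^sub>0 \<Sigma>\<^sub>1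
  for A :: "real \<Rightarrow> real^'n^'n" and B :: "real \<Rightarrow> real^'m^'n"
    and \<Phi> \<Phi>hat :: "real \<Rightarrow> real \<Rightarrow> real^'n^'n" and \<Pi>\<^sub>0 :: "real \<Rightarrow> real^'n^'n"
    and \<Sigma>\<^sub>0 \<Sigma>\<^sub>1 :: "real^'n^'n" +
  fixes m\<^sub>0 m\<^sub>1 :: "real^'n" and m :: "real \<Rightarrow> real^'n"
    and P :: "'w measure" and X :: "real \<Rightarrow> 'w \<Rightarrow> real^'n"
    and \<rho> :: "real \<Rightarrow> real^'n \<Rightarrow> real" and u :: "real \<Rightarrow> real^'n \<Rightarrow> real^'m"
  assumes m: "\<And>t. t \<in> {0..1} \<Longrightarrow>
      m t = transpose (\<Phi>hat 1 t) *v (matrix_inv (gramian B \<Phi>hat 1 0) *v (m\<^sub>1 - \<Phi>hat 1 0 *v m\<^sub>0))"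
    and P: "prob_space P"
    and X0: "distributed P lborel (X 0) (\<lambda>x. ennreal (gaussian_density m\<^sub>0 \<Sigma>\<^sub>0 x))"
    and X: "AE \<omega> in P. \<forall>t\<in>{0..1}. ((\<lambda>t. X t \<omega>) has_vector_derivative
        (A t - B t ** transpose (B t) ** \<Pi>\<^sub>0 t) *v X t \<omega> + (B t ** transpose (B t)) *v m t) (at t within {0..1})"
    and \<rho>_nonneg: "\<And>t x. t \<in> {0..1} \<Longrightarrow> 0 \<le> \<rho> t x"
    and \<rho>_joint: "jointly_measurable_on_strip \<rho>"
    and \<rho>: "\<And>t. t \<in> {0..1} \<Longrightarrow> distributed P lborel (X t) (\<lambda>x. ennreal (\<rho> t x))"
    and u: "\<And>t x. t \<in> {0..1} \<Longrightarrow> u t x = - (transpose (B t) *v (\<Pi>\<^sub>0 t *v x)) + transpose (B t) *v m t"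
begin

sublocale prob_space P by (rule P)

lemma m_deriv:
  assumes "t \<in> {0..1}"
  shows "(m has_vector_derivative - (transpose (A t - B t ** transpose (B t) ** \<Pi>\<^sub>0 t) *v m t)) (at t within {0..1})"
proof -
  let ?z = "matrix_inv (gramian B \<Phi>hat 1 0) *v (m\<^sub>1 - \<Phi>hat 1 0 *v m\<^sub>0)"
  have "((\<lambda>t. transpose (\<Phi>hat 1 t) *v ?z) has_vector_derivative
      - (transpose (A t - B t ** transpose (B t) ** \<Pi>\<^sub>0 t) *v m t)) (at t within {0..1})"
    using cls.adjoint_deriv[of 1 t ?z] assms by (simp add: m)
  then show ?thesis
    by (rule has_vector_derivative_transform[rotated 2]) (use assms m in auto)
qed

lemma m_continuous: "continuous_on {0..1} m"
  by (auto simp: continuous_on_eq_continuous_within intro: has_vector_derivative_continuous[OF m_deriv])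

lemma X_measurable: "t \<in> {0..1} \<Longrightarrow> X t \<in> borel_measurable P"
  using \<rho>[of t] by (simp add: distributed_def)

text \<open>Almost every path is a solution, so one exists; it serves as the origin relative to which
  almost all paths are images of the initial state under the homogeneous flow.\<close>

definition reference_solution :: "(real \<Rightarrow> real^'n) \<Rightarrow> bool" where
  "reference_solution xb \<longleftrightarrow> (\<forall>t\<in>{0..1}. (xb has_vector_derivative
     (A t - B t ** transpose (B t) ** \<Pi>\<^sub>0 t) *v xb t + (B t ** transpose (B t)) *v m t) (at t within {0..1}))"

lemma reference_solution_exists: "\<exists>xb. reference_solution xb"
proof (rule ccontr)
  assume no: "\<not> ?thesis"
  from X have "AE \<omega> in P. False"
  proof eventually_elim
    case (elim \<omega>)
    then have "reference_solution (\<lambda>t. X t \<omega>)" by (simp add: reference_solution_def)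
    with no show ?case by blast
  qed
  then show False by simp
qed

lemma reference_solution_continuous:
  assumes "reference_solution xb"
  shows "continuous_on {0..1} xb"
  using assms unfolding reference_solution_def continuous_on_eq_continuous_within
  by (blast intro: has_vector_derivative_continuous)

lemma closed_loop_homogeneous:
  assumes t: "t \<in> {0..1}"
  shows "((\<lambda>t. \<Phi>hat t 0 *v v) has_vector_derivative
    (A t - B t ** transpose (B t) ** \<Pi>\<^sub>0 t) *v (\<Phi>hat t 0 *v v)) (at t within {0..1})"
  using has_vector_derivative_matrix_vector_mult[OF cls.transition_deriv[of 0 t] has_vector_derivative_const] t
  by (simp add: matrix_vector_mul_assoc)

text \<open>A version of the process that solves the equation for every outcome: a particular solution
  plus the homogeneous flow of the initial deviation from it.  It is jointly measurable.\<close>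

lemma regular_version_deriv:
  assumes xb: "reference_solution xb" and t: "t \<in> {0..1}"
  shows "((\<lambda>t. \<Phi>hat t 0 *v (y - xb 0) + xb t) has_vector_derivative
        (A t - B t ** transpose (B t) ** \<Pi>\<^sub>0 t) *v (\<Phi>hat t 0 *v (y - xb 0) + xb t) + (B t ** transpose (B t)) *v m t)
        (at t within {0..1})"
proof -
  have "(xb has_vector_derivative
     (A t - B t ** transpose (B t) ** \<Pi>\<^sub>0 t) *v xb t + (B t ** transpose (B t)) *v m t) (at t within {0..1})"
    using xb t by (simp add: reference_solution_def)
  from has_vector_derivative_add[OF closed_loop_homogeneous[OF t] this]
  show ?thesis by (rule has_vector_derivative_eq_rhs) (simp add: matrix_vector_right_distrib)
qed

lemma regular_version_AE:
  assumes xb: "reference_solution xb" and t: "t \<in> {0..1}"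
  shows "AE \<omega> in P. X t \<omega> = \<Phi>hat t 0 *v (X 0 \<omega> - xb 0) + xb t"
  using X
proof eventually_elim
  case (elim \<omega>)
  let ?L = "\<lambda>t. A t - B t ** transpose (B t) ** \<Pi>\<^sub>0 t"
  have "X t \<omega> - xb t = \<Phi>hat t 0 *v (X 0 \<omega> - xb 0)"
  proof (rule linear_solution_unique[OF closed_loop_continuous, of "\<lambda>t. X t \<omega> - xb t" "\<lambda>t. \<Phi>hat t 0 *v (X 0 \<omega> - xb 0)" 0 t])
    show "((\<lambda>t. X t \<omega> - xb t) has_vector_derivative ?L s *v (X s \<omega> - xb s)) (at s within {0..1})" if s: "s \<in> {0..1}" for s
    proof -
      have "(xb has_vector_derivative ?L s *v xb s + (B s ** transpose (B s)) *v m s) (at s within {0..1})"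
        using xb s by (simp add: reference_solution_def)
      from has_vector_derivative_diff[OF elim[rule_format, OF s] this] show ?thesis
        by (rule has_vector_derivative_eq_rhs) (simp only: matrix_vector_mult_diff_distrib add_diff_add diff_self add_0_right)
    qed
  qed (use t closed_loop_homogeneous in auto)
  then show ?case by (simp add: algebra_simps)
qed

lemma density_flow_\<rho>: "density_flow \<rho>"
  unfolding density_flow_def
proof (intro conjI ballI allI impI)
  fix t :: real assume t: "t \<in> {0..1}"
  have "(\<integral>\<^sup>+x. ennreal (\<rho> t x) * 1 \<partial>lborel) = (\<integral>\<^sup>+\<omega>. 1 \<partial>P)"
    by (rule distributed_nn_integral[OF \<rho>[OF t]]) simp
  then show "(\<integral>\<^sup>+x. ennreal (\<rho> t x) \<partial>lborel) = 1" by (simp add: emeasure_space_1)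
next
  fix f :: "real^'n \<Rightarrow> real" assume f: "continuous_on UNIV f \<and> bounded (range f)"
  then have [measurable]: "f \<in> borel_measurable borel" by (intro borel_measurable_continuous_onI) simp
  obtain c where c: "\<And>x. \<bar>f x\<bar> \<le> c" using f unfolding bounded_iff by auto
  obtain xb where ref: "reference_solution xb" using reference_solution_exists by blast
  note xb = reference_solution_continuous[OF ref] regular_version_AE[OF ref]
  have [measurable]: "X 0 \<in> borel_measurable P" by (rule X_measurable) simp
  let ?Y = "\<lambda>t \<omega>. \<Phi>hat t 0 *v (X 0 \<omega> - xb 0) + xb t"
  have E: "(LINT x|lborel. f x * \<rho> t x) = (\<integral>\<omega>. f (?Y t \<omega>) \<partial>P)" if t: "t \<in> {0..1}" for t
  proof -
    have [measurable]: "X t \<in> borel_measurable P" by (rule X_measurable[OF t])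
    have "(LINT x|lborel. f x * \<rho> t x) = (LINT x|lborel. \<rho> t x * f x)" by (simp add: mult.commute)
    also have "\<dots> = (\<integral>\<omega>. f (X t \<omega>) \<partial>P)"
      by (rule distributed_integral[OF \<rho>[OF t]]) (use \<rho>_nonneg[OF t] in auto)
    also have "\<dots> = (\<integral>\<omega>. f (?Y t \<omega>) \<partial>P)"
      using xb(2)[OF t] by (intro integral_cong_AE) auto
    finally show ?thesis .
  qed
  have path: "continuous_on {0..1} (\<lambda>t. f (?Y t \<omega>))" for \<omega>
  proof (rule continuous_on_compose2[of UNIV f])
    show "continuous_on {0..1} (\<lambda>t. ?Y t \<omega>)"
      by (intro continuous_on_add matrix_continuous_intros(2) continuous_on_const xb(1) cls.continuous_transition) simp
  qed (use f in auto)
  have "continuous_on {0..1} (\<lambda>t. \<integral>\<omega>. f (?Y t \<omega>) \<partial>P)"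
    unfolding continuous_on_sequentially comp_def
  proof safe
    fix s :: "nat \<Rightarrow> real" and t assume t: "t \<in> {0..1}" and s: "\<forall>n. s n \<in> {0..1}" "s \<longlonglongrightarrow> t"
    show "(\<lambda>n. \<integral>\<omega>. f (?Y (s n) \<omega>) \<partial>P) \<longlonglongrightarrow> (\<integral>\<omega>. f (?Y t \<omega>) \<partial>P)"
    proof (rule integral_dominated_convergence[where w = "\<lambda>_. c"])
      show "AE \<omega> in P. (\<lambda>n. f (?Y (s n) \<omega>)) \<longlonglongrightarrow> f (?Y t \<omega>)"
        using path t s unfolding continuous_on_sequentially comp_def by auto
    qed (use c in auto)
  qed
  then show "continuous_on {0..1} (\<lambda>t. LINT x|lborel. f x * \<rho> t x)"
    by (subst continuous_on_cong[OF refl E])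
qed (use \<rho>_nonneg \<rho>_joint in auto)

lemma u_continuous: "continuous_on ({0..1} \<times> UNIV) (\<lambda>(t, x). u t x)"
proof -
  have "continuous_on ({0..1} \<times> UNIV) (\<lambda>z. - (transpose (B (fst z)) *v (\<Pi>\<^sub>0 (fst z) *v snd z))
      + transpose (B (fst z)) *v m (fst z))"
    by (intro continuous_intros matrix_continuous_intros continuous_on_strip_fst B Riccati_continuous m_continuous)
  then show ?thesis
    by (rule continuous_on_eq) (auto simp: u)
qed

text \<open>Along every path of the regular version, the integrand of the continuity equation is the
  time derivative of \<open>\<phi> (t, x t)\<close>, which integrates to zero because \<open>\<phi>\<close> vanishes at both ends.\<close>

lemma continuity_equation_\<rho>: "continuity_equation A B \<rho> u"
  unfolding continuity_equation_def
proof (intro allI impI)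
  fix \<phi> :: "real \<times> (real^'n) \<Rightarrow> real" assume \<phi>: "test_function \<phi>"
  then have smooth: "smooth \<phi>" and comp: "compact (closure {z. \<phi> z \<noteq> 0})"
    and supp: "closure {z. \<phi> z \<noteq> 0} \<subseteq> {0<..<1} \<times> UNIV"
    by (auto simp: test_function_def)
  define g where "g z = frechet_derivative \<phi> (at z) (1, A (fst z) *v snd z + B (fst z) *v u (fst z) (snd z))" for z
  have uc: "continuous_on ({0..1} \<times> UNIV) (\<lambda>z. u (fst z) (snd z))"
    using u_continuous by (simp add: case_prod_beta)
  have g_cont: "continuous_on ({0..1} \<times> UNIV) g"
    unfolding g_def by (intro smooth_frechet_derivative_continuous[OF smooth] continuous_intros matrix_continuous_intros
        continuous_on_strip_fst A B uc)
  have g_0: "g z = 0" if z: "z \<notin> closure {z. \<phi> z \<noteq> 0}" for z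
  proof -
    have "((\<lambda>_. 0) has_derivative (\<lambda>_. 0)) (at z)" by simp
    then have "(\<phi> has_derivative (\<lambda>_. 0)) (at z)"
      by (rule has_derivative_transform_within_open[where s = "- closure {z. \<phi> z \<noteq> 0}"])
        (use z closure_subset[of "{z. \<phi> z \<noteq> 0}"] in auto)
    from frechet_derivative_at[OF this, symmetric] show ?thesis by (simp add: g_def)
  qed
  have "bounded (g ` closure {z. \<phi> z \<noteq> 0})"
    using supp by (intro compact_imp_bounded compact_continuous_image continuous_on_subset[OF g_cont] comp) force
  then obtain k0 where "\<forall>y\<in>g ` closure {z. \<phi> z \<noteq> 0}. norm y \<le> k0" unfolding bounded_iff by blast
  then have k: "\<bar>g z\<bar> \<le> max k0 0" for z
    using g_0[of z] by (cases "z \<in> closure {z. \<phi> z \<noteq> 0}") auto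
  obtain xb where ref: "reference_solution xb" using reference_solution_exists by blast
  note xb = reference_solution_continuous[OF ref] regular_version_AE[OF ref] regular_version_deriv[OF ref]
  let ?Y = "\<lambda>t y. \<Phi>hat t 0 *v (y - xb 0) + xb t"
  have [measurable]: "X 0 \<in> borel_measurable P" by (rule X_measurable) simp
  have Yc: "continuous_on ({0..1} \<times> UNIV) (\<lambda>z. (fst z, ?Y (fst z) (snd z)))"
    by (intro continuous_intros matrix_continuous_intros continuous_on_strip_fst xb(1)
        continuous_on_strip_fst[where h = "\<lambda>t. \<Phi>hat t 0"] cls.continuous_transition) simp
  let ?G = "\<lambda>t \<omega>. g (t, ?Y t (X 0 \<omega>))"
  have "continuous_on ({0..1} \<times> UNIV) (\<lambda>z. g (fst z, ?Y (fst z) (snd z)))"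
    by (rule continuous_on_compose2[OF g_cont Yc]) auto
  from continuous_on_strip_measurable[OF this]
  have gY: "(\<lambda>z. g (fst z, ?Y (fst z) (snd z))) \<in> borel_measurable (unit_time \<Otimes>\<^sub>M borel)"
    by (simp cong: measurable_cong_sets sets_pair_measure_cong)
  have "(\<lambda>z. (fst z, X 0 (snd z))) \<in> measurable (unit_time \<Otimes>\<^sub>M P) (unit_time \<Otimes>\<^sub>M borel)"
    by measurable
  from measurable_compose[OF this gY]
  have G_meas: "case_prod ?G \<in> borel_measurable (unit_time \<Otimes>\<^sub>M P)"
    by (simp add: case_prod_beta)
  interpret TP: pair_prob_space unit_time P ..
  have G_int: "integrable (unit_time \<Otimes>\<^sub>M P) (case_prod ?G)"
    by (rule TP.integrable_const_bound[of _ "max k0 0"]) (use k G_meas in \<open>auto simp: case_prod_beta\<close>)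
  have inner: "(LINT x|lborel. frechet_derivative \<phi> (at (t, x)) (1, A t *v x + B t *v u t x) * \<rho> t x) = (\<integral>\<omega>. ?G t \<omega> \<partial>P)"
    if t: "t \<in> {0..1}" for t
  proof -
    have [measurable]: "X t \<in> borel_measurable P" by (rule X_measurable[OF t])
    have "continuous_on UNIV (\<lambda>x. g (t, x))"
      by (rule continuous_on_compose2[OF g_cont]) (use t in \<open>auto intro!: continuous_intros\<close>)
    then have [measurable]: "(\<lambda>x. g (t, x)) \<in> borel_measurable borel" by (rule borel_measurable_continuous_onI)
    have "(LINT x|lborel. frechet_derivative \<phi> (at (t, x)) (1, A t *v x + B t *v u t x) * \<rho> t x) = (LINT x|lborel. \<rho> t x * g (t, x))"
      by (simp add: g_def mult.commute)
    also have "\<dots> = (\<integral>\<omega>. g (t, X t \<omega>) \<partial>P)"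
      by (rule distributed_integral[OF \<rho>[OF t]]) (use \<rho>_nonneg[OF t] in auto)
    also have "\<dots> = (\<integral>\<omega>. ?G t \<omega> \<partial>P)"
    proof (rule integral_cong_AE)
      show "AE \<omega> in P. g (t, X t \<omega>) = ?G t \<omega>" using xb(2)[OF t] by eventually_elim simp
    qed measurable
    finally show ?thesis .
  qed
  have path: "(\<integral>t. ?G t \<omega> \<partial>unit_time) = 0" for \<omega>
  proof -
    let ?y = "\<lambda>t. ?Y t (X 0 \<omega>)"
    have d: "((\<lambda>t. \<phi> (t, ?y t)) has_real_derivative ?G t \<omega>) (at t within {0..1})" if t: "t \<in> {0..1}" for t
    proof -
      have v: "(A t - B t ** transpose (B t) ** \<Pi>\<^sub>0 t) *v ?y t + (B t ** transpose (B t)) *v m t = A t *v ?y t + B t *v u t (?y t)"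
        using t by (simp add: u matrix_distribs flip: matrix_vector_mul_assoc)
      have "((\<lambda>t. (t, ?y t)) has_vector_derivative (1, A t *v ?y t + B t *v u t (?y t))) (at t within {0..1})"
        using xb(3)[OF t, of "X 0 \<omega>"] unfolding v by (intro has_vector_derivative_Pair has_vector_derivative_id)
      then have "((\<lambda>t. (t, ?y t)) has_derivative (\<lambda>h. h *\<^sub>R (1, A t *v ?y t + B t *v u t (?y t)))) (at t within {0..1})"
        by (simp add: has_vector_derivative_def)
      from has_derivative_compose[OF this smooth_has_derivative[OF smooth]]
      have "((\<lambda>t. \<phi> (t, ?y t)) has_derivative (\<lambda>h. h *\<^sub>R ?G t \<omega>)) (at t within {0..1})"
        unfolding g_def fst_conv snd_conv
          linear_cmul[OF has_derivative_linear[OF smooth_has_derivative[OF smooth]]] .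
      then show ?thesis by (simp add: has_field_derivative_def mult.commute[of _ "?G t \<omega>"])
    qed
    have "continuous_on {0..1} (\<lambda>t. (t, X 0 \<omega>))" by (intro continuous_intros)
    then have "continuous_on {0..1} (\<lambda>t. ?G t \<omega>)"
      by (intro continuous_on_compose2[OF \<open>continuous_on ({0..1} \<times> UNIV) (\<lambda>z. g (fst z, ?Y (fst z) (snd z)))\<close>, of _ "\<lambda>t. (t, X 0 \<omega>)", simplified]) auto
    from integral_unit_time_FTC[OF d this, of 0 1]
    have "(\<integral>t. indicator {0..1} t * ?G t \<omega> \<partial>unit_time) = \<phi> (1, ?y 1) - \<phi> (0, ?y 0)" by simp
    also have "\<dots> = 0"
    proof -
      have "\<phi> (1, y) = 0" "\<phi> (0, y) = 0" for y
        using supp closure_subset[of "{z. \<phi> z \<noteq> 0}"] by fastforce+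
      then show ?thesis by simp
    qed
    also have "(\<integral>t. indicator {0..1} t * ?G t \<omega> \<partial>unit_time) = (\<integral>t. ?G t \<omega> \<partial>unit_time)"
      by (intro Bochner_Integration.integral_cong) auto
    finally show ?thesis .
  qed
  have "(LINT t:{0..1}|lborel. (LINT x|lborel. frechet_derivative \<phi> (at (t, x)) (1, A t *v x + B t *v u t x) * \<rho> t x))
      = (\<integral>t. (\<integral>\<omega>. ?G t \<omega> \<partial>P) \<partial>unit_time)"
    unfolding integral_unit_time[symmetric] by (intro Bochner_Integration.integral_cong) (auto simp: inner)
  also have "\<dots> = (\<integral>\<omega>. (\<integral>t. ?G t \<omega> \<partial>unit_time) \<partial>P)"
    using TP.Fubini_integral[OF G_int] by simp
  also have "\<dots> = 0" by (simp add: path)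
  finally show "(LINT t:{0..1}|lborel. (LINT x|lborel. frechet_derivative \<phi> (at (t, x)) (1, A t *v x + B t *v u t x) * \<rho> t x)) = 0" .
qed

lemma \<rho>_initial: "AE x in lborel. \<rho> 0 x = gaussian_density m\<^sub>0 \<Sigma>\<^sub>0 x"
  using distributed_unique[OF \<rho>[of 0] X0] \<rho>_nonneg[of 0] gaussian_density_nonneg[OF \<Sigma>\<^sub>0, of m\<^sub>0]
  by (auto elim!: AE_mp)

lemma \<rho>_final: "AE x in lborel. \<rho> 1 x = gaussian_density m\<^sub>1 \<Sigma>\<^sub>1 x"
proof -
  let ?T = "\<lambda>x. \<Phi>hat 1 0 *v (x - m\<^sub>0) + m\<^sub>1"
  have [measurable]: "X 0 \<in> borel_measurable P" "X 1 \<in> borel_measurable P" by (auto intro: X_measurable)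
  have eq: "AE \<omega> in P. X 1 \<omega> = ?T (X 0 \<omega>)"
    using X by eventually_elim (rule closed_loop_steers_mean[OF _ m], auto)
  have inv: "invertible (\<Phi>hat 1 0)"
    using cls.transition_compose[of 1 0 1] by (auto simp: invertible_right_inverse)
  have "distr P lborel (X 1) = distr P lborel (\<lambda>\<omega>. ?T (X 0 \<omega>))"
    using eq by (intro distr_cong_AE) auto
  also have "\<dots> = distr (distr P lborel (X 0)) lborel ?T"
    by (subst distr_distr) (auto simp: comp_def)
  also have "distr P lborel (X 0) = density lborel (\<lambda>x. ennreal (gaussian_density m\<^sub>0 \<Sigma>\<^sub>0 x))"
    using X0 by (simp add: distributed_def)
  also have "distr \<dots> lborel ?T = density lborel (\<lambda>x. ennreal (gaussian_density m\<^sub>1 (\<Phi>hat 1 0 ** \<Sigma>\<^sub>0 ** transpose (\<Phi>hat 1 0)) x))"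
    using \<Sigma>\<^sub>0 by (intro distr_gaussian_affine inv) (simp add: pos_def_iff)
  also have "\<Phi>hat 1 0 ** \<Sigma>\<^sub>0 ** transpose (\<Phi>hat 1 0) = \<Sigma>\<^sub>1" by (rule closed_loop_covariance)
  finally have "distributed P lborel (X 1) (\<lambda>x. ennreal (gaussian_density m\<^sub>1 \<Sigma>\<^sub>1 x))"
    by (simp add: distributed_def)
  from distributed_unique[OF \<rho>[of 1] this] show ?thesis
    using \<rho>_nonneg[of 1] gaussian_density_nonneg[OF \<Sigma>\<^sub>1, of m\<^sub>1] by (auto elim!: AE_mp)
qed

lemma feasible_\<rho>: "feasible A B (gaussian_density m\<^sub>0 \<Sigma>\<^sub>0) (gaussian_density m\<^sub>1 \<Sigma>\<^sub>1) \<rho> u"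
  unfolding feasible_def
  using density_flow_\<rho> u_continuous continuity_equation_\<rho> \<rho>_initial \<rho>_final by blast

sublocale optimal: controlled_flow A B \<rho> u
  by unfold_locales (fact A, fact B, fact density_flow_\<rho>, fact u_continuous, fact continuity_equation_\<rho>)

text \<open>The control is affine in the state, and the state at every time is an affine function, with
  bounded coefficients, of the Gaussian initial state.\<close>

lemma energy_integrable: "integrable optimal.\<nu> (\<lambda>z. (norm (u (fst z) (snd z)))\<^sup>2)"
proof -
  obtain xb where ref: "reference_solution xb" using reference_solution_exists by blast
  note xb = reference_solution_continuous[OF ref] regular_version_AE[OF ref]
  have [measurable]: "X 0 \<in> borel_measurable P" by (rule X_measurable) simp
  have "continuous_on {0..1} (\<lambda>t. - (transpose (B t) ** \<Pi>\<^sub>0 t))"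
    by (intro continuous_intros matrix_continuous_intros B Riccati_continuous)
  from matrix_path_bounded[OF this] obtain k1 where k1: "0 \<le> k1"
    "\<And>t x. t \<in> {0..1} \<Longrightarrow> norm (- (transpose (B t) ** \<Pi>\<^sub>0 t) *v x) \<le> k1 * norm x"
    by blast
  have "continuous_on {0..1} (\<lambda>t. transpose (B t) *v m t)"
    by (intro continuous_intros matrix_continuous_intros B m_continuous)
  from continuous_path_bounded[OF this] obtain k2 where k2: "0 \<le> k2" "\<And>t. t \<in> {0..1} \<Longrightarrow> norm (transpose (B t) *v m t) \<le> k2"
    by blast
  obtain k3 where k3: "0 \<le> k3" "\<And>t x. t \<in> {0..1} \<Longrightarrow> norm (\<Phi>hat t 0 *v x) \<le> k3 * norm x"
    using matrix_path_bounded[OF cls.continuous_transition[of 0]] by force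
  obtain k4 where k4: "0 \<le> k4" "\<And>t. t \<in> {0..1} \<Longrightarrow> norm (xb t) \<le> k4"
    using continuous_path_bounded[OF xb(1)] by blast
  define c where "c = k1 * k3 + (k1 * (k3 * k4 + k4) + k2)"
  have u_le: "(norm (u t (\<Phi>hat t 0 *v (y - xb 0) + xb t)))\<^sup>2 \<le> 2 * c\<^sup>2 + 2 * c\<^sup>2 * (norm y)\<^sup>2" if t: "t \<in> {0..1}" for t y
  proof -
    let ?x = "\<Phi>hat t 0 *v (y - xb 0) + xb t"
    have "norm ?x \<le> k3 * norm (y - xb 0) + k4"
      using norm_triangle_ineq[of "\<Phi>hat t 0 *v (y - xb 0)" "xb t"] k3(2)[OF t, of "y - xb 0"] k4(2)[OF t] by linarith
    also have "\<dots> \<le> k3 * (norm y + k4) + k4"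
      using norm_triangle_ineq4[of y "xb 0"] k4(2)[of 0] k3(1) by (intro add_right_mono mult_left_mono) auto
    finally have x: "norm ?x \<le> k3 * (norm y + k4) + k4" .
    have u_eq: "u t x = - (transpose (B t) ** \<Pi>\<^sub>0 t) *v x + transpose (B t) *v m t" for x
      by (simp add: u[OF t] matrix_vector_mul_assoc bounded_bilinear.minus_left[OF bounded_bilinear_matrix_vector_mult])
    have "norm (u t ?x) \<le> k1 * norm ?x + k2"
      using norm_triangle_ineq[of "- (transpose (B t) ** \<Pi>\<^sub>0 t) *v ?x" "transpose (B t) *v m t"]
        k1(2)[OF t, of ?x] k2(2)[OF t] unfolding u_eq by linarith
    also have "\<dots> \<le> k1 * (k3 * (norm y + k4) + k4) + k2"
      using x k1(1) by (intro add_right_mono mult_left_mono) auto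
    also have "\<dots> = k1 * k3 * norm y + (k1 * (k3 * k4 + k4) + k2) * 1" by (simp add: algebra_simps)
    also have "\<dots> \<le> c * norm y + c * 1"
    proof -
      have "k1 * k3 \<le> c" "k1 * (k3 * k4 + k4) + k2 \<le> c"
        unfolding c_def using k1(1) k2(1) k3(1) k4(1) by simp_all
      then show ?thesis by (intro add_mono mult_right_mono) auto
    qed
    finally have "(norm (u t ?x))\<^sup>2 \<le> (c * norm y + c * 1)\<^sup>2" by (intro power_mono) auto
    also have "\<dots> = c\<^sup>2 * (1 + norm y)\<^sup>2" by (simp add: algebra_simps flip: power_mult_distrib)
    also have "\<dots> \<le> c\<^sup>2 * (2 + 2 * (norm y)\<^sup>2)"
      using sum_squares_bound[of 1 "norm y"] by (intro mult_left_mono) (auto simp: power2_sum)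
    finally show ?thesis by (simp add: algebra_simps)
  qed
  have "(\<integral>\<^sup>+x. ennreal (gaussian_density m\<^sub>0 \<Sigma>\<^sub>0 x) * 1 \<partial>lborel) = (\<integral>\<^sup>+\<omega>. 1 \<partial>P)"
    by (rule distributed_nn_integral[OF X0]) simp
  then have "(\<integral>\<^sup>+x. ennreal (gaussian_density m\<^sub>0 \<Sigma>\<^sub>0 x) \<partial>lborel) < \<infinity>" by (simp add: emeasure_space_1)
  from gaussian_second_moment_finite[OF \<Sigma>\<^sub>0 this]
  have "(\<integral>\<^sup>+x. ennreal (gaussian_density m\<^sub>0 \<Sigma>\<^sub>0 x) * ennreal ((norm x)\<^sup>2) \<partial>lborel) < \<infinity>"
    using gaussian_density_nonneg[OF \<Sigma>\<^sub>0, of m\<^sub>0] by (simp add: mult.commute flip: ennreal_mult')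
  also have "(\<integral>\<^sup>+x. ennreal (gaussian_density m\<^sub>0 \<Sigma>\<^sub>0 x) * ennreal ((norm x)\<^sup>2) \<partial>lborel) = (\<integral>\<^sup>+\<omega>. ennreal ((norm (X 0 \<omega>))\<^sup>2) \<partial>P)"
    by (rule distributed_nn_integral[OF X0]) simp
  finally have X0_moment: "(\<integral>\<^sup>+\<omega>. ennreal ((norm (X 0 \<omega>))\<^sup>2) \<partial>P) < \<infinity>" .
  have slice: "(\<integral>\<^sup>+x. ennreal (\<rho> t x) * ennreal ((norm (u t x))\<^sup>2) \<partial>lborel)
      \<le> ennreal (2 * c\<^sup>2) + ennreal (2 * c\<^sup>2) * (\<integral>\<^sup>+\<omega>. ennreal ((norm (X 0 \<omega>))\<^sup>2) \<partial>P)" if t: "t \<in> {0..1}" for t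
  proof -
    have "continuous_on UNIV (\<lambda>x. u t x)"
      by (rule continuous_on_compose2[OF u_continuous, of _ "\<lambda>x. (t, x)", simplified])
        (use t in \<open>auto intro!: continuous_intros\<close>)
    then have [measurable]: "u t \<in> borel_measurable borel" by (rule borel_measurable_continuous_onI)
    have "(\<integral>\<^sup>+x. ennreal (\<rho> t x) * ennreal ((norm (u t x))\<^sup>2) \<partial>lborel) = (\<integral>\<^sup>+\<omega>. ennreal ((norm (u t (X t \<omega>)))\<^sup>2) \<partial>P)"
      by (rule distributed_nn_integral[OF \<rho>[OF t]]) simp
    also have "\<dots> \<le> (\<integral>\<^sup>+\<omega>. ennreal (2 * c\<^sup>2) + ennreal (2 * c\<^sup>2) * ennreal ((norm (X 0 \<omega>))\<^sup>2) \<partial>P)"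
    proof (rule nn_integral_mono_AE)
      show "AE \<omega> in P. ennreal ((norm (u t (X t \<omega>)))\<^sup>2) \<le> ennreal (2 * c\<^sup>2) + ennreal (2 * c\<^sup>2) * ennreal ((norm (X 0 \<omega>))\<^sup>2)"
        using xb(2)[OF t]
        by eventually_elim (use u_le[OF t] in \<open>simp add: flip: ennreal_mult' ennreal_plus\<close>)
    qed
    also have "\<dots> = ennreal (2 * c\<^sup>2) + ennreal (2 * c\<^sup>2) * (\<integral>\<^sup>+\<omega>. ennreal ((norm (X 0 \<omega>))\<^sup>2) \<partial>P)"
      by (subst nn_integral_add) (auto simp: nn_integral_cmult emeasure_space_1)
    finally show ?thesis .
  qed
  have "(\<integral>\<^sup>+z. ennreal ((norm (u (fst z) (snd z)))\<^sup>2) \<partial>optimal.\<nu>)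
      = (\<integral>\<^sup>+t. \<integral>\<^sup>+x. ennreal (\<rho> t x) * ennreal ((norm (u t x))\<^sup>2) \<partial>lborel \<partial>unit_time)"
    using optimal.u_measurable by (subst optimal.nn_integral_\<nu>) auto
  also have "\<dots> \<le> (\<integral>\<^sup>+t. ennreal (2 * c\<^sup>2) + ennreal (2 * c\<^sup>2) * (\<integral>\<^sup>+\<omega>. ennreal ((norm (X 0 \<omega>))\<^sup>2) \<partial>P) \<partial>unit_time)"
    by (intro nn_integral_mono slice) simp
  also have "\<dots> = ennreal (2 * c\<^sup>2) + ennreal (2 * c\<^sup>2) * (\<integral>\<^sup>+\<omega>. ennreal ((norm (X 0 \<omega>))\<^sup>2) \<partial>P)"
    using unit_time.emeasure_space_1 by simp
  also have "\<dots> < \<infinity>" using X0_moment by (simp add: ennreal_mult_less_top)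
  finally show ?thesis
    using optimal.u_measurable by (intro integrableI_nonneg) (auto simp: optimal.\<nu>_def)
qed

text \<open>Both pairs satisfy the verification identity with the same boundary value; it is an equality for
  the cost of the feedback flow and, by Young's inequality, a lower bound for the other cost.\<close>

lemma cost_optimal:
  assumes feas: "feasible A B (gaussian_density m\<^sub>0 \<Sigma>\<^sub>0) (gaussian_density m\<^sub>1 \<Sigma>\<^sub>1) \<rho>' u'"
  shows "cost \<rho> u \<le> cost \<rho>' u'"
proof -
  interpret other: controlled_flow A B \<rho>' u'
    using feas A B by unfold_locales (auto simp: feasible_def)
  let ?E = "\<lambda>z. 1/2 * (norm (u (fst z) (snd z)))\<^sup>2" and ?E' = "\<lambda>z. 1/2 * (norm (u' (fst z) (snd z)))\<^sup>2"
  show ?thesis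
  proof (cases "cost \<rho>' u' = \<infinity>")
    case False
    have E'_int: "integrable other.\<nu> ?E'"
    proof (rule integrableI_nonneg)
      show "(\<integral>\<^sup>+z. ennreal (?E' z) \<partial>other.\<nu>) < \<infinity>"
        using False by (simp add: other.cost_eq_nn_integral_\<nu> top.not_eq_extremum)
    qed (use other.u_measurable in \<open>auto simp: other.\<nu>_def\<close>)
    then have energy': "integrable other.\<nu> (\<lambda>z. (norm (u' (fst z) (snd z)))\<^sup>2)"
      using integrable_mult_right[OF E'_int, of 2] by simp
    have E_int: "integrable optimal.\<nu> ?E" using energy_integrable by simp
    have ends': "AE x in lborel. \<rho>' 0 x = gaussian_density m\<^sub>0 \<Sigma>\<^sub>0 x" "AE x in lborel. \<rho>' 1 x = gaussian_density m\<^sub>1 \<Sigma>\<^sub>1 x"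
      using feas by (auto simp: feasible_def)
    have moments: "integrable lborel (\<lambda>x. (norm x)\<^sup>2 * \<rho> 0 x)" "integrable lborel (\<lambda>x. (norm x)\<^sup>2 * \<rho> 1 x)"
      "integrable lborel (\<lambda>x. (norm x)\<^sup>2 * \<rho>' 0 x)" "integrable lborel (\<lambda>x. (norm x)\<^sup>2 * \<rho>' 1 x)"
      using density_flow_second_moment[OF optimal.flow _ \<Sigma>\<^sub>0 \<rho>_initial] density_flow_second_moment[OF optimal.flow _ \<Sigma>\<^sub>1 \<rho>_final]
        density_flow_second_moment[OF other.flow _ \<Sigma>\<^sub>0 ends'(1)] density_flow_second_moment[OF other.flow _ \<Sigma>\<^sub>1 ends'(2)]
        optimal.\<rho>_slice_measurable other.\<rho>_slice_measurable by auto
    define w where "w t x = - (transpose (B t) *v (\<Pi>\<^sub>0 t *v x)) + transpose (B t) *v m t" for t x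
    note w = w_def
    note duality = optimal.verification_identity[OF energy_integrable moments(1,2) riccati Riccati_sym m_deriv w]
    note duality' = other.verification_identity[OF energy' moments(3,4) riccati Riccati_sym m_deriv w]
    have ends: "boundary_value \<Pi>\<^sub>0 m (\<rho> 0) (\<rho> 1) = boundary_value \<Pi>\<^sub>0 m (\<rho>' 0) (\<rho>' 1)"
      using \<rho>_initial \<rho>_final ends' optimal.\<rho>_slice_measurable other.\<rho>_slice_measurable
      by (intro boundary_value_cong_AE) (auto elim!: AE_mp)
    have "(\<integral>z. ?E z \<partial>optimal.\<nu>) = (\<integral>z. u (fst z) (snd z) \<bullet> w (fst z) (snd z) - 1/2 * (norm (w (fst z) (snd z)))\<^sup>2 \<partial>optimal.\<nu>)"
      by (intro Bochner_Integration.integral_cong) (auto simp: optimal.space_\<nu> u w_def power2_norm_eq_inner)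
    also have "\<dots> = (\<integral>z. u' (fst z) (snd z) \<bullet> w (fst z) (snd z) - 1/2 * (norm (w (fst z) (snd z)))\<^sup>2 \<partial>other.\<nu>)"
      using duality(2) duality'(2) ends by (metis (no_types, lifting))
    also have "\<dots> \<le> (\<integral>z. ?E' z \<partial>other.\<nu>)"
    proof (rule integral_mono[OF duality'(1) E'_int])
      fix z
      let ?v = "u' (fst z) (snd z)" and ?w = "w (fst z) (snd z)"
      have "0 \<le> (?v - ?w) \<bullet> (?v - ?w)" by simp
      then show "?v \<bullet> ?w - 1/2 * (norm ?w)\<^sup>2 \<le> 1/2 * (norm ?v)\<^sup>2"
        by (simp add: power2_norm_eq_inner inner_diff_left inner_diff_right inner_commute[of ?w ?v])
    qed
    finally have "ennreal (\<integral>z. ?E z \<partial>optimal.\<nu>) \<le> ennreal (\<integral>z. ?E' z \<partial>other.\<nu>)" by (rule ennreal_leI)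
    then show ?thesis
      unfolding optimal.cost_eq_nn_integral_\<nu> other.cost_eq_nn_integral_\<nu>
      using E_int E'_int by (subst (1 2) nn_integral_eq_integral) auto
  qed simp
qed

end

theorem proposition4:
  fixes A :: "real \<Rightarrow> real^'n^'n" and B :: "real \<Rightarrow> real^'m^'n"
    and m\<^sub>0 m\<^sub>1 :: "real^'n" and \<Sigma>\<^sub>0 \<Sigma>\<^sub>1 :: "real^'n^'n"
    and \<Phi> \<Phi>hat :: "real \<Rightarrow> real \<Rightarrow> real^'n^'n"
    and \<Pi>\<^sub>0 :: "real \<Rightarrow> real^'n^'n"
    and m :: "real \<Rightarrow> real^'n"
    and P :: "'w measure" and X :: "real \<Rightarrow> 'w \<Rightarrow> real^'n"
    and \<rho> :: "real \<Rightarrow> real^'n \<Rightarrow> real"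
    and u :: "real \<Rightarrow> real^'n \<Rightarrow> real^'m"
  assumes "continuous_on {0..1} A" and "continuous_on {0..1} B"
    and "transition_matrix A \<Phi>"
    and "controllable B \<Phi>"
    and "pos_def \<Sigma>\<^sub>0" and "pos_def \<Sigma>\<^sub>1"
    and "riccati_solution A B \<Pi>\<^sub>0"
    and "\<Pi>\<^sub>0 0 = riccati_init \<Sigma>\<^sub>0 \<Sigma>\<^sub>1 (\<Phi> 1 0) (gramian B \<Phi> 1 0)"
    and "transition_matrix (\<lambda>t. A t - B t ** transpose (B t) ** \<Pi>\<^sub>0 t) \<Phi>hat"
    and "\<And>t. t \<in> {0..1} \<Longrightarrow>
           m t = transpose (\<Phi>hat 1 t) *v
                   (matrix_inv (gramian B \<Phi>hat 1 0) *v (m\<^sub>1 - \<Phi>hat 1 0 *v m\<^sub>0))"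
    and "prob_space P"
    and "distributed P lborel (X 0) (\<lambda>x. ennreal (gaussian_density m\<^sub>0 \<Sigma>\<^sub>0 x))"
    and "AE \<omega> in P. \<forall>t\<in>{0..1}.
           ((\<lambda>t. X t \<omega>) has_vector_derivative
              (A t - B t ** transpose (B t) ** \<Pi>\<^sub>0 t) *v X t \<omega> + (B t ** transpose (B t)) *v m t)
           (at t within {0..1})"
    and "\<And>t x. t \<in> {0..1} \<Longrightarrow> 0 \<le> \<rho> t x"
    and "jointly_measurable_on_strip \<rho>"
    and "\<And>t. t \<in> {0..1} \<Longrightarrow> distributed P lborel (X t) (\<lambda>x. ennreal (\<rho> t x))"
    and "\<And>t x. t \<in> {0..1} \<Longrightarrow>
           u t x = - (transpose (B t) *v (\<Pi>\<^sub>0 t *v x)) + transpose (B t) *v m t"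
  shows "minimizer A B (gaussian_density m\<^sub>0 \<Sigma>\<^sub>0) (gaussian_density m\<^sub>1 \<Sigma>\<^sub>1) \<rho> u"
proof -
  interpret covariance_steering A B \<Phi> \<Phi>hat \<Pi>\<^sub>0 \<Sigma>\<^sub>0 \<Sigma>\<^sub>1
    by unfold_locales (fact assms)+
  interpret gaussian_steering A B \<Phi> \<Phi>hat \<Pi>\<^sub>0 \<Sigma>\<^sub>0 \<Sigma>\<^sub>1 m\<^sub>0 m\<^sub>1 m P X \<rho> u
    by (intro gaussian_steering.intro gaussian_steering_axioms.intro)
      (fact covariance_steering_axioms assms(11) assms(12) assms(13) assms(15)
        | erule assms(10) assms(14) assms(16) assms(17))+
  show ?thesis
    unfolding minimizer_def using feasible_\<rho> cost_optimal by blast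
qed

end
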